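(* For any $0<\varepsilon\le\sqrt6(\sqrt{15}-3)$, there is an algorithm which, given an ordered list of independent nonnegative random variables $X_1,\dots,X_n$ (by their distributions) and the penalty $C\ge1$, runs in $\mathcal{O}\!\left(n^{2(6/\varepsilon)^5}/\varepsilon^{10}\right)$ time and computes a polynomial-size policy $\mathcal{P}$ that sequentially packs the items into bins of size $1+\varepsilon$ and incurs an expected cost (with respect to bins of size $1+\varepsilon$) of at most \[ (1+\varepsilon)\,\mathrm{cost}(\mathrm{OPT}), \] where $\mathrm{OPT}$ is the optimal policy sequentially packing the items into bins of unit capacity.
   Context: Offline sequential model. $C\ge1$ is a penalty parameter. The items are independent nonnegative random variables $X_1,\dots,X_n$ whose distributions are known in advance. Items are packed sequentially in the fixed order $1,\dots,n$ into homogeneous bins of capacity $c$: at round $i$ a policy chooses the bin for item $i$ as a function of the history (the bins chosen for and the realized sizes of items $1,\dots,i-1$); then the size of $X_i$ is revealed. The usage of a bin is the sum of the realized sizes of the items packed into it. A bin of capacity $c$ is overflowed once its usage exceeds $c$; a policy never packs an item into an already overflowed bin. A bin is opened when it receives its first item. With $N_{\mathcal{P}}$ the number of bins opened and $O_{\mathcal{P}}$ the number of bins overflowed, the expected cost of $\mathcal{P}$ with respect to bins of capacity $c$ is $\mathbf{E}[N_{\mathcal{P}}]+C\,\mathbf{E}[O_{\mathcal{P}}]$. $\mathrm{cost}(\mathrm{OPT})$ is the infimum of the expected cost with respect to bins of capacity $1$. "Polynomial-size" means of size polynomial in $n$ for fixed $\varepsilon$. *)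

theory Defs
  imports "HOL-Probability.Probability"
begin

section \<open>Sequential packing policies\<close>

text \<open>
  Items are numbered from 0, bins are labelled by arbitrary natural numbers, and
  \<open>x i\<close> is the realized size of item \<open>i\<close>.  A policy maps the history, i.e. the
  list of pairs (chosen bin, realized size) of the earlier items, to the next bin.
\<close>

type_synonym policy = "(nat \<times> real) list \<Rightarrow> nat"

fun history :: "policy \<Rightarrow> (nat \<Rightarrow> real) \<Rightarrow> nat \<Rightarrow> (nat \<times> real) list" where
  "history P x 0 = []"
| "history P x (Suc i) = history P x i @ [(P (history P x i), x i)]"

definition choice :: "policy \<Rightarrow> (nat \<Rightarrow> real) \<Rightarrow> nat \<Rightarrow> nat" where
  "choice P x i = P (history P x i)"

text \<open>The usage of bin \<open>b\<close> just before round \<open>i\<close>.\<close>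

definition usage :: "policy \<Rightarrow> (nat \<Rightarrow> real) \<Rightarrow> nat \<Rightarrow> nat \<Rightarrow> real" where
  "usage P x i b = (\<Sum>j | j < i \<and> choice P x j = b. x j)"

definition bins_opened :: "nat \<Rightarrow> policy \<Rightarrow> (nat \<Rightarrow> real) \<Rightarrow> nat" where
  "bins_opened n P x = card (choice P x ` {..<n})"

definition bins_overflowed :: "real \<Rightarrow> nat \<Rightarrow> policy \<Rightarrow> (nat \<Rightarrow> real) \<Rightarrow> nat" where
  "bins_overflowed c n P x = card {b \<in> choice P x ` {..<n}. c < usage P x n b}"

definition item_distribution :: "real measure \<Rightarrow> bool" where
  "item_distribution D \<longleftrightarrow> real_distribution D \<and> (AE y in D. 0 \<le> y)"

text \<open>The joint law of independent items with the given list of distributions.\<close>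

definition joint :: "real measure list \<Rightarrow> (nat \<Rightarrow> real) measure" where
  "joint Ds = Pi\<^sub>M {..<length Ds} (\<lambda>i. Ds ! i)"

text \<open>
  Measurability of the choices is what makes the expected cost below meaningful:
  the Bochner integral of a non-measurable function is 0 by convention.
\<close>

definition admissible :: "real \<Rightarrow> nat \<Rightarrow> policy \<Rightarrow> bool" where
  "admissible c n P \<longleftrightarrow>
     (\<forall>i<n. (\<lambda>x. choice P x i) \<in> measurable (Pi\<^sub>M {..<n} (\<lambda>_. borel)) (count_space UNIV)) \<and>
     (\<forall>x. (\<forall>j<n. 0 \<le> x j) \<longrightarrow> (\<forall>i<n. usage P x i (choice P x i) \<le> c))"

definition expected_cost :: "real \<Rightarrow> real \<Rightarrow> real measure list \<Rightarrow> policy \<Rightarrow> real" where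
  "expected_cost c C Ds P =
     (\<integral>x. real (bins_opened (length Ds) P x) \<partial>joint Ds)
     + C * (\<integral>x. real (bins_overflowed c (length Ds) P x) \<partial>joint Ds)"

definition cost_OPT :: "real \<Rightarrow> real measure list \<Rightarrow> real" where
  "cost_OPT C Ds = (INF P \<in> {P. admissible 1 (length Ds) P}. expected_cost 1 C Ds P)"


section \<open>Machine model\<close>

text \<open>
  A real random access machine, programmed in a structured language.  The memory
  consists of arrays of natural numbers and arrays of real numbers; a program
  mentions only finitely many array names.  There are no real constants, and no
  operation (floor, integer division) that turns reals into integers or
  unpacks integers.  The only access to the distributions is \<open>Query\<close>, which
  evaluates the cumulative distribution function of one item at one point.
  Every expression node and every executed command costs one unit of time.
\<close>

record memory =
  nmem :: "string \<Rightarrow> nat \<Rightarrow> nat"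
  rmem :: "string \<Rightarrow> nat \<Rightarrow> real"

definition set_nmem :: "string \<Rightarrow> nat \<Rightarrow> nat \<Rightarrow> memory \<Rightarrow> memory" where
  "set_nmem a i v s = s\<lparr>nmem := (nmem s)(a := (nmem s a)(i := v))\<rparr>"

definition set_rmem :: "string \<Rightarrow> nat \<Rightarrow> real \<Rightarrow> memory \<Rightarrow> memory" where
  "set_rmem a i v s = s\<lparr>rmem := (rmem s)(a := (rmem s a)(i := v))\<rparr>"

datatype nexp =
    NConst nat
  | NGet string nexp
  | NPlus nexp nexp
  | NMinus nexp nexp
  | NTimes nexp nexp

datatype rexp =
    ROfNat nexp
  | RGet string nexp
  | RPlus rexp rexp
  | RMinus rexp rexp
  | RTimes rexp rexp
  | RDivide rexp rexp

datatype bexp =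
    NLess nexp nexp
  | RLess rexp rexp
  | BNot bexp
  | BAnd bexp bexp

fun nval :: "nexp \<Rightarrow> memory \<Rightarrow> nat" where
  "nval (NConst k) s = k"
| "nval (NGet a e) s = nmem s a (nval e s)"
| "nval (NPlus e f) s = nval e s + nval f s"
| "nval (NMinus e f) s = nval e s - nval f s"
| "nval (NTimes e f) s = nval e s * nval f s"

fun rval :: "rexp \<Rightarrow> memory \<Rightarrow> real" where
  "rval (ROfNat e) s = real (nval e s)"
| "rval (RGet a e) s = rmem s a (nval e s)"
| "rval (RPlus e f) s = rval e s + rval f s"
| "rval (RMinus e f) s = rval e s - rval f s"
| "rval (RTimes e f) s = rval e s * rval f s"
| "rval (RDivide e f) s = rval e s / rval f s"

fun bval :: "bexp \<Rightarrow> memory \<Rightarrow> bool" where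
  "bval (NLess e f) s \<longleftrightarrow> nval e s < nval f s"
| "bval (RLess e f) s \<longleftrightarrow> rval e s < rval f s"
| "bval (BNot b) s \<longleftrightarrow> \<not> bval b s"
| "bval (BAnd b d) s \<longleftrightarrow> bval b s \<and> bval d s"

fun ncost :: "nexp \<Rightarrow> nat" where
  "ncost (NConst k) = 1"
| "ncost (NGet a e) = 1 + ncost e"
| "ncost (NPlus e f) = 1 + ncost e + ncost f"
| "ncost (NMinus e f) = 1 + ncost e + ncost f"
| "ncost (NTimes e f) = 1 + ncost e + ncost f"

fun rcost :: "rexp \<Rightarrow> nat" where
  "rcost (ROfNat e) = 1 + ncost e"
| "rcost (RGet a e) = 1 + ncost e"
| "rcost (RPlus e f) = 1 + rcost e + rcost f"
| "rcost (RMinus e f) = 1 + rcost e + rcost f"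
| "rcost (RTimes e f) = 1 + rcost e + rcost f"
| "rcost (RDivide e f) = 1 + rcost e + rcost f"

fun bcost :: "bexp \<Rightarrow> nat" where
  "bcost (NLess e f) = 1 + ncost e + ncost f"
| "bcost (RLess e f) = 1 + rcost e + rcost f"
| "bcost (BNot b) = 1 + bcost b"
| "bcost (BAnd b d) = 1 + bcost b + bcost d"

datatype com =
    Skip
  | NSet string nexp nexp
  | RSet string nexp rexp
  | Query string nexp nexp rexp
  | Seq com com
  | Cond bexp com com
  | While bexp com

text \<open>
  \<open>exec F c s t s'\<close>: started in memory \<open>s\<close>, the program \<open>c\<close> halts after \<open>t\<close> units of
  time with memory \<open>s'\<close>, where \<open>F j y\<close> is the answer to a query about item \<open>j\<close> at \<open>y\<close>.
\<close>

inductive exec ::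
  "(nat \<Rightarrow> real \<Rightarrow> real) \<Rightarrow> com \<Rightarrow> memory \<Rightarrow> nat \<Rightarrow> memory \<Rightarrow> bool"
  for F :: "nat \<Rightarrow> real \<Rightarrow> real"
where
  exec_Skip: "exec F Skip s 1 s"
| exec_NSet: "exec F (NSet a i e) s (1 + ncost i + ncost e) (set_nmem a (nval i s) (nval e s) s)"
| exec_RSet: "exec F (RSet a i e) s (1 + ncost i + rcost e) (set_rmem a (nval i s) (rval e s) s)"
| exec_Query: "exec F (Query a i j e) s (1 + ncost i + ncost j + rcost e)
                 (set_rmem a (nval i s) (F (nval j s) (rval e s)) s)"
| exec_Seq: "exec F c s t s' \<Longrightarrow> exec F d s' u s'' \<Longrightarrow> exec F (Seq c d) s (1 + t + u) s''"
| exec_CondT: "bval b s \<Longrightarrow> exec F c s t s' \<Longrightarrow> exec F (Cond b c d) s (1 + bcost b + t) s'"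
| exec_CondF: "\<not> bval b s \<Longrightarrow> exec F d s t s' \<Longrightarrow> exec F (Cond b c d) s (1 + bcost b + t) s'"
| exec_WhileF: "\<not> bval b s \<Longrightarrow> exec F (While b c) s (1 + bcost b) s"
| exec_WhileT: "bval b s \<Longrightarrow> exec F c s t s' \<Longrightarrow> exec F (While b c) s' u s'' \<Longrightarrow>
                exec F (While b c) s (1 + bcost b + t + u) s''"

definition cdf_answers :: "real measure list \<Rightarrow> nat \<Rightarrow> real \<Rightarrow> real" where
  "cdf_answers Ds j y = (if j < length Ds then cdf (Ds ! j) y else 0)"

definition input_memory :: "real \<Rightarrow> real \<Rightarrow> nat \<Rightarrow> memory" where
  "input_memory \<epsilon> C n =
     set_nmem ''n'' 0 n (set_rmem ''C'' 0 C (set_rmem ''eps'' 0 \<epsilon>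
       \<lparr>nmem = (\<lambda>_ _. 0), rmem = (\<lambda>_ _. 0)\<rparr>))"


section \<open>Policies represented by tables\<close>

text \<open>
  A policy is represented by a memory content \<open>s\<close> (the computed table) that a fixed
  decision program \<open>d\<close> consults once per item.  In every round \<open>d\<close> leaves the chosen
  bin in \<open>''bin''\<close>; the realized size of the item is then written to \<open>''size''\<close>, where
  \<open>d\<close> finds it in the next round.  Queries are answered by 0 here, so
  decisions are based on the table and on the observed sizes only.

  \<open>decides d B s xs s'\<close>: after the sizes \<open>xs\<close> have been observed, the memory
  following the next decision is \<open>s'\<close>, and no decision took more than \<open>B\<close> units of time.
\<close>

inductive decides :: "com \<Rightarrow> nat \<Rightarrow> memory \<Rightarrow> real list \<Rightarrow> memory \<Rightarrow> bool"
  for d :: com and B :: nat and s :: memory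
where
  decides_first: "exec (\<lambda>_ _. 0) d s t s' \<Longrightarrow> t \<le> B \<Longrightarrow> decides d B s [] s'"
| decides_later: "decides d B s xs s' \<Longrightarrow> exec (\<lambda>_ _. 0) d (set_rmem ''size'' 0 y s') t s'' \<Longrightarrow>
                  t \<le> B \<Longrightarrow> decides d B s (xs @ [y]) s''"

definition table_size_le :: "memory \<Rightarrow> nat \<Rightarrow> bool" where
  "table_size_le s B \<longleftrightarrow>
     finite {(a, i). nmem s a i \<noteq> 0} \<and> finite {(a, i). rmem s a i \<noteq> 0} \<and>
     card {(a, i). nmem s a i \<noteq> 0} + card {(a, i). rmem s a i \<noteq> 0} \<le> B"

text \<open>
  The size of a representation accounts for the table and for the time of a
  decision; the latter excludes a small table with an expensive interpreter.
\<close>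

definition represents :: "com \<Rightarrow> memory \<Rightarrow> nat \<Rightarrow> nat \<Rightarrow> policy \<Rightarrow> bool" where
  "represents d s B n P \<longleftrightarrow>
     table_size_le s B \<and>
     (\<forall>x. (\<forall>j<n. 0 \<le> x j) \<longrightarrow>
        (\<forall>i<n. \<exists>s'. decides d B s (map x [0..<i]) s' \<and> nmem s' ''bin'' 0 = choice P x i))"

end

theory Submission
  imports Defs
begin

text \<open>
  Measure sizes in units of \<open>1 / (nQ)\<close>, rounded up, and keep for every bin only a coarse level,
  a multiple of \<open>1 / Q\<close>.  An item of \<open>k = qn + r\<close> units raises the level of its bin by \<open>q + 1\<close> with
  probability \<open>r / n\<close> and by \<open>q\<close> otherwise, which is right on average.  The configurations (numbers of
  bins per level) are polynomially many for fixed \<open>Q\<close>, so an optimal policy for this random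
  process is found by dynamic programming.

  The rounding error of a bin is its drift \<open>d\<close>.  With the potential \<open>\<Sum> d\<^sup>2 / (nH)\<^sup>2\<close> over all bins,
  one item raises the expected potential by at most \<open>k / (nH\<^sup>2)\<close>, and \<open>\<Sum> k\<close> is at most \<open>O(nQ)\<close> times the
  number of bins of any policy with unit capacity.  A bin with \<open>\<bar>d\<bar> \<ge> nH\<close> has potential at least 1 and
  therefore pays for a fresh bin that replaces it.  Backward induction with this potential shows
  that the value \<open>V\<close> of the dynamic program is at most the cost of any policy with unit capacity plus
  the expected total load.  Conversely, a deterministic policy that knows the real drifts and always
  rounds in the direction with the smaller value of \<open>V\<close> plus potential costs at most \<open>V\<close> plus the
  expected total load, and in its bins the usage exceeds the level by less than \<open>(H + 1) / Q\<close>.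
\<close>

section \<open>Weakest preconditions with running time\<close>

text \<open>Rounding every size up to a multiple of 1/Q would accumulate an error of up to n/Q in a
  bin; unbiased random rounding turns it into a mean-zero drift. The only one-sided rounding left is
  the one to units of 1/(nQ), which costs a bin at most n units, that is one level. The potential is
  quadratic because an unbiased step raises d^2 on average by its variance alone, r (n - r) <= n k.
  This is linear in the size, so it can be charged to the bins that hold the items. The potential is
  subtracted in one comparison and added in the other. Each time this loses theta = (2Q + H + 3) /
  H^2 times the cost compared with, hence 1 + 2 theta in all.

  H enters in two opposite ways. A bin may exceed its level by about H/Q of capacity, so H/Q must be
  of order epsilon; and theta is of order Q/H^2, so this must be of order epsilon too. Together they
  force H of order epsilon^-2 and Q of order epsilon^-3. With L = Q + H + 1 there are n^(L+1)
  configurations, so the exponent is of order epsilon^-3 and stays below 2 (6/epsilon)^5.\<close>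

definition wp ::
  "(nat \<Rightarrow> real \<Rightarrow> real) \<Rightarrow> com \<Rightarrow> (nat \<Rightarrow> memory \<Rightarrow> bool) \<Rightarrow> memory \<Rightarrow> bool" where
  "wp F c Q s \<longleftrightarrow> (\<exists>t s'. exec F c s t s' \<and> Q t s')"

lemma wp_Skip: "wp F Skip Q s \<longleftrightarrow> Q 1 s"
  unfolding wp_def by (subst exec.simps) auto

lemma wp_NSet:
  "wp F (NSet a i e) Q s \<longleftrightarrow> Q (1 + ncost i + ncost e) (set_nmem a (nval i s) (nval e s) s)"
  unfolding wp_def by (subst exec.simps) auto

lemma wp_RSet:
  "wp F (RSet a i e) Q s \<longleftrightarrow> Q (1 + ncost i + rcost e) (set_rmem a (nval i s) (rval e s) s)"
  unfolding wp_def by (subst exec.simps) auto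

lemma wp_Query:
  "wp F (Query a i j e) Q s \<longleftrightarrow>
     Q (1 + ncost i + ncost j + rcost e) (set_rmem a (nval i s) (F (nval j s) (rval e s)) s)"
  unfolding wp_def by (subst exec.simps) auto

lemma wp_Seq: "wp F (Seq c d) Q s \<longleftrightarrow> wp F c (\<lambda>t s'. wp F d (\<lambda>u. Q (1 + t + u)) s') s"
  unfolding wp_def by (subst exec.simps) (simp, blast)

lemma wp_Cond:
  "wp F (Cond b c d) Q s \<longleftrightarrow>
     (if bval b s then wp F c (\<lambda>t. Q (1 + bcost b + t)) s else wp F d (\<lambda>t. Q (1 + bcost b + t)) s)"
  unfolding wp_def by (subst exec.simps) auto

lemmas wp_simps = wp_Skip wp_NSet wp_RSet wp_Query wp_Seq wp_Cond

fun written :: "com \<Rightarrow> string set" where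
  "written Skip = {}"
| "written (NSet a i e) = {a}"
| "written (RSet a i e) = {a}"
| "written (Query a i j e) = {a}"
| "written (Seq c d) = written c \<union> written d"
| "written (Cond b c d) = written c \<union> written d"
| "written (While b c) = written c"

definition agree :: "string set \<Rightarrow> memory \<Rightarrow> memory \<Rightarrow> bool" where
  "agree W s s' \<longleftrightarrow> (\<forall>a. a \<notin> W \<longrightarrow> nmem s' a = nmem s a \<and> rmem s' a = rmem s a)"

lemma agree_refl: "agree W s s"
  by (simp add: agree_def)

lemma agree_trans: "agree W s s' \<Longrightarrow> agree W s' s'' \<Longrightarrow> agree W s s''"
  by (simp add: agree_def)

lemma nmem_set_nmem:
  "nmem (set_nmem a i v s) b = (if a = b then (nmem s b)(i := v) else nmem s b)"
  by (simp add: set_nmem_def)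

lemma rmem_set_nmem: "rmem (set_nmem a i v s) = rmem s"
  by (simp add: set_nmem_def)

lemma rmem_set_rmem:
  "rmem (set_rmem a i v s) b = (if a = b then (rmem s b)(i := v) else rmem s b)"
  by (simp add: set_rmem_def)

lemma nmem_set_rmem: "nmem (set_rmem a i v s) = nmem s"
  by (simp add: set_rmem_def)

lemmas mem_simps = nmem_set_nmem rmem_set_nmem rmem_set_rmem nmem_set_rmem

lemma exec_agree: "exec F c s t s' \<Longrightarrow> agree (written c) s s'"
  by (induction rule: exec.induct)
     (auto simp: agree_def set_nmem_def set_rmem_def)

lemma wp_mono:
  assumes "wp F c Q s" "\<And>t s'. Q t s' \<Longrightarrow> agree (written c) s s' \<Longrightarrow> Q' t s'"
  shows "wp F c Q' s"
  using assms exec_agree unfolding wp_def by blast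

lemma wp_agree:
  assumes "wp F c Q s"
  shows "wp F c (\<lambda>t s'. Q t s' \<and> agree (written c) s s') s"
  using assms by (rule wp_mono) auto

lemma wp_While_unfold:
  "wp F (While b c) Q s \<longleftrightarrow>
     (if bval b s
      then wp F c (\<lambda>t s'. wp F (While b c) (\<lambda>u. Q (1 + bcost b + t + u)) s') s
      else Q (1 + bcost b) s)"
  unfolding wp_def by (subst exec.simps) (simp, blast)

text \<open>\<open>N\<close> is the exact number of iterations and \<open>I j\<close> the invariant
  after \<open>j\<close> of them, so termination and the time bound share one index. The frame fact
  \<open>agree\<close> is available in every obligation, which spares \<open>I\<close> the untouched
  variables.\<close>

lemma wp_While:
  assumes init: "I 0 s"
    and body: "\<And>j s'. j < N \<Longrightarrow> I j s' \<Longrightarrow> agree (written c) s s' \<Longrightarrow>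
      bval b s' \<and> wp F c (\<lambda>t s''. t \<le> T \<and> I (Suc j) s'') s'"
    and stop: "\<And>s'. I N s' \<Longrightarrow> agree (written c) s s' \<Longrightarrow> \<not> bval b s'"
  shows "wp F (While b c)
    (\<lambda>t s'. t \<le> N * (T + 1 + bcost b) + (1 + bcost b) \<and> I N s' \<and> agree (written c) s s') s"
proof -
  have "j \<le> N \<Longrightarrow> I j s' \<Longrightarrow> agree (written c) s s' \<Longrightarrow> wp F (While b c)
    (\<lambda>t s'. t \<le> (N - j) * (T + 1 + bcost b) + (1 + bcost b) \<and> I N s' \<and> agree (written c) s s') s'"
    for j s'
  proof (induction "N - j" arbitrary: j s')
    case 0
    then have "j = N" by simp
    with 0 stop show ?case
      by (subst wp_While_unfold) auto
  next
    case (Suc m)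
    then have j: "j < N" by simp
    from body[OF j Suc.prems(2,3)] have b: "bval b s'"
      and w: "wp F c (\<lambda>t s''. t \<le> T \<and> I (Suc j) s'') s'" by auto
    from w have "wp F c (\<lambda>t s''. wp F (While b c) (\<lambda>u s'''. 1 + bcost b + t + u \<le>
        (N - j) * (T + 1 + bcost b) + (1 + bcost b) \<and> I N s''' \<and> agree (written c) s s''') s'') s'"
    proof (rule wp_mono, elim conjE)
      fix t s'' assume t: "t \<le> T" "I (Suc j) s''" "agree (written c) s' s''"
      have eq: "N - j = Suc (N - Suc j)" using j by simp
      have "wp F (While b c) (\<lambda>t s'. t \<le> (N - Suc j) * (T + 1 + bcost b) + (1 + bcost b) \<and>
          I N s' \<and> agree (written c) s s') s''"
        using Suc j t by (intro Suc.hyps(1)) (auto intro: agree_trans)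
      then show "wp F (While b c) (\<lambda>u s'''. 1 + bcost b + t + u \<le>
        (N - j) * (T + 1 + bcost b) + (1 + bcost b) \<and> I N s''' \<and> agree (written c) s s''') s''"
        by (rule wp_mono) (use t(1) in \<open>auto simp: eq\<close>)
    qed
    with b show ?case by (subst wp_While_unfold) simp
  qed
  from this[of 0 s] init show ?thesis by (simp add: agree_refl)
qed

section \<open>Table size is bounded by running time\<close>

definition footprint :: "memory \<Rightarrow> (bool \<times> string \<times> nat) set" where
  "footprint s = {(k, a, i). if k then nmem s a i \<noteq> 0 else rmem s a i \<noteq> 0}"

lemma table_size_le_iff:
  "table_size_le s B \<longleftrightarrow> finite (footprint s) \<and> card (footprint s) \<le> B"
proof -
  let ?A = "{(a, i). nmem s a i \<noteq> 0}" and ?B = "{(a, i). rmem s a i \<noteq> 0}"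
  have eq: "footprint s = Pair True ` ?A \<union> Pair False ` ?B"
    by (auto simp: footprint_def image_iff split: if_splits)
  have "finite (footprint s) \<longleftrightarrow> finite ?A \<and> finite ?B"
    unfolding eq by (auto simp: finite_image_iff inj_on_def)
  moreover have "card (footprint s) = card ?A + card ?B" if "finite ?A" "finite ?B"
    unfolding eq using that by (subst card_Un_disjoint) (auto simp: card_image inj_on_def)
  ultimately show ?thesis
    unfolding table_size_le_def by auto
qed

lemma footprint_set:
  "footprint (set_nmem a i v s) \<subseteq> insert (True, a, i) (footprint s)"
  "footprint (set_rmem a i w s) \<subseteq> insert (False, a, i) (footprint s)"
  by (auto simp: footprint_def mem_simps split: if_splits)

lemma table_size_le_set:
  assumes "table_size_le s B"
  shows "table_size_le (set_nmem a i v s) (Suc B)" "table_size_le (set_rmem a i w s) (Suc B)"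
proof -
  have "finite X \<and> card X \<le> Suc B"
    if "X \<subseteq> insert y (footprint s)" for X y
    using assms that card_mono[OF _ that] card_insert_le_m1
    by (auto simp: table_size_le_iff card_insert_if finite_subset split: if_splits)
  then show "table_size_le (set_nmem a i v s) (Suc B)" "table_size_le (set_rmem a i w s) (Suc B)"
    using footprint_set table_size_le_iff by meson+
qed

lemma table_size_le_mono: "table_size_le s B \<Longrightarrow> B \<le> B' \<Longrightarrow> table_size_le s B'"
  by (auto simp: table_size_le_def)

text \<open>A write makes at most one more cell nonzero and takes at least one unit of time, so the
  size of the table is a by-product of the time bound.\<close>

lemma exec_table_size: "exec F c s t s' \<Longrightarrow> table_size_le s B \<Longrightarrow> table_size_le s' (B + t)"
proof (induction arbitrary: B rule: exec.induct)
  case (exec_NSet a i e s)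
  from table_size_le_set(1)[OF this] show ?case by (rule table_size_le_mono) simp
next
  case (exec_RSet a i e s)
  from table_size_le_set(2)[OF this] show ?case by (rule table_size_le_mono) simp
next
  case (exec_Query a i j e s)
  from table_size_le_set(2)[OF this] show ?case by (rule table_size_le_mono) simp
next
  case (exec_Seq c s t s' d u s'')
  then have "table_size_le s'' (B + t + u)" by blast
  then show ?case by (rule table_size_le_mono) simp
next
  case (exec_WhileT b s c t s' u s'')
  then have "table_size_le s'' (B + t + u)" by blast
  then show ?case by (rule table_size_le_mono) simp
next
  case (exec_CondT b s c t s' d)
  then have "table_size_le s' (B + t)" by blast
  then show ?case by (rule table_size_le_mono) simp
next
  case (exec_CondF b s d t s' c)
  then have "table_size_le s' (B + t)" by blast
  then show ?case by (rule table_size_le_mono) simp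
qed (erule table_size_le_mono, simp)+

section \<open>The planning program\<close>

abbreviation seq :: "com \<Rightarrow> com \<Rightarrow> com" (infixr ";;" 60) where
  "c ;; d \<equiv> Seq c d"

abbreviation nv :: "string \<Rightarrow> nexp" where "nv a \<equiv> NGet a (NConst 0)"
abbreviation rv :: "string \<Rightarrow> rexp" where "rv a \<equiv> RGet a (NConst 0)"
abbreviation nset :: "string \<Rightarrow> nexp \<Rightarrow> com" where "nset a \<equiv> NSet a (NConst 0)"
abbreviation rset :: "string \<Rightarrow> rexp \<Rightarrow> com" where "rset a \<equiv> RSet a (NConst 0)"
abbreviation rnat :: "nat \<Rightarrow> rexp" where "rnat k \<equiv> ROfNat (NConst k)"

text \<open>Without a division operation, \<open>q\<close> and \<open>r\<close> are stepped together
  as quotient and remainder of the grid index by \<open>n\<close>.\<close>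

definition advance :: com where
  "advance =
     nset ''r'' (NPlus (nv ''r'') (NConst 1)) ;;
     Cond (NLess (nv ''r'') (nv ''n'')) Skip
       (nset ''r'' (NConst 0) ;; nset ''q'' (NPlus (nv ''q'') (NConst 1)))"

definition grid_point :: "nat \<Rightarrow> rexp" where
  "grid_point Q = RDivide (ROfNat (NPlus (NTimes (nv ''q'') (nv ''n'')) (nv ''r'')))
     (RTimes (ROfNat (nv ''n'')) (rnat Q))"

definition landing_exp :: "nexp \<Rightarrow> rexp" where
  "landing_exp e = RPlus (RGet ''pen'' e) (RGet ''V'' (NPlus (nv ''b'') (NGet ''pw'' e)))"

text \<open>
  Expected value of putting item \<open>i\<close> into a bin of level \<open>st\<close>, where \<open>rem\<close> encodes the other bins.
  A size above the last grid point overflows every bin; this is the term after the loop.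
\<close>

definition evaluate :: "nat \<Rightarrow> nat \<Rightarrow> com" where
  "evaluate L Q =
     rset ''R'' (rnat 0) ;; rset ''prev'' (rnat 0) ;;
     nset ''q'' (NConst 0) ;; nset ''r'' (NConst 0) ;;
     nset ''b'' (NPlus (NTimes (NPlus (nv ''i'') (NConst 1)) (nv ''N'')) (nv ''rem'')) ;;
     While (NLess (nv ''q'') (NConst (L + 1)))
       (Query ''cur'' (NConst 0) (nv ''i'') (grid_point Q) ;;
        rset ''R'' (RPlus (rv ''R'') (RTimes (RMinus (rv ''cur'') (rv ''prev''))
          (RPlus
            (RTimes (RDivide (ROfNat (NMinus (nv ''n'') (nv ''r''))) (ROfNat (nv ''n'')))
              (landing_exp (NPlus (nv ''st'') (nv ''q''))))
            (RTimes (RDivide (ROfNat (nv ''r'')) (ROfNat (nv ''n'')))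
              (landing_exp (NPlus (NPlus (nv ''st'') (nv ''q'')) (NConst 1))))))) ;;
        rset ''prev'' (rv ''cur'') ;;
        advance) ;;
     rset ''R'' (RPlus (rv ''R'') (RTimes (RMinus (rnat 1) (rv ''prev''))
       (RPlus (rv ''C'') (RGet ''V'' (nv ''b'')))))"

text \<open>
  Here \<open>y\<close> holds \<open>x mod n\<^sup>l\<^sup>+\<^sup>1\<close>, so the configuration encoded by \<open>x\<close> has a bin of level \<open>l\<close> iff
  \<open>n\<^sup>l \<le> y\<close>.
\<close>

definition examine :: "nat \<Rightarrow> nat \<Rightarrow> com" where
  "examine L Q =
     nset ''l'' (NMinus (nv ''l'') (NConst 1)) ;;
     Cond (NLess (nv ''y'') (NGet ''pw'' (nv ''l''))) Skip
       (nset ''rem'' (NMinus (nv ''x'') (NGet ''pw'' (nv ''l''))) ;;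
        nset ''st'' (nv ''l'') ;;
        evaluate L Q ;;
        Cond (RLess (rv ''R'') (rv ''best''))
          (rset ''best'' (rv ''R'') ;; nset ''act'' (nv ''l'')) Skip ;;
        While (BNot (NLess (nv ''y'') (NGet ''pw'' (nv ''l''))))
          (nset ''y'' (NMinus (nv ''y'') (NGet ''pw'' (nv ''l'')))))"

text \<open>The action \<open>L + 1\<close> stands for opening a bin.\<close>

definition optimize :: "nat \<Rightarrow> nat \<Rightarrow> com" where
  "optimize L Q =
     nset ''rem'' (nv ''x'') ;; nset ''st'' (NConst 0) ;;
     evaluate L Q ;;
     rset ''best'' (RPlus (rnat 1) (rv ''R'')) ;; nset ''act'' (NConst (L + 1)) ;;
     nset ''y'' (nv ''x'') ;; nset ''l'' (NConst (L + 1)) ;;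
     While (NLess (NConst 0) (nv ''l'')) (examine L Q) ;;
     RSet ''V'' (NPlus (NTimes (nv ''i'') (nv ''N'')) (nv ''x'')) (rv ''best'') ;;
     NSet ''Act'' (NPlus (NTimes (nv ''i'') (nv ''N'')) (nv ''x'')) (nv ''act'') ;;
     nset ''x'' (NPlus (nv ''x'') (NConst 1))"

definition layer :: "nat \<Rightarrow> nat \<Rightarrow> com" where
  "layer L Q =
     nset ''i'' (NMinus (nv ''i'') (NConst 1)) ;; nset ''x'' (NConst 0) ;;
     While (NLess (nv ''x'') (nv ''N'')) (optimize L Q)"

definition powers :: "nat \<Rightarrow> com" where
  "powers L =
     nset ''N'' (NConst 1) ;; nset ''l'' (NConst 0) ;;
     While (NLess (nv ''l'') (NConst (L + 1)))
       (NSet ''pw'' (nv ''l'') (nv ''N'') ;;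
        nset ''N'' (NTimes (nv ''N'') (nv ''n'')) ;;
        RSet ''pen'' (NPlus (NConst (L + 1)) (nv ''l'')) (rv ''C'') ;;
        nset ''l'' (NPlus (nv ''l'') (NConst 1))) ;;
     RSet ''pen'' (NConst (2 * L + 2)) (rv ''C'')"

definition planner :: "nat \<Rightarrow> nat \<Rightarrow> com" where
  "planner L Q =
     powers L ;; nset ''i'' (nv ''n'') ;;
     While (NLess (NConst 0) (nv ''i'')) (layer L Q)"

text \<open>\<open>b\<close> addresses the other bins in the layer of the next item; adding
  \<open>pw l\<close> moves to the configuration that also contains a bin of level
  \<open>l\<close>.\<close>

definition landing :: "(nat \<Rightarrow> real) \<Rightarrow> (nat \<Rightarrow> nat) \<Rightarrow> (nat \<Rightarrow> real) \<Rightarrow> nat \<Rightarrow> nat \<Rightarrow> real" where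
  "landing pen pw V b l = pen l + V (b + pw l)"

definition mean :: "nat \<Rightarrow> (nat \<Rightarrow> real) \<Rightarrow> nat \<Rightarrow> nat \<Rightarrow> real" where
  "mean n W l k = real (n - k mod n) / real n * W (l + k div n)
     + real (k mod n) / real n * W (l + k div n + 1)"

text \<open>For a distribution function \<open>G\<close>, the probability that the rounded-up size
  is exactly \<open>k\<close> units. The case \<open>k = 0\<close> takes all mass up to 0 and so
  includes an atom at 0.\<close>

definition grid_prob :: "(real \<Rightarrow> real) \<Rightarrow> real \<Rightarrow> nat \<Rightarrow> real" where
  "grid_prob G M k = G (real k / M) - (if k = 0 then 0 else G ((real k - 1) / M))"

text \<open>The sum stops one short of the cap \<open>n * (L + 1)\<close>; the last term gives the
  capped size all the remaining probability.\<close>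

definition plan_value ::
  "(real \<Rightarrow> real) \<Rightarrow> nat \<Rightarrow> nat \<Rightarrow> nat \<Rightarrow> (nat \<Rightarrow> real) \<Rightarrow> real \<Rightarrow> nat \<Rightarrow> real" where
  "plan_value G n L Q W c l =
     (\<Sum>k<n * (L + 1). grid_prob G (real n * real Q) k * mean n W l k)
     + (1 - G ((real (n * (L + 1)) - 1) / (real n * real Q))) * c"

section \<open>Correctness and running time of the planning program\<close>

lemma wp_advance:
  assumes "nmem s ''n'' 0 = n" "0 < n" "nmem s ''q'' 0 = k div n" "nmem s ''r'' 0 = k mod n"
  shows "wp F advance (\<lambda>t s'. t \<le> 25 \<and> nmem s' ''q'' 0 = Suc k div n \<and>
    nmem s' ''r'' 0 = Suc k mod n \<and> rmem s' = rmem s) s"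
proof (cases "Suc (k mod n) = n")
  case True
  then show ?thesis using assms
    by (simp add: advance_def wp_simps mem_simps div_Suc mod_Suc)
next
  case False
  moreover have "Suc (k mod n) < n" using assms(2) False
    by (meson Suc_lessI mod_less_divisor)
  ultimately show ?thesis using assms
    by (simp add: advance_def wp_simps mem_simps div_Suc mod_Suc)
qed

lemma written_advance: "written advance = {''r'', ''q''}"
  by (auto simp: advance_def)

lemma wp_evaluate:
  assumes n: "nmem s ''n'' 0 = n" "0 < n"
  defines "b \<equiv> (nmem s ''i'' 0 + 1) * nmem s ''N'' 0 + nmem s ''rem'' 0"
  shows "wp F (evaluate L Q) (\<lambda>t s'. t \<le> 140 * (n * (L + 1)) + 60 \<and>
    rmem s' ''R'' 0 = plan_value (F (nmem s ''i'' 0)) n L Q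
      (landing (rmem s ''pen'') (nmem s ''pw'') (rmem s ''V'') b)
      (rmem s ''C'' 0 + rmem s ''V'' b) (nmem s ''st'' 0)) s"
proof -
  define W where "W = landing (rmem s ''pen'') (nmem s ''pw'') (rmem s ''V'') b"
  define G where "G = F (nmem s ''i'' 0)"
  define M where "M = real n * real Q"
  let ?body = "Query ''cur'' (NConst 0) (nv ''i'') (grid_point Q) ;;
        rset ''R'' (RPlus (rv ''R'') (RTimes (RMinus (rv ''cur'') (rv ''prev''))
          (RPlus
            (RTimes (RDivide (ROfNat (NMinus (nv ''n'') (nv ''r''))) (ROfNat (nv ''n'')))
              (landing_exp (NPlus (nv ''st'') (nv ''q''))))
            (RTimes (RDivide (ROfNat (nv ''r'')) (ROfNat (nv ''n'')))
              (landing_exp (NPlus (NPlus (nv ''st'') (nv ''q'')) (NConst 1))))))) ;;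
        rset ''prev'' (rv ''cur'') ;;
        advance"
  \<comment> \<open>\<open>prev\<close> lags one grid point behind and starts at 0, in agreement
    with the special case of \<open>grid_prob\<close>. At the end of the loop it holds the value
    that the tail term needs.\<close>
  define I where "I k s' \<longleftrightarrow> nmem s' ''q'' 0 = k div n \<and> nmem s' ''r'' 0 = k mod n \<and>
    rmem s' ''prev'' 0 = (if k = 0 then 0 else G ((real k - 1) / M)) \<and>
    rmem s' ''R'' 0 = (\<Sum>k<k. grid_prob G M k * mean n W (nmem s ''st'' 0) k)" for k and s' :: memory
  have written: "written ?body = {''cur'', ''R'', ''prev'', ''r'', ''q''}"
    by (auto simp: written_advance)
  have loop: "wp F (While (NLess (nv ''q'') (NConst (L + 1))) ?body)
    (\<lambda>t s'. t \<le> n * (L + 1) * (125 + 1 + bcost (NLess (nv ''q'') (NConst (L + 1))))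
      + (1 + bcost (NLess (nv ''q'') (NConst (L + 1)))) \<and> I (n * (L + 1)) s' \<and>
      agree (written ?body) s0 s') s0"
    if s0: "nmem s0 ''q'' 0 = 0" "nmem s0 ''r'' 0 = 0" "rmem s0 ''prev'' 0 = 0" "rmem s0 ''R'' 0 = 0"
      "nmem s0 ''b'' 0 = b" "nmem s0 ''n'' = nmem s ''n''" "nmem s0 ''i'' = nmem s ''i''"
      "nmem s0 ''st'' = nmem s ''st''" "nmem s0 ''pw'' = nmem s ''pw''"
      "rmem s0 ''pen'' = rmem s ''pen''" "rmem s0 ''V'' = rmem s ''V''" for s0
  proof (rule wp_While)
    show "I 0 s0" using s0 by (simp add: I_def)
  next
    fix k s' assume k: "k < n * (L + 1)" and I: "I k s'" and ag: "agree (written ?body) s0 s'"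
    have fr: "nmem s' ''n'' = nmem s ''n''" "nmem s' ''i'' = nmem s ''i''"
      "nmem s' ''st'' = nmem s ''st''" "nmem s' ''b'' 0 = b"
      "nmem s' ''pw'' = nmem s ''pw''" "rmem s' ''pen'' = rmem s ''pen''"
      "rmem s' ''V'' = rmem s ''V''"
      using ag s0 unfolding written by (simp_all add: agree_def)
    have q: "k div n < L + 1" using k n(2)
      by (metis less_mult_imp_div_less mult.commute)
    have g: "real (k div n) * real n + real (k mod n) = real k"
      by (simp flip: of_nat_mult of_nat_add)
    have "wp F ?body (\<lambda>t s''. t \<le> 125 \<and> I (Suc k) s'') s'"
      unfolding wp_simps
      apply (rule wp_mono[OF wp_advance[where n = n and k = k]])
      subgoal using n fr by (simp add: mem_simps)
      subgoal using n by simp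
      subgoal using I by (simp add: I_def mem_simps)
      subgoal using I by (simp add: I_def mem_simps)
      subgoal using I n fr g
        by (simp add: I_def mem_simps grid_point_def landing_exp_def M_def[symmetric] G_def[symmetric]
            grid_prob_def mean_def W_def landing_def)
      done
    with q I show "bval (NLess (nv ''q'') (NConst (L + 1))) s' \<and>
        wp F ?body (\<lambda>t s''. t \<le> 125 \<and> I (Suc k) s'') s'"
      by (simp add: I_def)
  next
    fix s' assume "I (n * (L + 1)) s'"
    then show "\<not> bval (NLess (nv ''q'') (NConst (L + 1))) s'"
      using n by (simp add: I_def)
  qed
  show ?thesis
    unfolding evaluate_def wp_simps
    apply (rule wp_mono[OF loop])
    apply (simp_all add: mem_simps b_def)[11]
    unfolding written
    apply (simp add: I_def mem_simps agree_def plan_value_def W_def[symmetric] G_def[symmetric] M_def[symmetric] b_def[symmetric])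
    using n apply (simp add: b_def algebra_simps)
    done
qed

text \<open>
  A level above \<open>L\<close> means that the bin has overflowed: such bins do not count in the encoding of a
  configuration.
\<close>

definition power_table :: "nat \<Rightarrow> nat \<Rightarrow> nat \<Rightarrow> nat" where
  "power_table n L l = (if l \<le> L then n ^ l else 0)"

definition penalty_table :: "nat \<Rightarrow> real \<Rightarrow> nat \<Rightarrow> real" where
  "penalty_table L C l = (if L < l \<and> l \<le> 2 * L + 2 then C else 0)"

text \<open>Keeping the receiving bin (level \<open>l\<close>) apart from the others (code
  \<open>y\<close>) lets one formula serve both a fresh bin and a bin of the configuration.\<close>

definition backup ::
  "(nat \<Rightarrow> real \<Rightarrow> real) \<Rightarrow> nat \<Rightarrow> nat \<Rightarrow> nat \<Rightarrow> real \<Rightarrow> (nat \<Rightarrow> real) \<Rightarrow> nat \<Rightarrow> nat \<Rightarrow> nat \<Rightarrow> real" where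
  "backup F n L Q C V i y l =
     plan_value (F i) n L Q
       (landing (penalty_table L C) (power_table n L) V ((i + 1) * n ^ (L + 1) + y))
       (C + V ((i + 1) * n ^ (L + 1) + y)) l"

text \<open>\<open>m\<close> is the lowest level examined so far, which makes this a loop invariant;
  the finished table has \<open>m = 0\<close>. The last clause says that the action attains
  \<open>v\<close>.\<close>

definition optimal_entry ::
  "(nat \<Rightarrow> nat \<Rightarrow> real) \<Rightarrow> nat \<Rightarrow> nat \<Rightarrow> nat \<Rightarrow> nat \<Rightarrow> real \<Rightarrow> nat \<Rightarrow> bool" where
  "optimal_entry B n L m x v a \<longleftrightarrow>
     v \<le> 1 + B x 0 \<and>
     (\<forall>l. m \<le> l \<and> l \<le> L \<and> n ^ l \<le> x mod n ^ (l + 1) \<longrightarrow> v \<le> B (x - n ^ l) l) \<and>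
     (a = L + 1 \<and> v = 1 + B x 0 \<or>
      a \<le> L \<and> n ^ a \<le> x mod n ^ (a + 1) \<and> v = B (x - n ^ a) a)"

text \<open>The zero clause covers every address from layer \<open>n\<close> on: after the last item
  there may be \<open>n\<close> bins, and their code can reach \<open>n ^ (L + 1)\<close>.\<close>

definition plan_table ::
  "(nat \<Rightarrow> real \<Rightarrow> real) \<Rightarrow> nat \<Rightarrow> nat \<Rightarrow> nat \<Rightarrow> real \<Rightarrow> (nat \<Rightarrow> real) \<Rightarrow> (nat \<Rightarrow> nat) \<Rightarrow> bool" where
  "plan_table F n L Q C V Act \<longleftrightarrow>
     (\<forall>a \<ge> n * n ^ (L + 1). V a = 0) \<and>
     (\<forall>i<n. \<forall>x<n ^ (L + 1). optimal_entry (backup F n L Q C V i) n L 0 x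
        (V (i * n ^ (L + 1) + x)) (Act (i * n ^ (L + 1) + x)))"

text \<open>A layer reads later layers only, so filling it invalidates neither its own entries nor
  those computed before.\<close>

lemma backup_cong:
  assumes "\<And>a. (i + 1) * n ^ (L + 1) \<le> a \<Longrightarrow> V a = V' a"
  shows "backup F n L Q C V i = backup F n L Q C V' i"
  using assms by (intro ext) (simp add: backup_def plan_value_def mean_def landing_def)

lemma written_evaluate: "written (evaluate L Q) = {''R'', ''prev'', ''q'', ''r'', ''b'', ''cur''}"
  by (auto simp: evaluate_def written_advance)

definition ready :: "nat \<Rightarrow> nat \<Rightarrow> real \<Rightarrow> memory \<Rightarrow> bool" where
  "ready n L C s \<longleftrightarrow> nmem s ''n'' 0 = n \<and> nmem s ''N'' 0 = n ^ (L + 1) \<and> rmem s ''C'' 0 = C \<and>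
     nmem s ''pw'' = power_table n L \<and> rmem s ''pen'' = penalty_table L C"

lemma wp_evaluate_backup:
  assumes "ready n L C s" "0 < n" "nmem s ''i'' 0 = i" "nmem s ''rem'' 0 = y" "nmem s ''st'' 0 = l"
    and "rmem s ''V'' = V"
  shows "wp F (evaluate L Q) (\<lambda>t s'. t \<le> 140 * (n * (L + 1)) + 60 \<and>
    rmem s' ''R'' 0 = backup F n L Q C V i y l) s"
  using wp_evaluate[of s n F L Q] assms by (simp add: ready_def backup_def)

lemma wp_reduce:
  assumes "nmem s ''y'' 0 = y" "nmem s ''pw'' (nmem s ''l'' 0) = p" "0 < p"
  shows "wp F (While (BNot (NLess (nv ''y'') (NGet ''pw'' (nv ''l''))))
      (nset ''y'' (NMinus (nv ''y'') (NGet ''pw'' (nv ''l'')))))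
    (\<lambda>t s'. t \<le> (y div p) * 17 + 8 \<and> nmem s' ''y'' 0 = y mod p) s"
proof -
  let ?b = "BNot (NLess (nv ''y'') (NGet ''pw'' (nv ''l'')))"
  let ?c = "nset ''y'' (NMinus (nv ''y'') (NGet ''pw'' (nv ''l'')))"
  have "wp F (While ?b ?c) (\<lambda>t s'. t \<le> (y div p) * (8 + 1 + bcost ?b) + (1 + bcost ?b) \<and>
     nmem s' ''y'' 0 = y - (y div p) * p \<and> agree (written ?c) s s') s"
  proof (rule wp_While)
    show "nmem s ''y'' 0 = y - 0 * p" using assms by simp
  next
    fix j s' assume j: "j < y div p" "nmem s' ''y'' 0 = y - j * p" "agree (written ?c) s s'"
    have "Suc j * p \<le> y" using j(1)
      by (metis Suc_leI div_times_less_eq_dividend mult_le_mono1 order_trans)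
    then have "\<not> y - j * p < p" "y - j * p - p = y - Suc j * p" by (simp_all add: algebra_simps)
    then show "bval ?b s' \<and> wp F ?c (\<lambda>t s''. t \<le> 8 \<and> nmem s'' ''y'' 0 = y - Suc j * p) s'"
      using j(2,3) assms by (simp add: agree_def wp_simps mem_simps del: mult_Suc)
  next
    fix s' assume "nmem s' ''y'' 0 = y - (y div p) * p" "agree (written ?c) s s'"
    then show "\<not> bval ?b s'" using assms
      by (simp add: agree_def minus_div_mult_eq_mod)
  qed
  then show ?thesis
    by (rule wp_mono) (simp add: minus_div_mult_eq_mod)
qed

text \<open>The cases match the branches of \<open>examine\<close>: level absent, level better than
  the best action so far, level no better.\<close>

lemma optimal_entry_step:
  assumes "optimal_entry B n L (Suc l) x v a" "l \<le> L"
  shows "x mod n ^ (l + 1) < n ^ l \<Longrightarrow> optimal_entry B n L l x v a"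
    and "\<not> x mod n ^ (l + 1) < n ^ l \<Longrightarrow> B (x - n ^ l) l < v \<Longrightarrow>
      optimal_entry B n L l x (B (x - n ^ l) l) l"
    and "\<not> B (x - n ^ l) l < v \<Longrightarrow> optimal_entry B n L l x v a"
  using assms unfolding optimal_entry_def
  by (auto simp: not_less_eq_eq le_eq_less_or_eq[of l] Suc_le_eq not_less)

lemma written_examine: "written (examine L Q) =
    {''l'', ''rem'', ''st'', ''R'', ''prev'', ''q'', ''r'', ''b'', ''cur'', ''best'', ''act'', ''y''}"
  by (auto simp: examine_def written_evaluate)

lemma wp_examine:
  assumes "ready n L C s" "0 < n" "nmem s ''i'' 0 = i" "nmem s ''x'' 0 = x" "rmem s ''V'' = V"
    and l: "nmem s ''l'' 0 = Suc l" "l \<le> L" "nmem s ''y'' 0 = x mod n ^ Suc l"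
    and best: "optimal_entry (backup F n L Q C V i) n L (Suc l) x (rmem s ''best'' 0) (nmem s ''act'' 0)"
  shows "wp F (examine L Q) (\<lambda>t s'. t \<le> 350 * (n * (L + 1)) \<and> nmem s' ''l'' 0 = l \<and>
    nmem s' ''y'' 0 = x mod n ^ l \<and>
    optimal_entry (backup F n L Q C V i) n L l x (rmem s' ''best'' 0) (nmem s' ''act'' 0)) s"
proof -
  define B where "B = backup F n L Q C V i"
  note best' = optimal_entry_step[OF best[folded B_def] l(2)]
  have pw: "nmem s ''pw'' l = n ^ l"
    using assms(1) l by (simp add: ready_def power_table_def)
  have p: "0 < n ^ l" using assms by simp
  define Y where "Y = x mod n ^ Suc l"
  have y: "nmem s ''y'' 0 = Y" using l by (simp add: Y_def)
  note best' = best'[unfolded Suc_eq_plus1[symmetric], folded Y_def]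
  have nL: "1 \<le> n * (L + 1)" using assms by simp
  have m: "Y mod n ^ l = x mod n ^ l"
    unfolding Y_def by (rule mod_mod_cancel) simp
  \<comment> \<open>The quotient is one base-\<open>n\<close> digit, so the repeated subtraction
    takes fewer than \<open>n\<close> rounds.\<close>
  have le: "Y div n ^ l \<le> n * (L + 1)"
  proof -
    have "Y < n * n ^ l" using assms(2) by (simp add: Y_def)
    then have "Y div n ^ l < n"
      using less_mult_imp_div_less by blast
    then show ?thesis by (simp add: less_imp_le trans_le_add1)
  qed
  show ?thesis
  proof (cases "Y < n ^ l")
    case True
    then have "x mod n ^ l = Y" using m by simp
    with True show ?thesis
      using best'(1) nL
      by (simp add: examine_def wp_simps mem_simps l(1) y pw B_def)
  next
    case False
    show ?thesis
      unfolding examine_def wp_simps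
      apply (simp add: mem_simps l(1) y pw False)
      apply (rule wp_mono[OF wp_evaluate_backup[where n = n and C = C and V = V and i = i and y = "x - n ^ l" and l = l]])
      subgoal using assms by (simp add: ready_def mem_simps)
      subgoal using assms by (simp add: ready_def mem_simps)
      subgoal using assms by (simp add: ready_def mem_simps)
      subgoal using assms pw by (simp add: ready_def mem_simps)
      subgoal using assms by (simp add: ready_def mem_simps)
      subgoal using assms by (simp add: ready_def mem_simps)
      subgoal premises ev for t s'
      proof -
        have fr: "nmem s' ''y'' 0 = Y" "nmem s' ''pw'' = nmem s ''pw''"
          "nmem s' ''l'' 0 = l" "rmem s' ''best'' = rmem s ''best''" "nmem s' ''act'' = nmem s ''act''"
          using ev(2) l(1) y unfolding written_evaluate by (simp_all add: agree_def mem_simps)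
        show ?thesis
          apply (cases "rmem s' ''R'' 0 < rmem s ''best'' 0"; simp add: fr)
          subgoal
            apply (rule wp_mono[OF wp_reduce[where y = "Y" and p = "n ^ l"]])
            subgoal using fr by (simp add: mem_simps)
            subgoal using fr pw by (simp add: mem_simps)
            subgoal using p by simp
            subgoal for u s'' using ev best' False m le nL fr
              by (simp add: agree_def mem_simps B_def)
            done
          subgoal
            apply (rule wp_mono[OF wp_reduce[where y = "Y" and p = "n ^ l"]])
            subgoal using fr by (simp add: mem_simps)
            subgoal using fr pw by (simp add: mem_simps)
            subgoal using p by simp
            subgoal for u s'' using ev best' False m le nL fr
              by (simp add: agree_def mem_simps B_def)
            done
          done
      qed
      done
  qed
qed

text \<open>At least one iteration is made, so the failing last test and a constant \<open>e\<close>
  can be charged to the iterations.\<close>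

lemma loop_time:
  fixes N :: nat
  assumes "1 \<le> N" "T + 2 * b + 2 + e \<le> T'"
  shows "N * (T + 1 + b) + (1 + b) + e \<le> N * T'"
proof -
  have "N * (T + 1 + b) + 1 * (1 + b + e) \<le> N * (T + 1 + b) + N * (1 + b + e)"
    using assms(1) by (intro add_left_mono mult_le_mono1)
  also have "\<dots> = N * (T + 2 * b + 2 + e)" by (simp add: algebra_simps)
  also have "\<dots> \<le> N * T'" using assms(2) by (rule mult_le_mono2)
  finally show ?thesis by simp
qed

lemma ready_agree:
  assumes "ready n L C s" "agree W s s'" "W \<inter> {''n'', ''N'', ''C'', ''pw'', ''pen''} = {}"
  shows "ready n L C s'"
proof -
  from assms(3) have "a \<notin> W" if "a \<in> {''n'', ''N'', ''C'', ''pw'', ''pen''}" for a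
    using that by blast
  with assms(1,2) show ?thesis by (simp add: ready_def agree_def)
qed

lemma wp_search:
  assumes "ready n L C s" "0 < n" "nmem s ''i'' 0 = i" "nmem s ''x'' 0 = x" "rmem s ''V'' = V"
    and "x < n ^ (L + 1)" "nmem s ''l'' 0 = L + 1" "nmem s ''y'' 0 = x"
    and best: "optimal_entry (backup F n L Q C V i) n L (L + 1) x (rmem s ''best'' 0) (nmem s ''act'' 0)"
  shows "wp F (While (NLess (NConst 0) (nv ''l'')) (examine L Q))
    (\<lambda>t s'. t \<le> 370 * (n * (L + 1)) * (L + 1) + 5 \<and>
      optimal_entry (backup F n L Q C V i) n L 0 x (rmem s' ''best'' 0) (nmem s' ''act'' 0)) s"
proof -
  define I where "I j s' \<longleftrightarrow> nmem s' ''l'' 0 = L + 1 - j \<and> nmem s' ''y'' 0 = x mod n ^ (L + 1 - j) \<and>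
    optimal_entry (backup F n L Q C V i) n L (L + 1 - j) x (rmem s' ''best'' 0) (nmem s' ''act'' 0)"
    for j and s' :: memory
  let ?b = "NLess (NConst 0) (nv ''l'')"
  have loop: "wp F (While ?b (examine L Q)) (\<lambda>t s'. t \<le> (L + 1) * (350 * (n * (L + 1)) + 1 + bcost ?b) +
      (1 + bcost ?b) \<and> I (L + 1) s' \<and> agree (written (examine L Q)) s s') s"
  proof (rule wp_While)
    show "I 0 s" using assms by (simp add: I_def)
  next
    fix j s' assume j: "j < L + 1" and I: "I j s'" and ag: "agree (written (examine L Q)) s s'"
    have r: "ready n L C s'" using assms(1) ag by (rule ready_agree) (simp add: written_examine)
    have eq: "L + 1 - j = Suc (L - j)" using j by simp
    have "wp F (examine L Q) (\<lambda>t s''. t \<le> 350 * (n * (L + 1)) \<and> nmem s'' ''l'' 0 = L - j \<and>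
      nmem s'' ''y'' 0 = x mod n ^ (L - j) \<and>
      optimal_entry (backup F n L Q C V i) n L (L - j) x (rmem s'' ''best'' 0) (nmem s'' ''act'' 0)) s'"
      using r assms(2) ag assms I unfolding I_def eq
      by (intro wp_examine) (simp_all add: agree_def written_examine del: power_Suc)
    then have "wp F (examine L Q) (\<lambda>t s''. t \<le> 350 * (n * (L + 1)) \<and> I (Suc j) s'') s'"
      by (rule wp_mono) (simp add: I_def)
    then show "bval ?b s' \<and> wp F (examine L Q) (\<lambda>t s''. t \<le> 350 * (n * (L + 1)) \<and> I (Suc j) s'') s'"
      using I eq by (simp add: I_def)
  next
    fix s' assume "I (L + 1) s'"
    then show "\<not> bval ?b s'" by (simp add: I_def)
  qed
  have "(L + 1) * (350 * (n * (L + 1)) + 1 + bcost ?b) + (1 + bcost ?b) + 0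
      \<le> (L + 1) * (370 * (n * (L + 1)))"
  proof (rule loop_time)
    have "1 \<le> K \<Longrightarrow> 350 * K + 2 * bcost ?b + 2 + 0 \<le> 370 * K" for K
      by simp
    then show "350 * (n * (L + 1)) + 2 * bcost ?b + 2 + 0 \<le> 370 * (n * (L + 1))"
      using assms(2) by simp
  qed simp
  moreover have "(L + 1) * (370 * (n * (L + 1))) = 370 * (n * (L + 1)) * (L + 1)"
    by (rule mult.commute)
  ultimately have "t \<le> 370 * (n * (L + 1)) * (L + 1) + 5"
    if "t \<le> (L + 1) * (350 * (n * (L + 1)) + 1 + bcost ?b) + (1 + bcost ?b)" for t
    using that by linarith
  with loop show ?thesis
    by (elim wp_mono conjE) (simp add: I_def)
qed

lemma written_optimize: "written (optimize L Q) =
    {''l'', ''rem'', ''st'', ''R'', ''prev'', ''q'', ''r'', ''b'', ''cur'', ''best'', ''act'', ''y'', ''x'', ''V'', ''Act''}"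
  by (auto simp: optimize_def written_evaluate written_examine)

lemma wp_optimize:
  assumes r: "ready n L C s" and n: "0 < n" and s: "nmem s ''i'' 0 = i" "nmem s ''x'' 0 = x" "rmem s ''V'' = V"
    and x: "x < n ^ (L + 1)"
  shows "wp F (optimize L Q) (\<lambda>t s'. t \<le> 700 * (n * (L + 1)) * (L + 1) \<and> nmem s' ''x'' 0 = Suc x \<and>
    (\<exists>v a. optimal_entry (backup F n L Q C V i) n L 0 x v a \<and>
      rmem s' ''V'' = V(i * n ^ (L + 1) + x := v) \<and>
      nmem s' ''Act'' = (nmem s ''Act'')(i * n ^ (L + 1) + x := a))) s"
proof -
  have t: "140 * (n * (L + 1)) + 60 + (370 * (n * (L + 1)) * (L + 1) + 5) + 85 \<le> 700 * (n * (L + 1)) * (L + 1)"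
  proof -
    have "1 \<le> n * (L + 1)" using n by simp
    moreover have "n * (L + 1) \<le> n * (L + 1) * (L + 1)" by simp
    ultimately show ?thesis by linarith
  qed
  show ?thesis
    unfolding optimize_def wp_simps
    apply (rule wp_mono[OF wp_evaluate_backup[where n = n and C = C and V = V and i = i and y = x and l = 0]])
    subgoal using r by (simp add: ready_def mem_simps)
    subgoal using n .
    subgoal using s by (simp add: mem_simps)
    subgoal using s by (simp add: mem_simps)
    subgoal using s by (simp add: mem_simps)
    subgoal using s by (simp add: mem_simps)
    subgoal premises ev for t1 s1
    proof -
      note fr = ev(2)[unfolded written_evaluate agree_def]
      have r1: "nmem s1 ''x'' 0 = x" "nmem s1 ''i'' 0 = i" "rmem s1 ''V'' = V"
        "nmem s1 ''n'' 0 = n" "nmem s1 ''N'' 0 = n ^ (L + 1)" "rmem s1 ''C'' 0 = C"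
        "nmem s1 ''pw'' = power_table n L" "rmem s1 ''pen'' = penalty_table L C"
        "nmem s1 ''Act'' = nmem s ''Act''"
        using fr r s by (simp_all add: ready_def mem_simps)
      show ?thesis
        apply (rule wp_mono[OF wp_search[where n = n and C = C and V = V and i = i and x = x]])
        subgoal using r1 by (simp add: ready_def mem_simps)
        subgoal using n .
        subgoal using r1 by (simp add: mem_simps)
        subgoal using r1 by (simp add: mem_simps)
        subgoal using r1 by (simp add: mem_simps)
        subgoal using x .
        subgoal by (simp add: mem_simps)
        subgoal using r1 by (simp add: mem_simps)
        subgoal using ev by (simp add: mem_simps optimal_entry_def)
        subgoal premises se for t2 s2
        proof -
          have fr2: "nmem s2 ''x'' 0 = x" "nmem s2 ''i'' 0 = i" "rmem s2 ''V'' = V"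
             "nmem s2 ''N'' 0 = n ^ (L + 1)" "nmem s2 ''Act'' = nmem s ''Act''"
            using se(2)[simplified written.simps written_examine] r1 by (simp_all add: agree_def mem_simps)
          have "t1 + t2 + 85 \<le> 700 * (n * (L + 1)) * (L + 1)"
            using se(1) ev(1) t by linarith
          then show ?thesis
            apply (simp add: mem_simps fr2 del: power_Suc)
            using se(1) by blast
        qed
        done
    qed
    done
qed

lemma optimal_entry_cong:
  "optimal_entry (backup F n L Q C V i) n L m x v a \<Longrightarrow>
   (\<And>a. (i + 1) * n ^ (L + 1) \<le> a \<Longrightarrow> V a = V' a) \<Longrightarrow>
   optimal_entry (backup F n L Q C V' i) n L m x v a"
  by (metis backup_cong)

definition plan_from ::
  "(nat \<Rightarrow> real \<Rightarrow> real) \<Rightarrow> nat \<Rightarrow> nat \<Rightarrow> nat \<Rightarrow> real \<Rightarrow> nat \<Rightarrow> (nat \<Rightarrow> real) \<Rightarrow> (nat \<Rightarrow> nat) \<Rightarrow> bool" where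
  "plan_from F n L Q C m V Act \<longleftrightarrow>
     (\<forall>a \<ge> n * n ^ (L + 1). V a = 0) \<and>
     (\<forall>i<n. m \<le> i \<longrightarrow> (\<forall>x<n ^ (L + 1). optimal_entry (backup F n L Q C V i) n L 0 x
        (V (i * n ^ (L + 1) + x)) (Act (i * n ^ (L + 1) + x))))"

lemma written_layer: "written (layer L Q) =
    {''l'', ''rem'', ''st'', ''R'', ''prev'', ''q'', ''r'', ''b'', ''cur'', ''best'', ''act'', ''y'', ''x'', ''V'', ''Act'', ''i''}"
  by (auto simp: layer_def written_optimize)

lemma wp_layer:
  assumes r: "ready n L C s" and n: "0 < n" and i: "nmem s ''i'' 0 = Suc i" "i < n"
    and plan: "plan_from F n L Q C (Suc i) (rmem s ''V'') (nmem s ''Act'')"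
  shows "wp F (layer L Q) (\<lambda>t s'. t \<le> 750 * (n * (L + 1)) * (L + 1) * n ^ (L + 1) \<and>
    nmem s' ''i'' 0 = i \<and> plan_from F n L Q C i (rmem s' ''V'') (nmem s' ''Act'')) s"
proof -
  define N where "N = n ^ (L + 1)"
  have N: "0 < N" using n by (simp add: N_def)
  define I where "I x s' \<longleftrightarrow> nmem s' ''x'' 0 = x \<and>
      (\<forall>a. a < i * N \<or> i * N + x \<le> a \<longrightarrow> rmem s' ''V'' a = rmem s ''V'' a \<and> nmem s' ''Act'' a = nmem s ''Act'' a) \<and>
      (\<forall>y<x. optimal_entry (backup F n L Q C (rmem s ''V'') i) n L 0 y
         (rmem s' ''V'' (i * N + y)) (nmem s' ''Act'' (i * N + y)))" for x and s' :: memory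
  let ?b = "NLess (nv ''x'') (nv ''N'')"
  define T where "T = 700 * (n * (L + 1)) * (L + 1)"
  have loop: "wp F (While ?b (optimize L Q)) (\<lambda>t s'. t \<le> N * (T + 1 + bcost ?b) + (1 + bcost ?b) \<and>
      I N s' \<and> agree (written (optimize L Q)) s0 s') s0"
    if s0: "nmem s0 ''x'' 0 = 0" "nmem s0 ''i'' 0 = i" "ready n L C s0"
      "rmem s0 ''V'' = rmem s ''V''" "nmem s0 ''Act'' = nmem s ''Act''" for s0
  proof (rule wp_While)
    show "I 0 s0" using s0 by (simp add: I_def)
  next
    fix x s' assume x: "x < N" and I: "I x s'" and ag: "agree (written (optimize L Q)) s0 s'"
    have r': "ready n L C s'" using s0(3) ag by (rule ready_agree) (simp add: written_optimize)
    have i': "nmem s' ''i'' 0 = i" using s0 ag by (simp add: agree_def written_optimize)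
    \<comment> \<open>The part of \<open>V\<close> that layer \<open>i\<close> reads has not changed
      since the layer was begun, so the invariant may refer to the initial array throughout.\<close>
    have cong: "backup F n L Q C (rmem s' ''V'') i = backup F n L Q C (rmem s ''V'') i"
      by (rule backup_cong) (use I x in \<open>simp add: I_def N_def\<close>)
    have "wp F (optimize L Q) (\<lambda>t s''. t \<le> T \<and> nmem s'' ''x'' 0 = Suc x \<and>
    (\<exists>v a. optimal_entry (backup F n L Q C (rmem s' ''V'') i) n L 0 x v a \<and>
      rmem s'' ''V'' = (rmem s' ''V'')(i * n ^ (L + 1) + x := v) \<and>
      nmem s'' ''Act'' = (nmem s' ''Act'')(i * n ^ (L + 1) + x := a))) s'"
      unfolding T_def using r' n i' I x by (intro wp_optimize) (simp_all add: I_def N_def)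
    then have "wp F (optimize L Q) (\<lambda>t s''. t \<le> T \<and> I (Suc x) s'') s'"
    proof (rule wp_mono, elim conjE exE)
      fix t v a and s'' :: memory
      assume *: "t \<le> T" "nmem s'' ''x'' 0 = Suc x"
        "optimal_entry (backup F n L Q C (rmem s' ''V'') i) n L 0 x v a"
        "rmem s'' ''V'' = (rmem s' ''V'')(i * n ^ (L + 1) + x := v)"
        "nmem s'' ''Act'' = (nmem s' ''Act'')(i * n ^ (L + 1) + x := a)"
      show "t \<le> T \<and> I (Suc x) s''"
        using * I unfolding I_def cong by (auto simp: N_def less_Suc_eq)
    qed
    then show "bval ?b s' \<and> wp F (optimize L Q) (\<lambda>t s''. t \<le> T \<and> I (Suc x) s'') s'"
      using x I r' by (simp add: I_def ready_def N_def)
  next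
    fix s' assume "I N s'" and ag: "agree (written (optimize L Q)) s0 s'"
    moreover have r': "ready n L C s'" using s0(3) ag by (rule ready_agree) (simp add: written_optimize)
    ultimately show "\<not> bval ?b s'" by (simp add: I_def ready_def N_def)
  qed
  have plan': "plan_from F n L Q C i (rmem s' ''V'') (nmem s' ''Act'')" if I: "I N s'" for s' :: memory
    unfolding plan_from_def N_def[symmetric]
  proof (intro conjI allI impI)
    fix a assume a: "n * N \<le> a"
    have "i * N + N \<le> n * N" using i(2)
      by (metis Suc_leI add.commute mult_Suc mult_le_mono1)
    with a have "i * N + N \<le> a" by simp
    then show "rmem s' ''V'' a = 0" using I a plan by (simp add: I_def plan_from_def N_def)
  next
    fix j x assume j: "j < n" "i \<le> j" and x: "x < N"
    show "optimal_entry (backup F n L Q C (rmem s' ''V'') j) n L 0 x (rmem s' ''V'' (j * N + x)) (nmem s' ''Act'' (j * N + x))"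
    proof (cases "j = i")
      case True
      have "optimal_entry (backup F n L Q C (rmem s ''V'') i) n L 0 x (rmem s' ''V'' (i * N + x)) (nmem s' ''Act'' (i * N + x))"
        using I x by (simp add: I_def)
      then show ?thesis unfolding True
        by (rule optimal_entry_cong) (use I in \<open>simp add: I_def N_def\<close>)
    next
      case False
      with j have "Suc i \<le> j" by simp
      then have le: "i * N + N \<le> j * N"
        by (metis add.commute mult_Suc mult_le_mono1)
      have "optimal_entry (backup F n L Q C (rmem s ''V'') j) n L 0 x (rmem s ''V'' (j * N + x)) (nmem s ''Act'' (j * N + x))"
        using plan j(1) x \<open>Suc i \<le> j\<close> by (simp add: plan_from_def N_def)
      moreover have "rmem s' ''V'' (j * N + x) = rmem s ''V'' (j * N + x)" "nmem s' ''Act'' (j * N + x) = nmem s ''Act'' (j * N + x)"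
        using I le by (simp_all add: I_def)
      ultimately have "optimal_entry (backup F n L Q C (rmem s ''V'') j) n L 0 x
          (rmem s' ''V'' (j * N + x)) (nmem s' ''Act'' (j * N + x))" by simp
      then show ?thesis
        by (rule optimal_entry_cong) (use I le in \<open>simp add: I_def N_def\<close>)
    qed
  qed
  show ?thesis
    unfolding layer_def wp_simps
    apply (rule wp_mono[OF loop])
    subgoal by (simp add: mem_simps)
    subgoal using i by (simp add: mem_simps)
    subgoal using r by (simp add: ready_def mem_simps)
    subgoal by (simp add: mem_simps)
    subgoal by (simp add: mem_simps)
    subgoal premises p for t s'
    proof -
      have "nmem s' ''i'' 0 = i"
        using p(2) i by (simp add: written_optimize agree_def mem_simps)
      moreover have "t + 30 \<le> 750 * (n * (L + 1)) * (L + 1) * N"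
      proof -
        have "N * (T + 1 + bcost ?b) + (1 + bcost ?b) + 30 \<le> N * (750 * (n * (L + 1)) * (L + 1))"
        proof (rule loop_time)
          have "1 \<le> K \<Longrightarrow> 700 * K + 2 * bcost ?b + 2 + 30 \<le> 750 * K" for K
            by simp
          from this[of "n * (L + 1) * (L + 1)"]
          show "T + 2 * bcost ?b + 2 + 30 \<le> 750 * (n * (L + 1)) * (L + 1)"
            using n unfolding T_def mult.assoc by simp
        qed (use N in simp)
        then show ?thesis using p(1) by (simp only: mult.commute[of N]) linarith
      qed
      ultimately show ?thesis using p plan'[of s'] by (simp add: N_def)
    qed
    done
qed


lemma plan_from_0: "plan_from F n L Q C 0 V Act \<longleftrightarrow> plan_table F n L Q C V Act"
  by (simp add: plan_from_def plan_table_def)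

lemma wp_powers:
  assumes "nmem s ''n'' 0 = n" "rmem s ''C'' 0 = C" "nmem s ''pw'' = (\<lambda>_. 0)" "rmem s ''pen'' = (\<lambda>_. 0)"
  shows "wp F (powers L) (\<lambda>t s'. t \<le> 60 * (L + 1) \<and> ready n L C s') s"
proof -
  let ?b = "NLess (nv ''l'') (NConst (L + 1))"
  let ?c = "NSet ''pw'' (nv ''l'') (nv ''N'') ;;
        nset ''N'' (NTimes (nv ''N'') (nv ''n'')) ;;
        RSet ''pen'' (NPlus (NConst (L + 1)) (nv ''l'')) (rv ''C'') ;;
        nset ''l'' (NPlus (nv ''l'') (NConst 1))"
  define I where "I l s' \<longleftrightarrow> nmem s' ''l'' 0 = l \<and> nmem s' ''N'' 0 = n ^ l \<and>
      nmem s' ''pw'' = (\<lambda>j. if j < l then n ^ j else 0) \<and>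
      rmem s' ''pen'' = (\<lambda>j. if L < j \<and> j < L + 1 + l then C else 0)" for l and s' :: memory
  have loop: "wp F (While ?b ?c) (\<lambda>t s'. t \<le> (L + 1) * (30 + 1 + bcost ?b) + (1 + bcost ?b) \<and>
      I (L + 1) s' \<and> agree (written ?c) s0 s') s0"
    if s0: "I 0 s0" "nmem s0 ''n'' 0 = n" "rmem s0 ''C'' 0 = C" for s0
  proof (rule wp_While)
    show "I 0 s0" by fact
  next
    fix j s' assume j: "j < L + 1" and I: "I j s'" and ag: "agree (written ?c) s0 s'"
    have "nmem s' ''n'' 0 = n" "rmem s' ''C'' 0 = C"
      using ag s0 by (simp_all add: agree_def)
    then show "bval ?b s' \<and> wp F ?c (\<lambda>t s''. t \<le> 30 \<and> I (Suc j) s'') s'"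
      using j I by (auto simp: I_def wp_simps mem_simps fun_eq_iff less_Suc_eq)
  next
    fix s' assume "I (L + 1) s'"
    then show "\<not> bval ?b s'" by (simp add: I_def)
  qed
  show ?thesis
    unfolding powers_def wp_simps
    apply (rule wp_mono[OF loop])
    subgoal using assms(3,4) by (simp add: I_def mem_simps) (rule ext, simp)
    subgoal using assms by (simp add: mem_simps)
    subgoal using assms by (simp add: mem_simps)
    subgoal premises p for t s'
    proof -
      have "nmem s' ''n'' 0 = n" "rmem s' ''C'' 0 = C"
        using p(1) assms(1,2) by (simp_all add: agree_def mem_simps)
      moreover have "(\<lambda>j. if j < L + 1 then n ^ j else 0) = power_table n L"
        by (simp add: power_table_def fun_eq_iff less_Suc_eq_le)
      \<comment> \<open>The loop fills \<open>L + 1\<close> to \<open>2 * L + 1\<close>, and the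
        assignment after it adds \<open>2 * L + 2\<close>. This is the highest reachable level:
        \<open>L\<close>, plus \<open>L + 1\<close> for a capped size, plus 1 for rounding
        upwards.\<close>
      moreover have "(\<lambda>j. if L < j \<and> j < L + 1 + (L + 1) then C else 0)(2 * L + 2 := C) = penalty_table L C"
        by (auto simp: penalty_table_def fun_eq_iff)
      ultimately show ?thesis
        using p(1) by (simp add: I_def ready_def mem_simps)
    qed
    done
qed

lemma written_powers: "written (powers L) = {''N'', ''l'', ''pw'', ''pen''}"
  by (auto simp: powers_def)

lemma written_planner: "written (planner L Q) =
    {''l'', ''rem'', ''st'', ''R'', ''prev'', ''q'', ''r'', ''b'', ''cur'', ''best'', ''act'', ''y'', ''x'',
     ''V'', ''Act'', ''i'', ''N'', ''pw'', ''pen''}"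
  by (auto simp: planner_def written_layer written_powers)

text \<open>The time is a product of nested loops: \<open>n\<close> items,
  \<open>n ^ (L + 1)\<close> configurations, \<open>L + 1\<close> levels and
  \<open>n * (L + 1)\<close> grid points. The zero-initialized \<open>V\<close> already is the layer
  past the last item.\<close>

lemma wp_planner:
  assumes n: "nmem s ''n'' 0 = n" "0 < n" and "rmem s ''C'' 0 = C" "nmem s ''pw'' = (\<lambda>_. 0)" "rmem s ''pen'' = (\<lambda>_. 0)"
    and V: "rmem s ''V'' = (\<lambda>_. 0)"
  shows "wp F (planner L Q) (\<lambda>t s'. t \<le> 900 * (n * (L + 1)) * (L + 1) * n ^ (L + 1) * n \<and> ready n L C s' \<and>
    plan_table F n L Q C (rmem s' ''V'') (nmem s' ''Act'')) s"
proof -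
  let ?b = "NLess (NConst 0) (nv ''i'')"
  define I where "I j s' \<longleftrightarrow> nmem s' ''i'' 0 = n - j \<and>
      plan_from F n L Q C (n - j) (rmem s' ''V'') (nmem s' ''Act'')" for j and s' :: memory
  define T where "T = 750 * (n * (L + 1)) * (L + 1) * n ^ (L + 1)"
  have loop: "wp F (While ?b (layer L Q)) (\<lambda>t s'. t \<le> n * (T + 1 + bcost ?b) + (1 + bcost ?b) \<and>
      I n s' \<and> agree (written (layer L Q)) s0 s') s0"
    if s0: "nmem s0 ''i'' 0 = n" "rmem s0 ''V'' = (\<lambda>_. 0)" "ready n L C s0" for s0
  proof (rule wp_While)
    show "I 0 s0" using s0 by (simp add: I_def plan_from_def)
  next
    fix j s' assume j: "j < n" and I: "I j s'" and ag: "agree (written (layer L Q)) s0 s'"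
    have r: "ready n L C s'" using s0(3) ag by (rule ready_agree) (simp add: written_layer)
    have eq: "n - j = Suc (n - Suc j)" using j by simp
    have "wp F (layer L Q) (\<lambda>t s''. t \<le> T \<and> nmem s'' ''i'' 0 = n - Suc j \<and>
        plan_from F n L Q C (n - Suc j) (rmem s'' ''V'') (nmem s'' ''Act'')) s'"
      unfolding T_def by (rule wp_layer) (use r n I j in \<open>simp_all add: I_def flip: eq\<close>)
    then show "bval ?b s' \<and> wp F (layer L Q) (\<lambda>t s''. t \<le> T \<and> I (Suc j) s'') s'"
      using I j by (simp add: I_def)
  next
    fix s' assume "I n s'"
    then show "\<not> bval ?b s'" by (simp add: I_def)
  qed
  have time: "n * (T + 1 + bcost ?b) + (1 + bcost ?b) + (60 * (L + 1) + 10)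
     \<le> n * (900 * (n * (L + 1)) * (L + 1) * n ^ (L + 1))"
  proof (rule loop_time)
    define K where "K = (n * (L + 1)) * (L + 1) * n ^ (L + 1)"
    have "1 \<le> n * (L + 1) * n ^ (L + 1)" using n by simp
    then have "1 * (L + 1) \<le> n * (L + 1) * n ^ (L + 1) * (L + 1)"
      by (rule mult_le_mono1)
    then have "L + 1 \<le> K" by (simp only: K_def mult_ac mult_1)
    then have "750 * K + 2 * bcost ?b + 2 + (60 * (L + 1) + 10) \<le> 900 * K" by simp
    then show "T + 2 * bcost ?b + 2 + (60 * (L + 1) + 10) \<le> 900 * (n * (L + 1)) * (L + 1) * n ^ (L + 1)"
      by (simp only: T_def K_def mult.assoc)
  qed (use n in simp)
  show ?thesis
    unfolding planner_def wp_simps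
    apply (rule wp_mono[OF wp_powers[where n = n and C = C]])
    using assms apply simp_all[4]
    subgoal premises p for t1 s1
      apply (rule wp_mono[OF loop])
      subgoal using p(2) n by (simp add: written_powers agree_def mem_simps)
      subgoal using p(2) V by (simp add: written_powers agree_def mem_simps)
      subgoal using p by (simp add: ready_def mem_simps)
      subgoal premises q for t s'
      proof -
        have "ready n L C s'"
        proof (rule ready_agree[OF _ q(2)])
          show "ready n L C (set_nmem ''i'' (nval (NConst 0) s1) (nval (nv ''n'') s1) s1)"
            using p(1) by (simp add: ready_def mem_simps)
        qed (simp add: written_layer)
        moreover have "1 + t1 + (1 + (1 + ncost (NConst 0) + ncost (nv ''n'')) + t)
            \<le> 900 * (n * (L + 1)) * (L + 1) * n ^ (L + 1) * n"
        proof -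
          have "1 + t1 + (1 + (1 + ncost (NConst 0) + ncost (nv ''n'')) + t)
            \<le> n * (T + 1 + bcost ?b) + (1 + bcost ?b) + (60 * (L + 1) + 10)"
            using p(1) q(1) by simp
          also note time
          also have "n * (900 * (n * (L + 1)) * (L + 1) * n ^ (L + 1)) = 900 * (n * (L + 1)) * (L + 1) * n ^ (L + 1) * n"
            by (rule mult.commute)
          finally show ?thesis .
        qed
        ultimately show ?thesis
          using q(1) by (simp only: I_def plan_from_0 diff_self_eq_0)
      qed
      done
    done
qed

section \<open>The policy\<close>

text \<open>In units of 1/(nQ), a bin of level \<open>l\<close> and drift \<open>d\<close> is
  accounted at \<open>n * l + d\<close>. The field \<open>code\<close> is the encoded configuration
  that indexes the table.\<close>

record packing =
  code :: nat
  opened :: nat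
  level :: "nat \<Rightarrow> nat"
  drift :: "nat \<Rightarrow> real"

definition open_bin :: "nat \<Rightarrow> packing \<Rightarrow> packing" where
  "open_bin l p = p\<lparr>opened := opened p + 1, level := (level p)(opened p := l),
     drift := (drift p)(opened p := 0)\<rparr>"

text \<open>A bin that is no longer used, though not overflowed, also gets a level above \<open>L\<close>.\<close>

definition retire :: "nat \<Rightarrow> nat \<Rightarrow> packing \<Rightarrow> packing" where
  "retire L b p = p\<lparr>level := (level p)(b := L + 1), drift := (drift p)(b := 0)\<rparr>"

text \<open>The fresh bin that replaces a drifted one takes over its level \<open>a\<close>, so
  \<open>code\<close> stays correct. Opening a bin on the plan's advice adds a bin of level 0, whose
  code is \<open>n ^ 0 = 1\<close>.\<close>

definition place ::
  "nat \<Rightarrow> nat \<Rightarrow> nat \<Rightarrow> (nat \<Rightarrow> nat) \<Rightarrow> nat \<Rightarrow> packing \<Rightarrow> nat \<times> packing" where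
  "place n L H Act i p =
     (let a = Act (i * n ^ (L + 1) + code p); b = (LEAST b. level p b = a) in
      if a \<le> L then
        if (drift p b)\<^sup>2 < (real n * real H)\<^sup>2 then (b, p)
        else (opened p, open_bin a (retire L b p))
      else (opened p, open_bin 0 (p\<lparr>code := code p + 1\<rparr>)))"

text \<open>Of the total potential only the term of bin \<open>b\<close> depends on the rounding, so
  \<open>down\<close> and \<open>up\<close> compare the full costs up to a common summand.\<close>

definition settle ::
  "nat \<Rightarrow> nat \<Rightarrow> nat \<Rightarrow> real \<Rightarrow> (nat \<Rightarrow> real) \<Rightarrow> nat \<Rightarrow> nat \<Rightarrow> nat \<Rightarrow> packing \<Rightarrow> packing" where
  "settle n L H C V i b k p =
     (let y = code p - power_table n L (level p b);
          l = level p b + k div n;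
          W = landing (penalty_table L C) (power_table n L) V ((i + 1) * n ^ (L + 1) + y);
          d = drift p b + real (k mod n);
          down = W l + d\<^sup>2 / (real n * real H)\<^sup>2;
          up = W (l + 1) + (d - real n)\<^sup>2 / (real n * real H)\<^sup>2
      in if up < down
         then p\<lparr>code := y + power_table n L (l + 1), level := (level p)(b := l + 1),
             drift := (drift p)(b := d - real n)\<rparr>
         else p\<lparr>code := y + power_table n L l, level := (level p)(b := l),
             drift := (drift p)(b := d)\<rparr>)"

primrec packings ::
  "nat \<Rightarrow> nat \<Rightarrow> nat \<Rightarrow> real \<Rightarrow> (nat \<Rightarrow> real) \<Rightarrow> (nat \<Rightarrow> nat) \<Rightarrow> (nat \<Rightarrow> nat) \<Rightarrow> nat \<Rightarrow> packing" where
  "packings n L H C V Act ks 0 = \<lparr>code = 0, opened = 0, level = (\<lambda>_. 0), drift = (\<lambda>_. 0)\<rparr>"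
| "packings n L H C V Act ks (Suc i) =
     (case place n L H Act i (packings n L H C V Act ks i) of
        (b, p) \<Rightarrow> settle n L H C V i b (ks i) p)"

text \<open>The cap bounds the load of a single item whatever its distribution; a capped size lifts
  any bin above level \<open>L\<close>.\<close>

definition quantum :: "nat \<Rightarrow> nat \<Rightarrow> nat \<Rightarrow> real \<Rightarrow> nat" where
  "quantum n L Q y = nat (min \<lceil>real n * real Q * y\<rceil> (int (n * (L + 1))))"

text \<open>
  Without this congruence rule the simplifier would execute the remaining program on a symbolic
  memory, with exponential blow-up.
\<close>

lemma wp_weak_cong: "s = s' \<Longrightarrow> wp F c Q s = wp F c Q s'"
  by simp

section \<open>The decision program\<close>

abbreviation sq :: "rexp \<Rightarrow> rexp" where "sq e \<equiv> RTimes e e"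

definition update_com :: "nat \<Rightarrow> com" where
  "update_com H =
     nset ''l'' (NGet ''level'' (nv ''bin'')) ;;
     nset ''code'' (NMinus (nv ''code'') (NGet ''pw'' (nv ''l''))) ;;
     nset ''l'' (NPlus (nv ''l'') (nv ''q'')) ;;
     nset ''b'' (NPlus (NTimes (nv ''j'') (nv ''N'')) (nv ''code'')) ;;
     rset ''d'' (RPlus (RGet ''drift'' (nv ''bin'')) (ROfNat (nv ''r''))) ;;
     rset ''down'' (RPlus (landing_exp (nv ''l''))
       (RDivide (sq (rv ''d'')) (sq (RTimes (ROfNat (nv ''n'')) (rnat H))))) ;;
     rset ''up'' (RPlus (landing_exp (NPlus (nv ''l'') (NConst 1)))
       (RDivide (sq (RMinus (rv ''d'') (ROfNat (nv ''n'')))) (sq (RTimes (ROfNat (nv ''n'')) (rnat H))))) ;;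
     Cond (RLess (rv ''up'') (rv ''down''))
       (nset ''l'' (NPlus (nv ''l'') (NConst 1)) ;; rset ''d'' (RMinus (rv ''d'') (ROfNat (nv ''n''))))
       Skip ;;
     RSet ''drift'' (nv ''bin'') (rv ''d'') ;;
     NSet ''level'' (nv ''bin'') (nv ''l'') ;;
     nset ''code'' (NPlus (nv ''code'') (NGet ''pw'' (nv ''l'')))"

definition settle_com :: "nat \<Rightarrow> nat \<Rightarrow> nat \<Rightarrow> com" where
  "settle_com L Q H =
     nset ''q'' (NConst 0) ;; nset ''r'' (NConst 0) ;;
     While (BAnd (NLess (nv ''q'') (NConst (L + 1))) (RLess (grid_point Q) (rv ''size''))) advance ;;
     update_com H"

definition open_com :: "nexp \<Rightarrow> com" where
  "open_com e =
     nset ''bin'' (nv ''opened'') ;;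
     NSet ''level'' (nv ''bin'') e ;;
     RSet ''drift'' (nv ''bin'') (rnat 0) ;;
     nset ''opened'' (NPlus (nv ''opened'') (NConst 1))"

definition place_com :: "nat \<Rightarrow> nat \<Rightarrow> com" where
  "place_com L H =
     nset ''a'' (NGet ''Act'' (NPlus (NTimes (nv ''j'') (nv ''N'')) (nv ''code''))) ;;
     Cond (NLess (nv ''a'') (NConst (L + 1)))
       (nset ''bin'' (NConst 0) ;;
        While (BNot (BAnd (BNot (NLess (NGet ''level'' (nv ''bin'')) (nv ''a'')))
                          (BNot (NLess (nv ''a'') (NGet ''level'' (nv ''bin''))))))
          (nset ''bin'' (NPlus (nv ''bin'') (NConst 1))) ;;
        Cond (RLess (sq (RGet ''drift'' (nv ''bin''))) (sq (RTimes (ROfNat (nv ''n'')) (rnat H)))) Skip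
          (NSet ''level'' (nv ''bin'') (NConst (L + 1)) ;;
           RSet ''drift'' (nv ''bin'') (rnat 0) ;;
           open_com (nv ''a'')))
       (nset ''code'' (NPlus (nv ''code'') (NConst 1)) ;; open_com (NConst 0)) ;;
     nset ''j'' (NPlus (nv ''j'') (NConst 1))"

text \<open>A size becomes known only after its round, so a decision begins by settling the previous
  item; \<open>j\<close> counts the decisions made.\<close>

definition decider :: "nat \<Rightarrow> nat \<Rightarrow> nat \<Rightarrow> com" where
  "decider L Q H = Cond (NLess (NConst 0) (nv ''j'')) (settle_com L Q H) Skip ;; place_com L H"

definition stored :: "nat \<Rightarrow> nat \<Rightarrow> real \<Rightarrow> (nat \<Rightarrow> real) \<Rightarrow> (nat \<Rightarrow> nat) \<Rightarrow> packing \<Rightarrow> memory \<Rightarrow> bool" where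
  "stored n L C V Act p s \<longleftrightarrow> ready n L C s \<and> rmem s ''V'' = V \<and> nmem s ''Act'' = Act \<and>
     nmem s ''code'' 0 = code p \<and> nmem s ''opened'' 0 = opened p \<and>
     nmem s ''level'' = level p \<and> rmem s ''drift'' = drift p"

text \<open>The machine cannot round, so the ceiling is found by scanning the grid for the first
  point not below the size, or up to the cap.\<close>

lemma wp_quantum:
  assumes n: "nmem s ''n'' 0 = n" "0 < n" "0 < Q" and s: "nmem s ''q'' 0 = 0" "nmem s ''r'' 0 = 0"
    and y: "rmem s ''size'' 0 = y"
  shows "wp F (While (BAnd (NLess (nv ''q'') (NConst (L + 1))) (RLess (grid_point Q) (rv ''size''))) advance)
    (\<lambda>t s'. t \<le> n * (L + 1) * 60 + 30 \<and> nmem s' ''q'' 0 = quantum n L Q y div n \<and>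
      nmem s' ''r'' 0 = quantum n L Q y mod n) s"
proof -
  let ?b = "BAnd (NLess (nv ''q'') (NConst (L + 1))) (RLess (grid_point Q) (rv ''size''))"
  define k where "k = quantum n L Q y"
  define M where "M = real n * real Q"
  have M: "0 < M" using n by (simp add: M_def)
  have k: "k \<le> n * (L + 1)"
    by (simp add: k_def quantum_def nat_le_iff)
  have less: "j < k \<Longrightarrow> j div n < L + 1 \<and> real j / M < y" for j
  proof -
    assume j: "j < k"
    then have "j < n * (L + 1)" using k by simp
    then have "j div n < L + 1" using less_mult_imp_div_less[of j "L + 1" n] by (simp add: mult.commute)
    moreover have "int j < \<lceil>M * y\<rceil>" using j by (simp add: k_def quantum_def M_def)
    then have "real j < M * y" by (simp add: less_ceiling_iff)
    ultimately show ?thesis using M by (simp add: field_simps)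
  qed
  have stop: "k div n = L + 1 \<or> \<not> real k / M < y"
  proof (cases "k = n * (L + 1)")
    case False
    have "\<lceil>M * y\<rceil> \<le> int k"
    proof -
      have "nat (min z (int K)) \<noteq> K \<Longrightarrow> z \<le> int (nat (min z (int K)))" for z K
        by (auto simp: min_def split: if_splits)
      from this[of "\<lceil>M * y\<rceil>"] show ?thesis
        using False unfolding k_def quantum_def M_def[symmetric] by metis
    qed
    then have "M * y \<le> real k" by linarith
    then show ?thesis using M by (simp add: field_simps)
  qed (use n in simp)
  define I where "I j s' \<longleftrightarrow> nmem s' ''q'' 0 = j div n \<and> nmem s' ''r'' 0 = j mod n"
    for j and s' :: memory
  have grid: "rval (grid_point Q) s' = real j / M"
    if "I j s'" "nmem s' ''n'' 0 = n" for j s'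
  proof -
    have "real (j div n) * real n + real (j mod n) = real j"
      by (simp flip: of_nat_mult of_nat_add)
    with that show ?thesis by (simp add: grid_point_def I_def M_def)
  qed
  have "wp F (While ?b advance) (\<lambda>t s'. t \<le> k * (25 + 1 + bcost ?b) + (1 + bcost ?b) \<and>
      I k s' \<and> agree (written advance) s s') s"
  proof (rule wp_While)
    show "I 0 s" using s by (simp add: I_def)
  next
    fix j s' assume j: "j < k" and I: "I j s'" and ag: "agree (written advance) s s'"
    have fr: "nmem s' ''n'' 0 = n" "rmem s' ''size'' 0 = y"
      using ag n y by (simp_all add: agree_def written_advance)
    have "wp F advance (\<lambda>t s''. t \<le> 25 \<and> nmem s'' ''q'' 0 = Suc j div n \<and>
       nmem s'' ''r'' 0 = Suc j mod n \<and> rmem s'' = rmem s') s'"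
      using fr n I by (intro wp_advance) (simp_all add: I_def)
    then have "wp F advance (\<lambda>t s''. t \<le> 25 \<and> I (Suc j) s'') s'"
      by (rule wp_mono) (simp add: I_def)
    moreover have "bval ?b s'"
      using less[OF j] I grid[OF I fr(1)] fr(2) by (simp add: I_def)
    ultimately show "bval ?b s' \<and> wp F advance (\<lambda>t s''. t \<le> 25 \<and> I (Suc j) s'') s'" by simp
  next
    fix s' assume I: "I k s'" and ag: "agree (written advance) s s'"
    have fr: "nmem s' ''n'' 0 = n" "rmem s' ''size'' 0 = y"
      using ag n y by (simp_all add: agree_def written_advance)
    show "\<not> bval ?b s'" using stop grid[OF I fr(1)] fr I by (auto simp: I_def)
  qed
  then show ?thesis
  proof (rule wp_mono, elim conjE)
    fix t s' assume t: "t \<le> k * (25 + 1 + bcost ?b) + (1 + bcost ?b)" and I: "I k s'"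
    have "bcost ?b = 24" by (simp add: grid_point_def)
    then have "t \<le> k * 60 + 30" using t by simp
    also have "\<dots> \<le> n * (L + 1) * 60 + 30" using k by simp
    finally show "t \<le> n * (L + 1) * 60 + 30 \<and> nmem s' ''q'' 0 = quantum n L Q y div n \<and>
      nmem s' ''r'' 0 = quantum n L Q y mod n"
      using I by (simp add: I_def k_def)
  qed
qed

lemma wp_update:
  assumes st: "stored n L C V Act p s"
    and s: "nmem s ''j'' 0 = Suc i" "nmem s ''bin'' 0 = b"
      "nmem s ''q'' 0 = k div n" "nmem s ''r'' 0 = k mod n"
  shows "wp F (update_com H) (\<lambda>t s'. t \<le> 250 \<and>
    stored n L C V Act (settle n L H C V i b k p) s' \<and> nmem s' ''j'' 0 = Suc i) s"
proof -
  have fr: "rmem s ''V'' = V" "nmem s ''Act'' = Act"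
      "nmem s ''code'' 0 = code p" "nmem s ''opened'' 0 = opened p"
      "nmem s ''level'' = level p" "rmem s ''drift'' = drift p"
      "nmem s ''n'' 0 = n" "nmem s ''N'' 0 = n ^ (L + 1)" "rmem s ''C'' 0 = C"
      "nmem s ''pw'' = power_table n L" "rmem s ''pen'' = penalty_table L C"
    using st by (simp_all add: stored_def ready_def)
  show ?thesis
    unfolding update_com_def
    by (simp add: wp_simps mem_simps fr s landing_exp_def settle_def stored_def ready_def
        landing_def Let_def power2_eq_square del: power_Suc cong: wp_weak_cong)
qed

lemma wp_settle:
  assumes st: "stored n L C V Act p s" and n: "0 < n" "0 < Q"
    and s: "nmem s ''j'' 0 = Suc i" "nmem s ''bin'' 0 = b" "rmem s ''size'' 0 = y"
  shows "wp F (settle_com L Q H) (\<lambda>t s'. t \<le> n * (L + 1) * 60 + 300 \<and>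
    stored n L C V Act (settle n L H C V i b (quantum n L Q y) p) s' \<and> nmem s' ''j'' 0 = Suc i) s"
  unfolding settle_com_def wp_simps
  apply (rule wp_mono[OF wp_quantum[where n = n and y = y]])
  subgoal using st by (simp add: stored_def ready_def mem_simps)
  subgoal using n by simp
  subgoal using n by simp
  subgoal by (simp add: mem_simps)
  subgoal by (simp add: mem_simps)
  subgoal using s by (simp add: mem_simps)
  subgoal premises p for t s'
    apply (rule wp_mono[OF wp_update[where n = n and L = L and C = C and V = V and Act = Act and p = p and i = i and b = b
        and k = "quantum n L Q y"]])
    using p st s by (simp_all add: stored_def ready_def agree_def written_advance mem_simps del: power_Suc)
  done

text \<open>The \<open>LEAST\<close> in \<open>place\<close> as a linear search; a witness below
  \<open>n\<close> bounds its time.\<close>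

lemma wp_find:
  assumes "nmem s ''bin'' 0 = 0" "level_b = nmem s ''level''" "b < n" "level_b b = nmem s ''a'' 0"
  shows "wp F (While (BNot (BAnd (BNot (NLess (NGet ''level'' (nv ''bin'')) (nv ''a'')))
                          (BNot (NLess (nv ''a'') (NGet ''level'' (nv ''bin''))))))
          (nset ''bin'' (NPlus (nv ''bin'') (NConst 1))))
    (\<lambda>t s'. t \<le> n * 40 + 40 \<and> nmem s' ''bin'' 0 = (LEAST b. level_b b = nmem s ''a'' 0)) s"
proof -
  let ?b = "BNot (BAnd (BNot (NLess (NGet ''level'' (nv ''bin'')) (nv ''a'')))
                          (BNot (NLess (nv ''a'') (NGet ''level'' (nv ''bin'')))))"
  let ?c = "nset ''bin'' (NPlus (nv ''bin'') (NConst 1))"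
  define m where "m = (LEAST b. level_b b = nmem s ''a'' 0)"
  have m: "level_b m = nmem s ''a'' 0" "m \<le> b" "\<And>j. j < m \<Longrightarrow> level_b j \<noteq> nmem s ''a'' 0"
    unfolding m_def using assms(4) by (auto intro: LeastI Least_le dest: not_less_Least)
  have "wp F (While ?b ?c) (\<lambda>t s'. t \<le> m * (6 + 1 + bcost ?b) + (1 + bcost ?b) \<and>
      nmem s' ''bin'' 0 = m \<and> agree (written ?c) s s') s"
  proof (rule wp_While)
    show "nmem s ''bin'' 0 = 0" by fact
  next
    fix j s' assume "j < m" "nmem s' ''bin'' 0 = j" "agree (written ?c) s s'"
    with m(3)[of j] show "bval ?b s' \<and> wp F ?c (\<lambda>t s''. t \<le> 6 \<and> nmem s'' ''bin'' 0 = Suc j) s'"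
      using assms(2) by (auto simp: agree_def wp_simps mem_simps)
  next
    fix s' assume "nmem s' ''bin'' 0 = m" "agree (written ?c) s s'"
    with m(1) show "\<not> bval ?b s'" using assms(2) by (simp add: agree_def)
  qed
  then show ?thesis
    by (rule wp_mono) (use m(2) assms(3) in \<open>simp add: m_def[symmetric]\<close>)
qed

lemma wp_place:
  assumes st: "stored n L C V Act p s" and s: "nmem s ''j'' 0 = i"
    and ex: "Act (i * n ^ (L + 1) + code p) \<le> L \<Longrightarrow> \<exists>b<n. level p b = Act (i * n ^ (L + 1) + code p)"
  shows "wp F (place_com L H) (\<lambda>t s'. t \<le> n * 40 + 250 \<and>
    stored n L C V Act (snd (place n L H Act i p)) s' \<and> nmem s' ''j'' 0 = Suc i \<and>
    nmem s' ''bin'' 0 = fst (place n L H Act i p)) s"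
proof -
  define a where "a = Act (i * n ^ Suc L + code p)"
  have fr: "rmem s ''V'' = V" "nmem s ''Act'' = Act"
      "nmem s ''code'' 0 = code p" "nmem s ''opened'' 0 = opened p"
      "nmem s ''level'' = level p" "rmem s ''drift'' = drift p"
      "nmem s ''n'' 0 = n" "nmem s ''N'' 0 = n ^ (L + 1)" "rmem s ''C'' 0 = C"
      "nmem s ''pw'' = power_table n L" "rmem s ''pen'' = penalty_table L C"
    using st by (simp_all add: stored_def ready_def)
  show ?thesis
  proof (cases "a \<le> L")
    case False
    then show ?thesis unfolding a_def place_com_def open_com_def
      by (simp add: place_def open_bin_def Let_def wp_simps mem_simps fr s
          stored_def ready_def del: power_Suc cong: wp_weak_cong)
  next
    case True
    then obtain b where b: "b < n" "level p b = a" using ex by (auto simp: a_def)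
    show ?thesis
      unfolding place_com_def
      apply (simp add: wp_simps fr s mem_simps a_def[symmetric, unfolded Suc_eq_plus1] True[unfolded less_Suc_eq_le[symmetric] Suc_eq_plus1] del: power_Suc One_nat_def cong: wp_weak_cong)
      apply (rule wp_mono[OF wp_find[where level_b = "level p" and b = b and n = n]])
      subgoal by (simp add: mem_simps)
      subgoal using fr by (simp add: mem_simps)
      subgoal using b by simp
      subgoal using b by (simp add: mem_simps)
      subgoal for t s'
        using st True
        apply (simp add: agree_def mem_simps)
        unfolding open_com_def
        apply (simp add: wp_simps fr s mem_simps del: power_Suc cong: wp_weak_cong)
        apply (simp add: place_def open_bin_def retire_def Let_def stored_def ready_def a_def mem_simps power2_eq_square)
        done
      done
  qed
qed


text \<open>Between two decisions the memory holds the state after an item is placed and before its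
  size is known; the next decision resumes there.\<close>

lemma decides_packings:
  assumes n: "0 < n" "0 < Q" and st: "ready n L C s" "rmem s ''V'' = V" "nmem s ''Act'' = Act"
      "nmem s ''j'' 0 = 0" "nmem s ''code'' 0 = 0" "nmem s ''opened'' 0 = 0"
      "nmem s ''level'' = (\<lambda>_. 0)" "rmem s ''drift'' = (\<lambda>_. 0)"
    and B: "B = n * (L + 1) * 60 + n * 40 + 600"
    and ex: "\<And>i p. i < n \<Longrightarrow> p = packings n L H C V Act (\<lambda>j. quantum n L Q (x j)) i \<Longrightarrow>
      Act (i * n ^ (L + 1) + code p) \<le> L \<Longrightarrow> \<exists>b<n. level p b = Act (i * n ^ (L + 1) + code p)"
    and i: "i < n"
  shows "\<exists>s'. decides (decider L Q H) B s (map x [0..<i]) s' \<and>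
    (case place n L H Act i (packings n L H C V Act (\<lambda>j. quantum n L Q (x j)) i) of (b, p) \<Rightarrow>
      stored n L C V Act p s' \<and> nmem s' ''j'' 0 = Suc i \<and> nmem s' ''bin'' 0 = b)"
  using i
proof (induction i)
  case 0
  define p where "p = packings n L H C V Act (\<lambda>j. quantum n L Q (x j)) 0"
  have "wp (\<lambda>_ _. 0) (place_com L H) (\<lambda>t s'. t \<le> n * 40 + 250 \<and>
    stored n L C V Act (snd (place n L H Act 0 p)) s' \<and> nmem s' ''j'' 0 = Suc 0 \<and>
    nmem s' ''bin'' 0 = fst (place n L H Act 0 p)) s"
    by (rule wp_place) (use st ex[OF 0 p_def] in \<open>simp_all add: stored_def p_def\<close>)
  then have "wp (\<lambda>_ _. 0) (decider L Q H) (\<lambda>t s'. t \<le> B \<and>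
    stored n L C V Act (snd (place n L H Act 0 p)) s' \<and> nmem s' ''j'' 0 = Suc 0 \<and>
    nmem s' ''bin'' 0 = fst (place n L H Act 0 p)) s"
    unfolding decider_def wp_Seq by (simp add: wp_Cond wp_Skip st) (erule wp_mono, simp add: B)
  then show ?case
    unfolding wp_def p_def[symmetric] by (auto intro: decides_first split: prod.split)
next
  case (Suc i)
  define p where "p = packings n L H C V Act (\<lambda>j. quantum n L Q (x j)) i"
  obtain b p' where pl: "place n L H Act i p = (b, p')" by fastforce
  from Suc pl obtain s' where s': "decides (decider L Q H) B s (map x [0..<i]) s'"
    "stored n L C V Act p' s'" "nmem s' ''j'' 0 = Suc i" "nmem s' ''bin'' 0 = b"
    unfolding p_def by auto
  define q where "q = packings n L H C V Act (\<lambda>j. quantum n L Q (x j)) (Suc i)"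
  have q: "q = settle n L H C V i b (quantum n L Q (x i)) p'"
    using pl by (simp add: q_def p_def)
  let ?s = "set_rmem ''size'' 0 (x i) s'"
  have "wp (\<lambda>_ _. 0) (settle_com L Q H) (\<lambda>t s'. t \<le> n * (L + 1) * 60 + 300 \<and>
    stored n L C V Act q s' \<and> nmem s' ''j'' 0 = Suc i) ?s"
    unfolding q by (rule wp_settle) (use s' n in \<open>simp_all add: stored_def ready_def mem_simps\<close>)
  then have "wp (\<lambda>_ _. 0) (decider L Q H) (\<lambda>t s'. t \<le> B \<and>
    stored n L C V Act (snd (place n L H Act (Suc i) q)) s' \<and> nmem s' ''j'' 0 = Suc (Suc i) \<and>
    nmem s' ''bin'' 0 = fst (place n L H Act (Suc i) q)) ?s"
    unfolding decider_def wp_Seq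
    apply (simp add: wp_Cond mem_simps s' cong: wp_weak_cong)
    apply (erule wp_mono)
    apply (rule wp_mono[OF wp_place[where n = n and L = L and C = C and V = V and Act = Act and p = q and i = "Suc i"]])
    using ex[OF Suc.prems q_def] by (simp_all add: B)
  then obtain t s'' where s'': "exec (\<lambda>_ _. 0) (decider L Q H) ?s t s''" "t \<le> B"
    "stored n L C V Act (snd (place n L H Act (Suc i) q)) s''" "nmem s'' ''j'' 0 = Suc (Suc i)"
    "nmem s'' ''bin'' 0 = fst (place n L H Act (Suc i) q)"
    unfolding wp_def by blast
  have "decides (decider L Q H) B s (map x [0..<Suc i]) s''"
    using decides_later[OF s'(1) s''(1,2)] by simp
  with s''(3-5) show ?case
    unfolding q_def[symmetric] by (intro exI[of _ s'']) (simp add: case_prod_beta)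
qed

section \<open>Iterated integrals\<close>

text \<open>Expectation of \<open>f\<close> over items \<open>i\<close> to \<open>i + m - 1\<close>
  with the other sizes fixed by \<open>x\<close>. Coordinate \<open>i\<close> is integrated
  outermost, as backward induction over the rounds requires.\<close>

primrec rest_integral ::
  "(nat \<Rightarrow> real measure) \<Rightarrow> ((nat \<Rightarrow> real) \<Rightarrow> ennreal) \<Rightarrow> nat \<Rightarrow> nat \<Rightarrow> (nat \<Rightarrow> real) \<Rightarrow> ennreal" where
  "rest_integral M f 0 i x = f x"
| "rest_integral M f (Suc m) i x = (\<integral>\<^sup>+ y. rest_integral M f m (Suc i) (x(i := y)) \<partial>M i)"

lemma rest_integral_PiM:
  assumes M: "\<And>i. prob_space (M i)"
    and f: "f \<in> borel_measurable (Pi\<^sub>M {..<i + m} M)"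
  shows "rest_integral M f m i \<in> borel_measurable (Pi\<^sub>M {..<i} M) \<and>
    (\<integral>\<^sup>+ x. f x \<partial>Pi\<^sub>M {..<i + m} M) = (\<integral>\<^sup>+ x. rest_integral M f m i x \<partial>Pi\<^sub>M {..<i} M)"
  using f
proof (induction m arbitrary: i)
  case 0
  then show ?case by simp
next
  case (Suc m)
  show ?case (is "rest_integral M f (Suc m) ?i \<in> _ \<and> _")
  proof -
    interpret M: prob_space "M j" for j by (rule M)
    interpret product_sigma_finite M ..
    have eq: "{..<Suc ?i} = insert ?i {..<?i}" by auto
    define g where "g = rest_integral M f m (Suc ?i)"
    have g: "g \<in> borel_measurable (Pi\<^sub>M (insert ?i {..<?i}) M)"
      and int: "(\<integral>\<^sup>+ x. f x \<partial>Pi\<^sub>M {..<?i + Suc m} M) = (\<integral>\<^sup>+ x. g x \<partial>Pi\<^sub>M (insert ?i {..<?i}) M)"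
      using Suc.IH[of "Suc ?i"] Suc.prems unfolding g_def eq by auto
    have "(\<lambda>(x, y). g (x(?i := y))) \<in> borel_measurable (Pi\<^sub>M {..<?i} M \<Otimes>\<^sub>M M ?i)"
      using measurable_compose[OF measurable_add_dim g] by (simp add: case_prod_beta')
    then have "(\<lambda>x. \<integral>\<^sup>+ y. g (x(?i := y)) \<partial>M ?i) \<in> borel_measurable (Pi\<^sub>M {..<?i} M)"
      using M.borel_measurable_nn_integral_fst by fastforce
    moreover have "(\<integral>\<^sup>+ x. g x \<partial>Pi\<^sub>M (insert ?i {..<?i}) M) =
        (\<integral>\<^sup>+ x. \<integral>\<^sup>+ y. g (x(?i := y)) \<partial>M ?i \<partial>Pi\<^sub>M {..<?i} M)"
      by (rule product_nn_integral_insert) (use g in auto)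
    ultimately show ?thesis using int by (simp add: g_def)
  qed
qed

text \<open>The empty product space has the single point \<open>\<lambda>_. undefined\<close>, from
  which the iterated integral starts.\<close>

lemma nn_integral_PiM_rest:
  assumes "\<And>i. prob_space (M i)" "f \<in> borel_measurable (Pi\<^sub>M {..<n} M)"
  shows "(\<integral>\<^sup>+ x. f x \<partial>Pi\<^sub>M {..<n} M) = rest_integral M f n 0 (\<lambda>_. undefined)"
proof -
  interpret M: prob_space "M i" for i by (rule assms)
  interpret product_sigma_finite M ..
  show ?thesis
    using rest_integral_PiM[of M f 0 n] assms by (simp add: nn_integral_empty)
qed

text \<open>\<open>E\<close> is arbitrary because the nonnegative integral is monotone even on
  non-measurable functions. This keeps measurability of \<open>rest_integral\<close> out of the
  backward inductions.\<close>

lemma ennreal_integral_le: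
  fixes h :: "'a \<Rightarrow> real"
  assumes "integrable D h" "AE y in D. ennreal (h y) \<le> E y"
  shows "ennreal (\<integral>y. h y \<partial>D) \<le> (\<integral>\<^sup>+ y. E y \<partial>D)"
proof -
  have i: "integrable D (\<lambda>y. max 0 (h y))" using assms(1) by simp
  have "(\<integral>y. h y \<partial>D) \<le> (\<integral>y. max 0 (h y) \<partial>D)"
    using assms(1) i by (intro integral_mono) auto
  then have "ennreal (\<integral>y. h y \<partial>D) \<le> ennreal (\<integral>y. max 0 (h y) \<partial>D)"
    by (rule ennreal_leI)
  also have "\<dots> = (\<integral>\<^sup>+ y. ennreal (max 0 (h y)) \<partial>D)"
    using i by (intro nn_integral_eq_integral[symmetric]) auto
  also have "\<dots> \<le> (\<integral>\<^sup>+ y. E y \<partial>D)"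
    using assms(2) by (intro nn_integral_mono_AE) (auto simp: ennreal_max_0)
  finally show ?thesis .
qed

lemma le_ennreal_integral:
  fixes h :: "'a \<Rightarrow> real"
  assumes "integrable D h" "AE y in D. E y \<le> ennreal (h y)" "\<And>y. 0 \<le> h y"
  shows "(\<integral>\<^sup>+ y. E y \<partial>D) \<le> ennreal (\<integral>y. h y \<partial>D)"
  using nn_integral_mono_AE[OF assms(2)] nn_integral_eq_integral[OF assms(1)] assms(3) by simp

section \<open>Quantized sizes\<close>

lemma quantum_le: "quantum n L Q y \<le> n * (L + 1)"
  by (simp add: quantum_def nat_le_iff)

lemma quantum_le_iff:
  assumes "k < n * (L + 1)" "0 < Q"
  shows "quantum n L Q y \<le> k \<longleftrightarrow> y \<le> real k / (real n * real Q)"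
proof -
  have n: "0 < n" using assms(1) by (cases n) auto
  have "quantum n L Q y \<le> k \<longleftrightarrow> min \<lceil>real n * real Q * y\<rceil> (int (n * (L + 1))) \<le> int k"
    by (simp add: quantum_def nat_le_iff)
  also have "\<dots> \<longleftrightarrow> \<lceil>real n * real Q * y\<rceil> \<le> int k"
    using assms(1) unfolding min_le_iff_disj by linarith
  also have "\<dots> \<longleftrightarrow> y \<le> real k / (real n * real Q)"
    using n assms(2) by (simp add: ceiling_le_iff field_simps)
  finally show ?thesis .
qed

lemma quantum_upper:
  assumes "0 \<le> y"
  shows "real (quantum n L Q y) \<le> real n * real Q * y + 1"
proof -
  have "0 \<le> real n * real Q * y" using assms by simp
  then have "int (quantum n L Q y) \<le> \<lceil>real n * real Q * y\<rceil>"
    by (simp add: quantum_def)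
  then show ?thesis by linarith
qed

lemma measurable_quantum [measurable]: "quantum n L Q \<in> measurable borel (count_space UNIV)"
  unfolding quantum_def[abs_def] by measurable

lemma integrable_quantum:
  fixes h :: "nat \<Rightarrow> real"
  assumes "real_distribution D"
  shows "integrable D (\<lambda>y. h (quantum n L Q y))"
proof -
  interpret real_distribution D by fact
  show ?thesis
  proof (rule integrable_const_bound)
    have "finite ((\<lambda>k. \<bar>h k\<bar>) ` {..n * (L + 1)})" by simp
    then have "\<bar>h (quantum n L Q y)\<bar> \<le> Max ((\<lambda>k. \<bar>h k\<bar>) ` {..n * (L + 1)})" for y
      using quantum_le[of n L Q y] by (intro Max_ge) auto
    then show "AE y in D. norm (h (quantum n L Q y)) \<le> Max ((\<lambda>k. \<bar>h k\<bar>) ` {..n * (L + 1)})"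
      by simp
  qed measurable
qed

text \<open>Identifies the sum accumulated by the program with an expectation over the item.\<close>

lemma integral_quantum:
  fixes h :: "nat \<Rightarrow> real"
  assumes D: "real_distribution D" and n: "0 < n" "0 < Q"
  shows "(\<integral>y. h (quantum n L Q y) \<partial>D) =
    (\<Sum>k<n * (L + 1). grid_prob (cdf D) (real n * real Q) k * h k)
     + (1 - cdf D ((real (n * (L + 1)) - 1) / (real n * real Q))) * h (n * (L + 1))"
proof -
  interpret real_distribution D by fact
  define K where "K = n * (L + 1)"
  define M where "M = real n * real Q"
  have M: "0 < M" using n by (simp add: M_def)
  have K: "0 < K" using n by (simp add: K_def)
  note le = quantum_le_iff[of _ n L Q, folded K_def M_def, OF _ n(2)]
  let ?A = "\<lambda>k. {y. quantum n L Q y = k}"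
  have meas: "?A k \<in> sets D" for k
    using measurable_sets[OF measurable_quantum, of "{k}" n L Q] by (simp add: vimage_def)
  have "(\<integral>y. h (quantum n L Q y) \<partial>D) = (\<integral>y. (\<Sum>k\<le>K. h k * indicator (?A k) y) \<partial>D)"
  proof (rule Bochner_Integration.integral_cong[OF refl])
    fix y
    have "(\<Sum>k\<le>K. h k * indicator (?A k) y) = (\<Sum>k\<in>{quantum n L Q y}. h k)"
      using quantum_le[of n L Q y]
      by (intro sum.mono_neutral_cong_right) (auto simp: K_def indicator_def)
    then show "h (quantum n L Q y) = (\<Sum>k\<le>K. h k * indicator (?A k) y)" by simp
  qed
  also have "\<dots> = (\<Sum>k\<le>K. h k * measure D (?A k))"
    using meas by (subst Bochner_Integration.integral_sum)
      (auto intro!: integrable_mult_right simp: less_top[symmetric])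
  also have "\<dots> = (\<Sum>k<K. h k * measure D (?A k)) + h K * measure D (?A K)"
    by (simp add: lessThan_Suc_atMost[symmetric])
  also have "measure D (?A K) = 1 - cdf D ((real K - 1) / M)"
  proof -
    have "quantum n L Q y = K \<longleftrightarrow> \<not> y \<le> (real K - 1) / M" for y
      using le[of "K - 1" y] K quantum_le[of n L Q y, folded K_def] by (auto simp: of_nat_diff)
    then have "?A K = space D - {..(real K - 1) / M}" by auto
    moreover have "{..(real K - 1) / M} \<in> events" by simp
    ultimately show ?thesis using prob_compl by (simp add: cdf_def)
  qed
  also have "(\<Sum>k<K. h k * measure D (?A k)) = (\<Sum>k<K. grid_prob (cdf D) M k * h k)"
  proof (rule sum.cong[OF refl])
    fix k assume "k \<in> {..<K}"
    then have k: "k < K" by simp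
    have "measure D (?A k) = grid_prob (cdf D) M k"
    proof (cases k)
      case 0
      then have "?A k = {..real k / M}" using le[OF k] by auto
      then show ?thesis by (simp add: grid_prob_def cdf_def 0)
    next
      case (Suc j)
      have "quantum n L Q y = k \<longleftrightarrow> quantum n L Q y \<le> k \<and> \<not> quantum n L Q y \<le> j" for y
        using Suc by auto
      then have "quantum n L Q y = k \<longleftrightarrow> y \<le> real k / M \<and> \<not> y \<le> (real k - 1) / M" for y
        using le[OF k, of y] le[of j y] k Suc by simp
      then have "?A k = {..real k / M} - {..(real k - 1) / M}" by auto
      moreover have "(real k - 1) / M \<le> real k / M" using M by (simp add: divide_right_mono)
      ultimately show ?thesis
        by (simp add: grid_prob_def cdf_def Suc finite_measure_Diff)
    qed
    then show "h k * measure D (?A k) = grid_prob (cdf D) M k * h k" by simp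
  qed
  finally show ?thesis by (simp add: K_def M_def mult.commute)
qed

section \<open>Configurations\<close>

text \<open>In base \<open>n\<close>, the digit at position \<open>l\<close> counts the bins of
  level \<open>l\<close>; with fewer than \<open>n\<close> bins no carry occurs.\<close>

definition encode :: "nat \<Rightarrow> nat \<Rightarrow> nat multiset \<Rightarrow> nat" where
  "encode n L m = (\<Sum>l\<in>#m. power_table n L l)"

lemma encode_simps [simp]:
  "encode n L {#} = 0"
  "encode n L (add_mset l m) = power_table n L l + encode n L m"
  by (simp_all add: encode_def)

lemma encode_bound:
  assumes "size m < n" "\<And>l. l \<in># m \<Longrightarrow> l < k \<or> L < l" "0 < n"
  shows "encode n L m < n ^ k"
proof (cases k)
  case 0
  then have "\<forall>l\<in>#m. power_table n L l = 0"
    using assms(2) by (auto simp: power_table_def dest: leD)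
  then have "encode n L m = 0" by (simp add: encode_def)
  then show ?thesis using 0 by simp
next
  case (Suc j)
  have "power_table n L l \<le> n ^ j" if "l \<in># m" for l
    using assms(2)[OF that] assms(3) Suc
    by (auto simp: power_table_def intro: power_increasing)
  then have "encode n L m \<le> size m * n ^ j"
    unfolding encode_def by (induction m) fastforce+
  also have "\<dots> < n * n ^ j" using assms by simp
  finally show ?thesis using Suc by simp
qed

lemma encode_less:
  assumes "size m < n"
  shows "encode n L m < n ^ (L + 1)"
  using assms by (intro encode_bound) auto

text \<open>Levels above \<open>l\<close> contribute multiples of \<open>n ^ (l + 1)\<close>, and
  fewer than \<open>n\<close> bins of levels below \<open>l\<close> contribute less than
  \<open>n ^ l\<close> together. Hence the remainder reaches \<open>n ^ l\<close> only through a bin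
  of level \<open>l\<close>.\<close>

lemma encode_available:
  assumes "size m < n" "l \<le> L"
  shows "n ^ l \<le> encode n L m mod n ^ (l + 1) \<longleftrightarrow> l \<in># m"
proof -
  have n: "0 < n" using assms(1) by simp
  define lo where "lo = filter_mset (\<lambda>j. j \<le> l) m"
  define hi where "hi = filter_mset (\<lambda>j. \<not> j \<le> l) m"
  have m: "m = lo + hi" by (simp add: lo_def hi_def)
  have "n ^ (l + 1) dvd encode n L hi"
  proof -
    have "n ^ (l + 1) dvd power_table n L j" if "j \<in># hi" for j
      using that by (auto simp: hi_def power_table_def intro!: le_imp_power_dvd simp del: power_Suc)
    then show ?thesis unfolding encode_def by (induction hi) auto
  qed
  moreover have size: "size lo < n"
    using assms(1) size_filter_mset_lesseq unfolding lo_def by (rule order.strict_trans1[rotated])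
  moreover have "encode n L lo < n ^ (l + 1)"
    by (rule encode_bound) (use size n in \<open>auto simp: lo_def\<close>)
  moreover have "encode n L m = encode n L lo + encode n L hi"
    by (subst m) (simp add: encode_def)
  ultimately have mod: "encode n L m mod n ^ (l + 1) = encode n L lo"
    by (metis mod_add_right_eq dvd_imp_mod_0 add.right_neutral mod_less)
  show ?thesis unfolding mod
  proof
    assume "l \<in># m"
    then have "l \<in># lo" by (simp add: lo_def)
    then obtain m' where "lo = add_mset l m'" by (metis insert_DiffM)
    then show "n ^ l \<le> encode n L lo" using assms(2) by (simp add: power_table_def)
  next
    assume *: "n ^ l \<le> encode n L lo"
    show "l \<in># m"
    proof (rule ccontr)
      assume "l \<notin># m"
      then have "encode n L lo < n ^ l"
        by (intro encode_bound) (use size n in \<open>auto simp: lo_def le_less\<close>)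
      with * show False by simp
    qed
  qed
qed

lemma encode_remove: "l \<in># m \<Longrightarrow> l \<le> L \<Longrightarrow> encode n L m - n ^ l = encode n L (m - {#l#})"
  by (auto simp: power_table_def dest!: multi_member_split)

section \<open>Averages over the two roundings\<close>

lemma mean_le:
  assumes "0 < n" "W (l + k div n) \<le> c" "W (l + k div n + 1) \<le> c"
  shows "mean n W l k \<le> c"
proof -
  have r: "k mod n < n" using assms(1) by simp
  have "mean n W l k \<le> real (n - k mod n) / real n * c + real (k mod n) / real n * c"
    unfolding mean_def using assms by (intro add_mono mult_left_mono) auto
  also have "\<dots> = c" using r by (simp add: of_nat_diff field_simps)
  finally show ?thesis .
qed

lemma mean_ge:
  assumes "0 < n" "c \<le> W (l + k div n)" "c \<le> W (l + k div n + 1)"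
  shows "c \<le> mean n W l k"
  using mean_le[of n "\<lambda>l. - W l" l k "- c"] assms by (simp add: mean_def)

lemma mean_affine:
  assumes "0 < n"
  shows "mean n (\<lambda>l. W l + (c - D l / s)) l k = mean n W l k + c - mean n D l k / s"
proof -
  define v w where "v = real (n - k mod n) / real n" and "w = real (k mod n) / real n"
  have "k mod n < n" using assms by simp
  then have "v + w = 1" using assms by (simp add: v_def w_def of_nat_diff field_simps)
  moreover have "v * (a + (c - e / s)) + w * (a' + (c - e' / s)) =
      (v * a + w * a') + (v + w) * c - (v * e + w * e') / s" for a a' e e'
    by (simp add: algebra_simps add_divide_distrib)
  ultimately show ?thesis by (simp add: mean_def v_def w_def)
qed

text \<open>The two possible drifts average to the old one, so only the variance is added.\<close>

lemma mean_square:
  assumes "0 < n" "W (l + k div n) = (d + real (k mod n))\<^sup>2"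
    "W (l + k div n + 1) = (d + real (k mod n) - real n)\<^sup>2"
  shows "mean n W l k = d\<^sup>2 + real (k mod n) * (real n - real (k mod n))"
proof -
  have r: "k mod n \<le> n" using assms(1) by (simp add: less_imp_le)
  show ?thesis unfolding mean_def assms(2,3) using assms(1) r
    by (simp add: of_nat_diff field_simps power2_eq_square)
qed

section \<open>Cost along a run\<close>

lemma history_cong: "(\<And>j. j < i \<Longrightarrow> x j = y j) \<Longrightarrow> history P x i = history P y i"
  by (induction i) auto

lemma choice_cong: "(\<And>j. j < i \<Longrightarrow> x j = y j) \<Longrightarrow> choice P x i = choice P y i"
  unfolding choice_def by (metis history_cong)

lemma choice_upd: "j \<le> i \<Longrightarrow> choice P (x(i := y)) j = choice P x j"
  by (rule choice_cong) auto

lemma usage_cong: "(\<And>j. j < i \<Longrightarrow> x j = y j) \<Longrightarrow> usage P x i b = usage P y i b"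
proof -
  assume eq: "\<And>j. j < i \<Longrightarrow> x j = y j"
  then have "choice P x j = choice P y j" if "j < i" for j
    using that by (intro choice_cong) auto
  with eq show ?thesis unfolding usage_def by (intro sum.cong) auto
qed

lemma usage_Suc:
  "usage P (x(i := y)) (Suc i) b = usage P x i b + (if b = choice P x i then y else 0)"
proof -
  have "{j. j < Suc i \<and> choice P (x(i := y)) j = b} =
     {j. j < i \<and> choice P x j = b} \<union> (if b = choice P x i then {i} else {})"
    by (auto simp: less_Suc_eq choice_upd)
  moreover have "(\<Sum>j | j < i \<and> choice P x j = b. (x(i := y)) j) = usage P x i b"
    unfolding usage_def by (intro sum.cong) auto
  ultimately show ?thesis by (simp add: usage_def)
qed

lemma usage_nonneg: "(\<And>j. j < i \<Longrightarrow> 0 \<le> x j) \<Longrightarrow> 0 \<le> usage P x i b"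
  unfolding usage_def by (intro sum_nonneg) auto

lemma usage_fresh: "b \<notin> choice P x ` {..<i} \<Longrightarrow> usage P x i b = 0"
  unfolding usage_def by (intro sum.neutral) auto

lemma choices_Suc:
  "choice P (x(i := y)) ` {..<Suc i} = insert (choice P x i) (choice P x ` {..<i})"
  by (auto simp: lessThan_Suc choice_upd)

definition score :: "real \<Rightarrow> real \<Rightarrow> policy \<Rightarrow> nat \<Rightarrow> (nat \<Rightarrow> real) \<Rightarrow> real" where
  "score c C P i x = real (card (choice P x ` {..<i}))
     + C * real (card {b \<in> choice P x ` {..<i}. c < usage P x i b})"

text \<open>The chosen bin has not overflowed yet, so an overflow after this round is a new
  one.\<close>

lemma score_Suc:
  assumes "0 \<le> y" "usage P x i (choice P x i) \<le> c"
  shows "score c C P (Suc i) (x(i := y)) = score c C P i x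
    + of_bool (choice P x i \<notin> choice P x ` {..<i}) + C * of_bool (c < usage P x i (choice P x i) + y)"
proof -
  define b where "b = choice P x i"
  define S where "S = choice P x ` {..<i}"
  define O' where "O' = {b \<in> S. c < usage P x i b}"
  have fin: "finite S" "finite O'" by (auto simp: S_def O'_def)
  have "{b' \<in> insert b S. c < usage P (x(i := y)) (Suc i) b'} =
      (if c < usage P x i b + y then insert b O' else O')" "b \<notin> O'"
    using assms by (auto simp: usage_Suc O'_def b_def)
  then have "card {b' \<in> insert b S. c < usage P (x(i := y)) (Suc i) b'} =
      card O' + of_bool (c < usage P x i b + y)"
    using fin by simp
  moreover have "card (insert b S) = card S + of_bool (b \<notin> S)"
    using fin by (simp add: card_insert_if)
  ultimately show ?thesis
    unfolding score_def choices_Suc b_def[symmetric] S_def[symmetric] O'_def[symmetric]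
    by (simp add: algebra_simps)
qed

lemma admissible_usage:
  assumes "admissible c n P" "i < n" "\<And>j. j < i \<Longrightarrow> 0 \<le> x j"
  shows "usage P x i (choice P x i) \<le> c"
proof -
  \<comment> \<open>Admissibility speaks of vectors nonnegative in all \<open>n\<close> coordinates;
    the future is set to 0, which affects neither the choice nor the usage.\<close>
  define x' where "x' j = (if j < i then x j else 0)" for j
  have "choice P x i = choice P x' i" "usage P x i b = usage P x' i b" for b
    by (rule choice_cong usage_cong, simp add: x'_def)+
  moreover have "usage P x' i (choice P x' i) \<le> c"
    using assms unfolding admissible_def by (auto simp: x'_def)
  ultimately show ?thesis by simp
qed

text \<open>Padded to a total family of probability measures, as the product measure locales require.\<close>

definition item :: "real measure list \<Rightarrow> nat \<Rightarrow> real measure" where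
  "item Ds i = (if i < length Ds then Ds ! i else return borel 0)"

section \<open>The value of the plan against an arbitrary policy of unit capacity\<close>

locale planned =
  fixes Ds :: "real measure list" and C :: real and n Q H L :: nat
    and V :: "nat \<Rightarrow> real" and Act :: "nat \<Rightarrow> nat"
  assumes n: "n = length Ds" "0 < n" and QH: "0 < Q" "0 < H" "L = Q + H + 1"
    and items: "\<And>D. D \<in> set Ds \<Longrightarrow> item_distribution D"
    and C: "1 \<le> C"
    and table: "plan_table (cdf_answers Ds) n L Q C V Act"
begin

abbreviation "kap \<equiv> quantum n L Q"
abbreviation "W i y \<equiv> landing (penalty_table L C) (power_table n L) V ((i + 1) * n ^ (L + 1) + y)"
abbreviation "load k \<equiv> real k / (real n * (real H)\<^sup>2)"
abbreviation "sqdev \<equiv> (real n * real H)\<^sup>2"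

lemma sqdev_pos: "0 < sqdev"
  using n QH by simp

lemma item_cases: "real_distribution (item Ds i) \<and> (AE y in item Ds i. 0 \<le> y)"
proof (cases "i < length Ds")
  case True
  then have "item Ds i = Ds ! i" "item_distribution (Ds ! i)"
    using items[of "Ds ! i"] by (simp_all add: item_def)
  then show ?thesis by (simp only: item_distribution_def)
next
  case False
  have "real_distribution (return borel (0::real))"
    by (auto simp: real_distribution_def real_distribution_axioms_def intro!: prob_space_return)
  moreover have "AE y in return borel (0::real). 0 \<le> y"
    by (subst AE_return) auto
  moreover have "item Ds i = return borel 0" using False by (simp add: item_def)
  ultimately show ?thesis by (simp only:)
qed

lemma item_dist: "real_distribution (item Ds i)" and item_nonneg: "AE y in item Ds i. 0 \<le> y"
  using item_cases by auto

lemma prob_space_item: "prob_space (item Ds i)"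
  using item_dist[of i] by (simp add: real_distribution_def)

lemma backup_eq:
  assumes "i < n" "l \<le> L"
  shows "backup (cdf_answers Ds) n L Q C V i y l = (\<integral>z. mean n (W i y) l (kap z) \<partial>item Ds i)"
proof -
  have "cdf_answers Ds i = cdf (item Ds i)"
    using assms n by (simp add: cdf_answers_def item_def fun_eq_iff)
  \<comment> \<open>A capped size has remainder 0 and leads above level \<open>L\<close>: it pays
    \<open>C\<close> and the bin leaves the code, which is the constant passed to
    \<open>plan_value\<close>.\<close>
  moreover have "mean n (W i y) l (n * (L + 1)) = C + V ((i + 1) * n ^ (L + 1) + y)"
    using n(2) assms(2) by (simp add: mean_def landing_def penalty_table_def power_table_def)
  ultimately show ?thesis
    using integral_quantum[OF item_dist[of i] n(2) QH(1), where h = "mean n (W i y) l" and L = L]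
    by (simp add: backup_def plan_value_def)
qed

lemma variance_le_load: "real (k mod n) * (real n - real (k mod n)) / sqdev \<le> load k"
proof -
  have "real (k mod n) * (real n - real (k mod n)) \<le> real k * real n"
    by (intro mult_mono) (auto simp: n(2) less_imp_le)
  then have "real (k mod n) * (real n - real (k mod n)) / sqdev \<le> real k * real n / sqdev"
    using sqdev_pos by (intro divide_right_mono) auto
  also have "\<dots> = load k" using n by (simp add: power2_eq_square)
  finally show ?thesis .
qed

lemma entry:
  assumes "i < n" "size m < n"
  shows "optimal_entry (backup (cdf_answers Ds) n L Q C V i) n L 0 (encode n L m)
     (V (i * n ^ (L + 1) + encode n L m)) (Act (i * n ^ (L + 1) + encode n L m))"
  using table assms encode_less[of m n L] by (simp add: plan_table_def)

lemma entry_le_new: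
  assumes "i < n" "size m < n"
  shows "V (i * n ^ (L + 1) + encode n L m) \<le> 1 + backup (cdf_answers Ds) n L Q C V i (encode n L m) 0"
  using entry[OF assms] by (simp add: optimal_entry_def)

lemma entry_le_level:
  assumes "i < n" "size m < n" "l \<in># m" "l \<le> L"
  shows "V (i * n ^ (L + 1) + encode n L m) \<le>
    backup (cdf_answers Ds) n L Q C V i (encode n L (m - {#l#})) l"
  using entry[OF assms(1,2)] encode_available[OF assms(2,4)] assms(3,4)
    encode_remove[OF assms(3,4), of n]
  by (auto simp: optimal_entry_def)

text \<open>The loads are part of the cost so that they pay for the growth of the potential along
  the run.\<close>

definition run_cost :: "policy \<Rightarrow> (nat \<Rightarrow> real) \<Rightarrow> ennreal" where
  "run_cost P x = ennreal (score 1 C P n x + (\<Sum>j<n. load (kap (x j))))"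

lemma abs_drift_less: "d\<^sup>2 < sqdev \<Longrightarrow> \<bar>d\<bar> < real n * real H" for d :: real
  by (metis power2_abs power2_less_imp_less of_nat_0_le_iff mult_nonneg_nonneg)

text \<open>
  A policy with unit capacity is shadowed in the random process: \<open>lev\<close> and \<open>d\<close> are the level and drift
  of the shadow of a bin, and the configuration \<open>m\<close> may contain further, abandoned bins.  If the
  chosen bin is new or its shadow has drifted too far, the shadow is a fresh bin.
\<close>

lemma shadow_start:
  assumes i: "i < n" and x: "\<And>j. j < i \<Longrightarrow> 0 \<le> x j" and P: "admissible 1 n P"
    and S: "S = choice P x ` {..<i}" and b: "b = choice P x i"
    and m: "image_mset lev (mset_set S) \<subseteq># m" "size m \<le> i"
    and inv: "\<And>b. b \<in> S \<Longrightarrow> real n * real (lev b) + d b \<le> real n * real Q * usage P x i b + real i"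
  obtains l0 d0 m0 fee where "l0 \<le> L" "d0\<^sup>2 < sqdev" "image_mset lev (mset_set (S - {b})) \<subseteq># m0"
    "size m0 \<le> i" "real n * real l0 + d0 \<le> real n * real Q * usage P x i b + real i"
    "V (i * n ^ (L + 1) + encode n L m) \<le> fee + backup (cdf_answers Ds) n L Q C V i (encode n L m0) l0"
    "fee + d0\<^sup>2 / sqdev \<le> (if b \<in> S then (d b)\<^sup>2 / sqdev else 1)"
proof (cases "b \<in> S \<and> (d b)\<^sup>2 < sqdev")
  case True
  have fin: "finite S" by (simp add: S)
  have "mset_set S = add_mset b (mset_set (S - {b}))"
    using True fin by (simp add: mset_set.remove)
  then have m': "add_mset (lev b) (image_mset lev (mset_set (S - {b}))) \<subseteq># m" using m(1) by simp
  then have mem: "lev b \<in># m" by (meson insert_subset_eq_iff)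
  have d: "\<bar>d b\<bar> < real n * real H" using True abs_drift_less by blast
  \<comment> \<open>Usage at most 1 keeps the shadow within level \<open>L = Q + H + 1\<close>:
    \<open>Q\<close> for the usage, \<open>H\<close> for the drift, and 1 for at most
    \<open>i < n\<close> units of rounding up.\<close>
  have "usage P x i b \<le> 1" unfolding b using P i x by (rule admissible_usage)
  then have "real n * real Q * usage P x i b \<le> real n * real Q" by (simp add: mult_left_le)
  then have "real n * real (lev b) \<le> real n * real Q + real i - d b"
    using inv[of b] True by linarith
  also have "\<dots> \<le> real n * real Q + real n + real n * real H" using d i by linarith
  also have "\<dots> = real n * real L" by (simp add: QH algebra_simps)
  finally have "lev b \<le> L" using n(2) by (simp flip: of_nat_mult)
  show ?thesis
  proof (rule that[of "lev b" "d b" "m - {#lev b#}" 0])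
    show "V (i * n ^ (L + 1) + encode n L m) \<le>
        0 + backup (cdf_answers Ds) n L Q C V i (encode n L (m - {#lev b#})) (lev b)"
      using entry_le_level[OF i _ mem \<open>lev b \<le> L\<close>] m(2) i by simp
    show "image_mset lev (mset_set (S - {b})) \<subseteq># m - {#lev b#}"
      using m' by (simp add: insert_subset_eq_iff)
    show "size (m - {#lev b#}) \<le> i" using m(2) by (simp add: size_Diff_submset mem)
  qed (use True \<open>lev b \<le> L\<close> inv in auto)
next
  case False
  show ?thesis
  \<comment> \<open>If \<open>b\<close> was already open, its drifted shadow stays in
    \<open>m\<close> as an abandoned bin, and its potential of at least 1 pays the fee. Otherwise
    the policy itself opens a bin.\<close>
  proof (rule that[of 0 0 m 1])
    show "V (i * n ^ (L + 1) + encode n L m) \<le> 1 + backup (cdf_answers Ds) n L Q C V i (encode n L m) 0"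
      using entry_le_new[OF i] m(2) i by simp
    have "mset_set (S - {b}) \<subseteq># mset_set S"
      by (rule subset_imp_msubset_mset_set) (auto simp: S)
    then show "image_mset lev (mset_set (S - {b})) \<subseteq># m"
      using m(1) image_mset_subseteq_mono subset_mset.order_trans by blast
    show "1 + 0\<^sup>2 / sqdev \<le> (if b \<in> S then (d b)\<^sup>2 / sqdev else 1)"
      using False sqdev_pos by (auto simp: not_less)
    show "real n * real 0 + 0 \<le> real n * real Q * usage P x i b + real i"
      using usage_nonneg[OF x] by simp
  qed (use m sqdev_pos in auto)
qed

text \<open>The policy does not see its shadow, so the continuation \<open>E\<close> is the same
  whichever way the shadow is rounded; the bounds for the two roundings therefore imply the bound
  for their average. This is why the induction is over all shadows \<open>lev\<close>,
  \<open>m\<close>, \<open>d\<close> compatible with the history.\<close>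

lemma value_le_run_cost:
  assumes P: "admissible 1 n P"
  shows "i \<le> n \<Longrightarrow> (\<And>j. j < i \<Longrightarrow> 0 \<le> x j) \<Longrightarrow> S = choice P x ` {..<i} \<Longrightarrow>
    image_mset lev (mset_set S) \<subseteq># m \<Longrightarrow> size m \<le> i \<Longrightarrow>
    (\<And>b. b \<in> S \<Longrightarrow> real n * real (lev b) + d b \<le> real n * real Q * usage P x i b + real i) \<Longrightarrow>
    ennreal (V (i * n ^ (L + 1) + encode n L m) + score 1 C P i x + (\<Sum>j<i. load (kap (x j)))
      - (\<Sum>b\<in>S. (d b)\<^sup>2) / sqdev) \<le> rest_integral (item Ds) (run_cost P) (n - i) i x"
proof (induction "n - i" arbitrary: i x S lev m d)
  case 0
  then have i: "i = n" by simp
  have "V (i * n ^ (L + 1) + encode n L m) = 0"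
    using table by (simp add: plan_table_def i)
  moreover have "0 \<le> (\<Sum>b\<in>S. (d b)\<^sup>2) / sqdev" by (intro divide_nonneg_nonneg sum_nonneg) auto
  ultimately show ?case by (simp add: i run_cost_def ennreal_leI)
next
  case (Suc k i)
  note x = Suc.prems(2) and S = Suc.prems(3) and m = Suc.prems(4,5) and inv = Suc.prems(6)
  have i: "i < n" using Suc.hyps(2) by simp
  define b where "b = choice P x i"
  define u where "u = usage P x i b"
  have fin: "finite S" by (simp add: S)
  have u1: "u \<le> 1" unfolding u_def b_def using P i x by (rule admissible_usage)
  obtain l0 d0 m0 fee where l0: "l0 \<le> L" and d0: "d0\<^sup>2 < sqdev"
    and m0: "image_mset lev (mset_set (S - {b})) \<subseteq># m0" "size m0 \<le> i"
    and inv0: "real n * real l0 + d0 \<le> real n * real Q * u + real i"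
    and V0: "V (i * n ^ (L + 1) + encode n L m) \<le> fee + backup (cdf_answers Ds) n L Q C V i (encode n L m0) l0"
    and fee: "fee + d0\<^sup>2 / sqdev \<le> (if b \<in> S then (d b)\<^sup>2 / sqdev else 1)"
    using shadow_start[OF i x P S b_def m inv] unfolding u_def by metis
  have d0': "\<bar>d0\<bar> < real n * real H" using d0 by (rule abs_drift_less)
  define A where "A = score 1 C P i x + of_bool (b \<notin> S) + (\<Sum>j<i. load (kap (x j)))
    - (\<Sum>b\<in>S - {b}. (d b)\<^sup>2) / sqdev"
  define E where "E y = rest_integral (item Ds) (run_cost P) (n - Suc i) (Suc i) (x(i := y))" for y
  have step: "ennreal (mean n (W i (encode n L m0)) l0 (kap y) + (A - d0\<^sup>2 / sqdev)) \<le> E y"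
    if y: "0 \<le> y" for y
  proof -
    define k where "k = kap y"
    define q r where "q = k div n" and "r = k mod n"
    have kqr: "real n * real q + real r = real k"
      unfolding q_def r_def by (simp flip: of_nat_mult of_nat_add)
    have r: "r < n" using n by (simp add: r_def)
    have kap: "real k \<le> real n * real Q * y + 1" unfolding k_def using y by (rule quantum_upper)
    define D where "D l = (if l = l0 + q then d0 + real r else d0 + real r - real n)" for l
    define T where "T l = W i (encode n L m0) l + (A + load k - (D l)\<^sup>2 / sqdev)" for l
    have T: "ennreal (T l) \<le> E y" if l: "l = l0 + q \<or> l = l0 + q + 1" for l
    proof -
      have Dl: "real n * real l + D l = real n * real l0 + d0 + real k"
        using l kqr by (auto simp: D_def algebra_simps)
      have S': "insert b S = choice P (x(i := y)) ` {..<Suc i}"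
        unfolding choices_Suc S b_def ..
      have ms: "mset_set (insert b S) = add_mset b (mset_set (S - {b}))"
        using fin by (simp add: mset_set.insert_remove)
      have im: "image_mset (lev(b := l)) (mset_set (S - {b})) = image_mset lev (mset_set (S - {b}))"
        by (rule image_mset_cong) (auto simp: fin)
      have sum: "(\<Sum>b'\<in>insert b S. ((d(b := D l)) b')\<^sup>2) = (D l)\<^sup>2 + (\<Sum>b\<in>S - {b}. (d b)\<^sup>2)"
        using fin by (simp add: sum.insert_remove)
      \<comment> \<open>Rounding a size up to whole units adds at most one unit, which the slack
        \<open>real (Suc i)\<close> absorbs.\<close>
      have inv': "real n * real ((lev(b := l)) b') + (d(b := D l)) b' \<le>
          real n * real Q * usage P (x(i := y)) (Suc i) b' + real (Suc i)" if "b' \<in> insert b S" for b'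
      proof (cases "b' = b")
        case True
        have "real n * real l + D l \<le> real n * real Q * (u + y) + real (Suc i)"
          unfolding Dl using inv0 kap by (simp add: algebra_simps)
        then show ?thesis using True by (simp add: usage_Suc b_def u_def)
      next
        case False
        then show ?thesis using that inv[of b'] by (simp add: usage_Suc b_def)
      qed
      have IH: "ennreal (V (Suc i * n ^ (L + 1) + encode n L (add_mset l m0)) + score 1 C P (Suc i) (x(i := y))
          + (\<Sum>j<Suc i. load (kap ((x(i := y)) j))) - (\<Sum>b'\<in>insert b S. ((d(b := D l)) b')\<^sup>2) / sqdev) \<le> E y"
        unfolding E_def
      proof (rule Suc.hyps(1)[OF _ _ _ S'])
        show "image_mset (lev(b := l)) (mset_set (insert b S)) \<subseteq># add_mset l m0"
          using m0(1) by (simp add: ms im)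
      qed (use Suc.hyps(2) i x y m0 inv' in \<open>auto simp: less_Suc_eq\<close>)
      \<comment> \<open>A bin that does not overflow stays below level
        \<open>L + 1 = Q + H + 2\<close>: \<open>Q\<close> for the usage, 1 for at most
        \<open>n\<close> units of rounding up, less than \<open>H\<close> for the old drift, and 1
        for the present rounding.\<close>
      have pen: "penalty_table L C l \<le> C * of_bool (1 < u + y)"
      proof (cases "1 < u + y \<or> l \<le> L")
        case False
        then have "real n * real Q * (u + y) \<le> real n * real Q" by (simp add: mult_left_le)
        then have "real n * real l \<le> real n * real Q + 1 + real i - D l"
          using Dl inv0 kap by (simp add: algebra_simps)
        moreover have "D l \<ge> d0 - real n" by (simp add: D_def)
        ultimately have "real n * real l < real n * real Q + real n + real n + real n * real H"
          using d0' i by linarith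
        also have "\<dots> = real n * real (L + 1)" by (simp add: QH algebra_simps)
        finally have "l < L + 1" using n(2) mult_less_cancel_left_pos[of "real n"]
          by (metis of_nat_0_less_iff of_nat_less_iff)
        then show ?thesis using False by simp
      qed (use C in \<open>auto simp: penalty_table_def\<close>)
      have sc: "score 1 C P (Suc i) (x(i := y)) = score 1 C P i x + of_bool (b \<notin> S) + C * of_bool (1 < u + y)"
        using score_Suc[OF y, of P x i 1 C] u1 by (simp add: b_def u_def S)
      have "T l \<le> V (Suc i * n ^ (L + 1) + encode n L (add_mset l m0)) + score 1 C P (Suc i) (x(i := y))
          + (\<Sum>j<Suc i. load (kap ((x(i := y)) j))) - (\<Sum>b'\<in>insert b S. ((d(b := D l)) b')\<^sup>2) / sqdev"
        unfolding sum sc using pen by (simp add: T_def A_def landing_def k_def[symmetric] add_divide_distrib add_ac S b_def)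
      then show ?thesis using IH by (meson ennreal_leI order_trans)
    qed
    have "mean n T l0 k \<le> max (T (l0 + q)) (T (l0 + q + 1))"
      by (rule mean_le) (auto simp: n(2) q_def)
    then have "ennreal (mean n T l0 k) \<le> E y"
      using T by (metis ennreal_leI max_def order_trans)
    moreover have "mean n T l0 k = mean n (W i (encode n L m0)) l0 k + (A + load k) -
        (d0\<^sup>2 + real r * (real n - real r)) / sqdev"
    proof -
      have "mean n (\<lambda>l. (D l)\<^sup>2) l0 k = d0\<^sup>2 + real r * (real n - real r)"
        unfolding r_def by (rule mean_square) (auto simp: n(2) D_def q_def r_def)
      moreover have "mean n T l0 k = mean n (W i (encode n L m0)) l0 k + (A + load k) - mean n (\<lambda>l. (D l)\<^sup>2) l0 k / sqdev"
        unfolding T_def by (rule mean_affine[OF n(2)])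
      ultimately show ?thesis by simp
    qed
    moreover have "real r * (real n - real r) / sqdev \<le> load k"
      unfolding r_def by (rule variance_le_load)
    ultimately show ?thesis
      by (elim order_trans[rotated]) (simp add: k_def add_divide_distrib ennreal_leI)
  qed
  have int: "integrable (item Ds i) (\<lambda>y. mean n (W i (encode n L m0)) l0 (kap y))"
    by (rule integrable_quantum[OF item_dist])
  interpret prob_space "item Ds i" by (rule prob_space_item)
  have "ennreal (\<integral>y. mean n (W i (encode n L m0)) l0 (kap y) + (A - d0\<^sup>2 / sqdev) \<partial>item Ds i)
      \<le> (\<integral>\<^sup>+ y. E y \<partial>item Ds i)"
    using item_nonneg[of i] step int by (intro ennreal_integral_le) (auto elim: eventually_mono)
  also have "(\<integral>\<^sup>+ y. E y \<partial>item Ds i) = rest_integral (item Ds) (run_cost P) (n - i) i x"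
    unfolding E_def using i by (simp flip: Suc_diff_Suc)
  also have "(\<integral>y. mean n (W i (encode n L m0)) l0 (kap y) + (A - d0\<^sup>2 / sqdev) \<partial>item Ds i)
     = backup (cdf_answers Ds) n L Q C V i (encode n L m0) l0 + (A - d0\<^sup>2 / sqdev)"
    using int by (simp add: backup_eq[OF i l0] prob_space)
  finally have le: "ennreal (backup (cdf_answers Ds) n L Q C V i (encode n L m0) l0 + (A - d0\<^sup>2 / sqdev))
    \<le> rest_integral (item Ds) (run_cost P) (n - i) i x" .
  have "(\<Sum>b\<in>S. (d b)\<^sup>2) / sqdev = (if b \<in> S then (d b)\<^sup>2 / sqdev else 0) + (\<Sum>b\<in>S - {b}. (d b)\<^sup>2) / sqdev"
    using fin by (simp add: sum.remove[of S b] add_divide_distrib)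
  then have "V (i * n ^ (L + 1) + encode n L m) + score 1 C P i x + (\<Sum>j<i. load (kap (x j)))
      - (\<Sum>b\<in>S. (d b)\<^sup>2) / sqdev \<le> backup (cdf_answers Ds) n L Q C V i (encode n L m0) l0 + (A - d0\<^sup>2 / sqdev)"
    using V0 fee by (simp add: A_def split: if_splits)
  then show ?case using le by (meson ennreal_leI order_trans)
qed

end

section \<open>The deterministic policy against the value of the plan\<close>

lemma length_history [simp]: "length (history P x i) = i"
  by (induction i) auto

lemma snd_history: "j < i \<Longrightarrow> snd (history P x i ! j) = x j"
  by (induction i) (auto simp: nth_append less_Suc_eq)

lemma packings_cong:
  "(\<And>j. j < i \<Longrightarrow> ks j = ks' j) \<Longrightarrow> packings n L H C V Act ks i = packings n L H C V Act ks' i"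
  by (induction i) auto

context planned
begin

text \<open>The induction is over addresses rather than configurations, since adding a power to an
  arbitrary code may lead past the end of its layer.\<close>

lemma V_nonneg: "0 \<le> V a"
proof -
  define N where "N = n ^ (L + 1)"
  have N: "0 < N" using n by (simp add: N_def)
  have "(n - j) * N \<le> a \<Longrightarrow> 0 \<le> V a" for j a
  proof (induction j arbitrary: a)
    case 0
    then show ?case using table by (simp add: plan_table_def N_def)
  next
    case (Suc j)
    show ?case
    proof (cases "(n - j) * N \<le> a")
      case False
      define i x where "i = a div N" and "x = a mod N"
      have a: "a = i * N + x" "x < N" using N by (simp_all add: i_def x_def)
      have i: "n - Suc j \<le> i" "i < n - j"
        using Suc.prems False N by (simp_all add: i_def less_eq_div_iff_mult_less_eq div_less_iff_less_mult)
      then have i1: "(i + 1) * N \<ge> (n - j) * N" by (intro mult_le_mono1) auto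
      have W0: "0 \<le> W i y l" for y l
        unfolding landing_def
      proof (intro add_nonneg_nonneg Suc.IH)
        show "0 \<le> penalty_table L C l" using C by (simp add: penalty_table_def)
        show "(n - j) * N \<le> (i + 1) * n ^ (L + 1) + y + power_table n L l"
          using i1 by (simp add: N_def)
      qed
      have "0 \<le> backup (cdf_answers Ds) n L Q C V i y l" if "l \<le> L" for y l
      proof -
        have "0 \<le> mean n (W i y) l k" for k
          using n(2) W0 by (intro mean_ge)
        then show ?thesis using i that by (subst backup_eq) auto
      qed
      moreover have "optimal_entry (backup (cdf_answers Ds) n L Q C V i) n L 0 x (V a) (Act a)"
        using table i a by (simp add: plan_table_def N_def)
      ultimately show ?thesis
        by (auto simp: optimal_entry_def)
    qed (rule Suc.IH)
  qed
  from this[of n a] show ?thesis by simp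
qed

lemma W_nonneg: "0 \<le> W i y l"
  using C V_nonneg by (simp add: landing_def penalty_table_def)

abbreviation "levels p B \<equiv> image_mset (level p) (mset_set B)"

text \<open>The table records only an arithmetic test on the code. With at most \<open>i < n\<close>
  bins behind the code, the test yields an actual bin.\<close>

lemma action_cases:
  assumes "i < n" "opened p \<le> i" "code p = encode n L (levels p {..<opened p})"
  obtains (new) "Act (i * n ^ (L + 1) + code p) = L + 1"
      "V (i * n ^ (L + 1) + code p) = 1 + backup (cdf_answers Ds) n L Q C V i (code p) 0"
  | (level) a where "Act (i * n ^ (L + 1) + code p) = a" "a \<le> L" "\<exists>b<opened p. level p b = a"
      "V (i * n ^ (L + 1) + code p) = backup (cdf_answers Ds) n L Q C V i (code p - n ^ a) a"
proof -
  define m where "m = levels p {..<opened p}"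
  have m: "size m < n" "code p = encode n L m" using assms by (simp_all add: m_def)
  have mem: "\<exists>b<opened p. level p b = a" if "a \<in># m" for a
    using that by (auto simp: m_def)
  define a where "a = Act (i * n ^ (L + 1) + code p)"
  have e: "optimal_entry (backup (cdf_answers Ds) n L Q C V i) n L 0 (code p) (V (i * n ^ (L + 1) + code p)) a"
    unfolding a_def m(2) using assms(1) m(1) by (rule entry)
  show thesis
  proof (cases "a = L + 1")
    case True
    then show thesis using e new by (simp add: optimal_entry_def a_def)
  next
    case False
    with e have "a \<le> L" "n ^ a \<le> code p mod n ^ (a + 1)"
      "V (i * n ^ (L + 1) + code p) = backup (cdf_answers Ds) n L Q C V i (code p - n ^ a) a"
      unfolding optimal_entry_def by blast+
    moreover from this have "a \<in># m" using encode_available[OF m(1)] m(2) by simp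
    ultimately show thesis using mem level a_def by blast
  qed
qed

definition potential :: "packing \<Rightarrow> real" where
  "potential p = (\<Sum>b<opened p. (drift p b)\<^sup>2) / sqdev"

lemma potential_nonneg: "0 \<le> potential p"
  unfolding potential_def by (intro divide_nonneg_nonneg sum_nonneg) auto

text \<open>The state is recomputed from the observed sizes, which also determine the bins chosen
  earlier.\<close>

definition plan_policy :: policy where
  "plan_policy h = fst (place n L H Act (length h)
     (packings n L H C V Act (\<lambda>j. kap (snd (h ! j))) (length h)))"

abbreviation "pack x i \<equiv> packings n L H C V Act (\<lambda>j. kap (x j)) i"

lemma choice_plan: "choice plan_policy x i = fst (place n L H Act i (pack x i))"
proof -
  have "packings n L H C V Act (\<lambda>j. kap (snd (history plan_policy x i ! j))) i = pack x i"
    by (rule packings_cong) (simp add: snd_history)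
  then show ?thesis by (simp add: choice_def plan_policy_def)
qed

text \<open>Opposite to the shadow's invariant, \<open>n * level + drift\<close> bounds the usage
  from above here. Bins above level \<open>L\<close> are exempt: a retired bin, or one that received
  a capped size, need not obey it.\<close>

definition consistent :: "nat \<Rightarrow> (nat \<Rightarrow> real) \<Rightarrow> packing \<Rightarrow> bool" where
  "consistent i x p \<longleftrightarrow> code p = encode n L (levels p {..<opened p}) \<and> opened p \<le> i \<and>
     choice plan_policy x ` {..<i} = {..<opened p} \<and>
     (\<forall>b<opened p. level p b \<le> L \<longrightarrow>
        real n * real Q * usage plan_policy x i b \<le> real n * real (level p b) + drift p b)"

text \<open>State between the choice of the bin and the revelation of the size; the last clause is
  the amortized cost of the choice.\<close>

definition placed :: "nat \<Rightarrow> (nat \<Rightarrow> real) \<Rightarrow> packing \<Rightarrow> nat \<Rightarrow> packing \<Rightarrow> bool" where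
  "placed i x p b p' \<longleftrightarrow> {..<opened p'} = insert b {..<opened p} \<and> opened p' \<le> Suc i \<and>
     level p' b \<le> L \<and> (drift p' b)\<^sup>2 < sqdev \<and>
     code p' = encode n L (levels p' {..<opened p'}) \<and>
     (\<forall>b'<opened p'. level p' b' \<le> L \<longrightarrow>
        real n * real Q * usage plan_policy x i b' \<le> real n * real (level p' b') + drift p' b') \<and>
     of_bool (opened p \<le> b)
       + backup (cdf_answers Ds) n L Q C V i (encode n L (levels p' ({..<opened p'} - {b}))) (level p' b)
       + potential p'
     \<le> V (i * n ^ (L + 1) + code p) + potential p"

lemma place_placed:
  assumes i: "i < n" and p: "consistent i x p" and pl: "place n L H Act i p = (b, p')"
  shows "placed i x p b p'"
proof -
  note p' = p[unfolded consistent_def]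
  define m where "m = levels p {..<opened p}"
  have code: "code p = encode n L m" using p' by (simp add: m_def)
  have fresh: "usage plan_policy x i (opened p) = 0"
    using p' by (intro usage_fresh) simp
  from p' have "opened p \<le> i" "code p = encode n L (levels p {..<opened p})" by auto
  then show ?thesis
  proof (cases rule: action_cases[OF i, consumes 2, case_names new level])
    case new
    then have eq: "b = opened p" "p' = open_bin 0 (p\<lparr>code := code p + 1\<rparr>)"
      using pl by (simp_all add: place_def)
    have lv: "levels p' {..<opened p} = m"
      unfolding m_def eq by (rule image_mset_cong) (auto simp: open_bin_def)
    have "potential p' = potential p"
      unfolding potential_def eq by (simp add: open_bin_def)
    moreover have "{..<opened p'} = insert (opened p) {..<opened p}" by (auto simp: eq open_bin_def)
    ultimately show ?thesis
      unfolding placed_def using new p' lv code fresh sqdev_pos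
      by (simp add: eq(1)) (auto simp: eq(2) open_bin_def power_table_def)
  next
    case (level a)
    define b0 where "b0 = (LEAST b. level p b = a)"
    obtain b1 where b1: "b1 < opened p" "level p b1 = a" using level(3) by blast
    \<comment> \<open>Labels not yet used have level 0 as well, but the least label found is at most
      \<open>b1\<close>, hence that of an opened bin.\<close>
    have b0: "level p b0 = a" "b0 < opened p"
      unfolding b0_def using b1 by (auto intro: LeastI Least_le order.strict_trans1)
    have ms: "mset_set {..<opened p} = add_mset b0 (mset_set ({..<opened p} - {b0}))"
      using b0 by (simp add: mset_set.remove)
    have m: "m = add_mset a (levels p ({..<opened p} - {b0}))"
      unfolding m_def ms using b0 by simp
    have rem: "code p - n ^ a = encode n L (levels p ({..<opened p} - {b0}))"
      using level(2) by (simp add: code m power_table_def)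
    show ?thesis
    proof (cases "(drift p b0)\<^sup>2 < sqdev")
      case True
      then have eq: "b = b0" "p' = p" using pl level by (auto simp: place_def b0_def)
      show ?thesis
        unfolding placed_def eq using p' b0 True level rem by auto
    next
      case False
      then have eq: "b = opened p" "p' = open_bin a (retire L b0 p)"
        using pl level by (auto simp: place_def b0_def)
      have lv: "levels p' ({..<opened p} - {b0}) = levels p ({..<opened p} - {b0})"
        unfolding eq by (rule image_mset_cong) (auto simp: open_bin_def retire_def)
      have l0: "level p' b0 = L + 1" "level p' b = a"
        using b0 by (auto simp: eq open_bin_def retire_def)
      have lv': "encode n L (levels p' {..<opened p}) = code p - n ^ a"
        unfolding ms rem by (simp add: lv l0 power_table_def)
      have S: "{..<opened p'} = insert b {..<opened p}" "{..<opened p'} - {b} = {..<opened p}"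
        by (auto simp: eq open_bin_def retire_def)
      have "(\<Sum>b<opened p'. (drift p' b)\<^sup>2) = (\<Sum>b\<in>{..<opened p} - {b0}. (drift p b)\<^sup>2)"
        unfolding S(1) using b0
        by (subst sum.insert) (auto simp: eq open_bin_def retire_def sum.remove[of _ b0] intro!: sum.cong)
      then have pot: "potential p = potential p' + (drift p b0)\<^sup>2 / sqdev"
        unfolding potential_def using b0 by (simp add: sum.remove[of _ b0] add_divide_distrib)
      have one: "1 \<le> (drift p b0)\<^sup>2 / sqdev" using False sqdev_pos by simp
      have c: "code p' = encode n L (levels p' {..<opened p'})"
      proof -
        have "code p' = code p" by (simp add: eq open_bin_def retire_def)
        also have "\<dots> = n ^ a + encode n L (levels p' {..<opened p})"
          unfolding lv' rem using level(2) by (simp add: code m power_table_def)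
        also have "\<dots> = encode n L (levels p' {..<opened p'})"
          unfolding S(1) using level(2) l0(2) by (simp add: eq(1) power_table_def)
        finally show ?thesis .
      qed
      show ?thesis
        unfolding placed_def
      proof (intro conjI allI impI)
        fix b' assume "b' < opened p'" "level p' b' \<le> L"
        then show "real n * real Q * usage plan_policy x i b' \<le> real n * real (level p' b') + drift p' b'"
          using p' fresh by (auto simp: eq open_bin_def retire_def less_Suc_eq split: if_splits)
      next
        show "of_bool (opened p \<le> b)
           + backup (cdf_answers Ds) n L Q C V i (encode n L (levels p' ({..<opened p'} - {b}))) (level p' b)
           + potential p' \<le> V (i * n ^ (L + 1) + code p) + potential p"
          unfolding S(2) lv' l0 using one level by (simp add: eq(1) pot)
      qed (use S c p' level l0 sqdev_pos in \<open>auto simp: eq open_bin_def retire_def\<close>)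
    qed
  qed
qed

text \<open>The second part is the amortized cost of a rounding: the chosen one is no worse than the
  average, and averaging the squared drift adds only the variance, which the load covers.\<close>

lemma settle_consistent:
  fixes c :: real
  assumes i: "i < n" and p: "consistent i x p" and pd: "placed i x p b p'"
    and b: "b = choice plan_policy x i" and y: "0 \<le> y"
    and c: "real Q + 2 * real H + 2 \<le> c * real Q"
    and p'': "p'' = settle n L H C V i b (kap y) p'"
  shows "consistent (Suc i) (x(i := y)) p''"
    and "C * of_bool (c < usage plan_policy x i b + y) + V (Suc i * n ^ (L + 1) + code p'') + potential p''
      \<le> mean n (W i (encode n L (levels p' ({..<opened p'} - {b})))) (level p' b) (kap y)
        + potential p' + load (kap y)"
proof -
  define k where "k = kap y"
  define q r where "q = k div n" and "r = k mod n"
  have kqr: "real n * real q + real r = real k"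
    unfolding q_def r_def by (simp flip: of_nat_mult of_nat_add)
  have r: "r < n" using n(2) by (simp add: r_def)
  define l0 d0 where "l0 = level p' b" and "d0 = drift p' b"
  note pd' = pd[unfolded placed_def]
  have b': "b < opened p'" using pd' by auto
  have l0: "l0 \<le> L" and d0: "\<bar>d0\<bar> < real n * real H"
    using pd' abs_drift_less by (auto simp: l0_def d0_def)
  define e where "e = encode n L (levels p' ({..<opened p'} - {b}))"
  define D where "D l = (if l = l0 + q then d0 + real r else d0 + real r - real n)" for l
  \<comment> \<open>The double negation fits the shape of \<open>mean_affine\<close>, where the
    squares enter with a minus sign.\<close>
  define T where "T l = W i e l + (0 - (- (D l)\<^sup>2) / sqdev)" for l
  define l where "l = (if T (l0 + q + 1) < T (l0 + q) then l0 + q + 1 else l0 + q)"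
  have ms: "mset_set {..<opened p'} = add_mset b (mset_set ({..<opened p'} - {b}))"
    using b' by (simp add: mset_set.remove)
  have "code p' = power_table n L l0 + e"
    using pd' by (simp only: ms e_def l0_def image_mset_add_mset encode_simps)
  then have e: "code p' - power_table n L l0 = e" by simp
  have set: "p'' = p'\<lparr>code := e + power_table n L l, level := (level p')(b := l), drift := (drift p')(b := D l)\<rparr>"
    unfolding p'' settle_def Let_def l0_def[symmetric] d0_def[symmetric] e k_def[symmetric]
      q_def[symmetric] r_def[symmetric]
    by (simp add: l_def T_def D_def)
  have Dl: "real n * real l + D l = real n * real l0 + d0 + real k"
    using kqr by (auto simp: D_def l_def algebra_simps)
  have T: "T l \<le> mean n T l0 k"
    using n(2) by (intro mean_ge) (auto simp: l_def q_def)
  have "mean n T l0 k = mean n (W i e) l0 k + 0 - mean n (\<lambda>l. - (D l)\<^sup>2) l0 k / sqdev"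
    unfolding T_def by (rule mean_affine[OF n(2)])
  also have "mean n (\<lambda>l. - (D l)\<^sup>2) l0 k = - mean n (\<lambda>l. (D l)\<^sup>2) l0 k"
    by (simp add: mean_def)
  also have "mean n (\<lambda>l. (D l)\<^sup>2) l0 k = d0\<^sup>2 + real r * (real n - real r)"
    unfolding r_def by (rule mean_square) (auto simp: n(2) D_def q_def r_def)
  finally have T': "T l \<le> mean n (W i e) l0 k + d0\<^sup>2 / sqdev + load k"
    using T variance_le_load[of k] by (simp add: add_divide_distrib diff_divide_distrib r_def)
  \<comment> \<open>A final level of at most \<open>L\<close> excludes a capped size, for which the
    quantum would not bound \<open>y\<close>.\<close>
  have use: "real n * real Q * (usage plan_policy x i b + y) \<le> real n * real l + D l" if "l \<le> L"
  proof -
    have "q \<le> L" using that by (auto simp: l_def split: if_splits)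
    then have "q < L + 1" by simp
    then have "k < n * (L + 1)" using n(2)
      by (simp add: q_def div_less_iff_less_mult mult.commute)
    then have "y \<le> real k / (real n * real Q)"
      using quantum_le_iff[of k n L Q y] QH by (simp add: k_def)
    then have "real n * real Q * y \<le> real k" using n(2) QH by (simp add: field_simps)
    moreover have "real n * real Q * usage plan_policy x i b \<le> real n * real l0 + d0"
      using pd' b' by (auto simp: l0_def d0_def)
    ultimately show ?thesis using Dl by (simp add: algebra_simps)
  qed
  \<comment> \<open>At level at most \<open>L\<close> the usage is below
    \<open>(L + H + 1) / Q = (Q + 2 * H + 2) / Q\<close>, hence below \<open>c\<close>:
    \<open>H\<close> for the old drift and 1 for the remainder.\<close>
  have over: "c < usage plan_policy x i b + y \<Longrightarrow> L < l"
  proof (rule ccontr)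
    assume c': "c < usage plan_policy x i b + y" and "\<not> L < l"
    then have l: "l \<le> L" by simp
    have "D l \<le> d0 + real r" by (simp add: D_def)
    moreover have "real n * real l \<le> real n * real L" using l by (simp add: mult_left_mono)
    moreover have "real r < real n" using r by simp
    ultimately have "real n * real l + D l < real n * real L + real n * real H + real n"
      using d0 by linarith
    also have "\<dots> = real n * (real Q + 2 * real H + 2)" by (simp add: QH algebra_simps)
    also have "\<dots> \<le> real n * (c * real Q)" using c by (intro mult_left_mono) auto
    finally have "real n * real Q * (usage plan_policy x i b + y) < real n * real Q * c"
      using use[OF l] by (simp add: algebra_simps)
    then show False using c' n(2) QH by (simp add: mult_less_cancel_left_pos)
  qed
  \<comment> \<open>Beyond this index the penalty table would be 0 again.\<close>
  have "l \<le> 2 * L + 2"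
  proof -
    have "k \<le> n * (L + 1)" unfolding k_def by (rule quantum_le)
    then have "q \<le> n * (L + 1) div n" unfolding q_def by (rule div_le_mono)
    then have "q \<le> L + 1" using n(2) by simp
    then show ?thesis using l0 by (simp add: l_def)
  qed
  then have pen: "C * of_bool (c < usage plan_policy x i b + y) \<le> penalty_table L C l"
    using over C by (auto simp: penalty_table_def)
  have "potential p'' = potential p' - d0\<^sup>2 / sqdev + (D l)\<^sup>2 / sqdev"
    unfolding potential_def set using b'
    by (simp add: sum.remove[of "{..<opened p'}" b] d0_def add_divide_distrib)
  then show "C * of_bool (c < usage plan_policy x i b + y) + V (Suc i * n ^ (L + 1) + code p'') + potential p''
      \<le> mean n (W i (encode n L (levels p' ({..<opened p'} - {b})))) (level p' b) (kap y)
        + potential p' + load (kap y)"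
    using T' pen unfolding e_def[symmetric] k_def[symmetric] l0_def[symmetric]
    by (simp add: T_def landing_def set add_ac)
  show "consistent (Suc i) (x(i := y)) p''"
    unfolding consistent_def
  proof (intro conjI allI impI)
    have "levels p'' ({..<opened p'} - {b}) = levels p' ({..<opened p'} - {b})"
      by (rule image_mset_cong) (auto simp: set)
    then show "code p'' = encode n L (levels p'' {..<opened p''})"
      by (simp add: set ms e_def)
    show "opened p'' \<le> Suc i" using pd' by (simp add: set)
    show "choice plan_policy (x(i := y)) ` {..<Suc i} = {..<opened p''}"
      unfolding choices_Suc using p pd' by (simp add: set b consistent_def)
    fix b'' assume b'': "b'' < opened p''" "level p'' b'' \<le> L"
    show "real n * real Q * usage plan_policy (x(i := y)) (Suc i) b'' \<le> real n * real (level p'' b'') + drift p'' b''"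
    proof (cases "b'' = b")
      case True
      then show ?thesis using use b'' by (simp add: usage_Suc set b)
    next
      case False
      then show ?thesis using pd' b'' by (simp add: usage_Suc set b)
    qed
  qed
qed

end

section \<open>Measurability and expected cost\<close>

lemma measurable_map_upt:
  fixes f :: "nat \<Rightarrow> 'a \<Rightarrow> 'b :: countable"
  assumes "\<And>j. j < i \<Longrightarrow> f j \<in> measurable M (count_space UNIV)"
  shows "(\<lambda>x. map (\<lambda>j. f j x) [0..<i]) \<in> measurable M (count_space UNIV)"
proof (subst measurable_count_space_eq2_countable, intro conjI ballI)
  fix l :: "'b list"
  have "map (\<lambda>j. f j x) [0..<i] = l \<longleftrightarrow> length l = i \<and> (\<forall>j\<in>{..<i}. f j x = l ! j)" for x
    by (subst list_eq_iff_nth_eq) fastforce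
  then have "(\<lambda>x. map (\<lambda>j. f j x) [0..<i]) -` {l} \<inter> space M =
      {x \<in> space M. length l = i \<and> (\<forall>j\<in>{..<i}. f j x = l ! j)}"
    by blast
  also have "\<dots> \<in> sets M"
  proof (intro sets.sets_Collect_conj sets.sets_Collect_const sets.sets_Collect_finite_All)
    fix j assume "j \<in> {..<i}"
    then show "{x \<in> space M. f j x = l ! j} \<in> sets M"
      using measurable_sets[OF assms, of j "{l ! j}"] by (simp add: vimage_def Int_def conj_commute)
  qed auto
  finally show "(\<lambda>x. map (\<lambda>j. f j x) [0..<i]) -` {l} \<inter> space M \<in> sets M" .
qed auto

text \<open>Counting each value at its first occurrence turns the size of a random set into a finite
  sum of indicators, which is visibly measurable.\<close>

lemma card_image_upt:
  "card {b \<in> g ` {..<n}. R b} = (\<Sum>j<n. of_bool (R (g j) \<and> (\<forall>k<j. g k \<noteq> g j)))" for n :: nat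
proof (induction n)
  case (Suc n)
  have "{b \<in> g ` {..<Suc n}. R b} = (if R (g n) then insert (g n) {b \<in> g ` {..<n}. R b} else {b \<in> g ` {..<n}. R b})"
    by (auto simp: lessThan_Suc)
  moreover have "g n \<in> {b \<in> g ` {..<n}. R b} \<longleftrightarrow> R (g n) \<and> \<not> (\<forall>k<n. g k \<noteq> g n)"
  proof -
    have "g n \<in> g ` {..<n} \<longleftrightarrow> \<not> (\<forall>k<n. g k \<noteq> g n)"
      by (metis imageE imageI lessThan_iff)
    then show ?thesis by blast
  qed
  ultimately show ?case
    by (auto simp: Suc card_insert_if)
qed simp

lemma joint_eq: "joint Ds = Pi\<^sub>M {..<length Ds} (item Ds)"
  unfolding joint_def by (rule PiM_cong) (auto simp: item_def)

lemma sum_upd: "(\<Sum>j<Suc i. h ((x(i := y)) j)) = (\<Sum>j<i. h (x j)) + h y" for h :: "'a \<Rightarrow> real"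
  by simp

context planned
begin

lemma sets_items: "sets (Pi\<^sub>M {..<n} (item Ds)) = sets (Pi\<^sub>M {..<n} (\<lambda>_. borel))"
  using item_dist by (intro sets_PiM_cong) (auto simp: real_distribution_def real_distribution_axioms_def)

lemma measurable_run:
  assumes P: "admissible c' n P" and i: "i \<le> n"
  shows "(\<lambda>x. real (card (choice P x ` {..<i}))) \<in> borel_measurable (Pi\<^sub>M {..<n} (item Ds))"
    and "(\<lambda>x. real (card {b \<in> choice P x ` {..<i}. c < usage P x i b})) \<in> borel_measurable (Pi\<^sub>M {..<n} (item Ds))"
proof -
  define M where "M = Pi\<^sub>M {..<n} (\<lambda>_. borel :: real measure)"
  have choice: "(\<lambda>x. choice P x j) \<in> measurable M (count_space UNIV)" if "j < i" for j
    using P i that unfolding admissible_def M_def by (meson order.strict_trans2)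
  have comp: "(\<lambda>x. x j) \<in> borel_measurable M" if "j < i" for j
    using i that unfolding M_def by (intro measurable_component_singleton) auto
  \<comment> \<open>A sum over a random index set becomes a sum over a fixed one.\<close>
  have u: "usage P x i (choice P x j) = (\<Sum>k<i. if choice P x k = choice P x j then x k else 0)" for x j
    unfolding usage_def by (subst sum.inter_filter[symmetric]) (auto intro!: sum.cong)
  have eq: "Measurable.pred M (\<lambda>x. choice P x k = choice P x j)" if "j < i" "k < i" for j k
  proof -
    note [measurable] = choice[OF that(1)] choice[OF that(2)]
    show ?thesis by measurable
  qed
  have "(\<lambda>x. if choice P x k = choice P x j then x k else 0) \<in> borel_measurable M" if "j < i" "k < i" for j k
  proof -
    note [measurable] = eq[OF that] comp[OF that(2)]
    show ?thesis by measurable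
  qed
  then have usage: "(\<lambda>x. usage P x i (choice P x j)) \<in> borel_measurable M" if "j < i" for j
    unfolding u using that by (intro borel_measurable_sum) auto
  have fresh: "Measurable.pred M (\<lambda>x. \<forall>k\<in>{..<j}. choice P x k \<noteq> choice P x j)" if "j < i" for j
    using eq that by (intro pred_intros_finite pred_intros_logic) auto
  have "(\<lambda>x. real (card {b \<in> choice P x ` {..<i}. R x b})) \<in> borel_measurable M"
    if R: "\<And>j. j < i \<Longrightarrow> Measurable.pred M (\<lambda>x. R x (choice P x j))" for R
  proof -
    have "(\<lambda>x. of_bool (R x (choice P x j) \<and> (\<forall>k<j. choice P x k \<noteq> choice P x j)) :: real) \<in> borel_measurable M"
      if "j < i" for j
    proof -
      have "Measurable.pred M (\<lambda>x. R x (choice P x j) \<and> (\<forall>k\<in>{..<j}. choice P x k \<noteq> choice P x j))"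
        using R[OF that] fresh[OF that] by (rule pred_intros_logic)
      then show ?thesis
        by (auto simp: of_bool_def Ball_def intro!: measurable_If)
    qed
    then show ?thesis
      unfolding card_image_upt of_nat_sum of_nat_of_bool by (intro borel_measurable_sum) auto
  qed
  note this[of "\<lambda>_ _. True"] this[of "\<lambda>x b. c < usage P x i b"]
  moreover have "Measurable.pred M (\<lambda>x. c < usage P x i (choice P x j))" if "j < i" for j
    using usage[OF that] by measurable
  ultimately show "(\<lambda>x. real (card (choice P x ` {..<i}))) \<in> borel_measurable (Pi\<^sub>M {..<n} (item Ds))"
    "(\<lambda>x. real (card {b \<in> choice P x ` {..<i}. c < usage P x i b})) \<in> borel_measurable (Pi\<^sub>M {..<n} (item Ds))"
    unfolding measurable_cong_sets[OF sets_items refl] M_def by auto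
qed

lemma prob_space_joint: "prob_space (joint Ds)"
  unfolding joint_eq by (rule prob_space_PiM) (rule prob_space_item)

lemma AE_joint_nonneg: "AE x in joint Ds. \<forall>j<n. 0 \<le> x j"
proof -
  have "AE x in Pi\<^sub>M {..<n} (item Ds). \<forall>j\<in>{..<n}. 0 \<le> x j"
  proof (rule AE_finite_allI)
    fix j assume "j \<in> {..<n}"
    then show "AE x in Pi\<^sub>M {..<n} (item Ds). 0 \<le> x j"
      by (intro AE_PiM_component) (auto simp: prob_space_item item_nonneg)
  qed simp
  then show ?thesis unfolding joint_eq n(1)[symmetric] by (auto elim: eventually_mono)
qed

lemma score_nonneg: "0 \<le> score c C P i x"
  using C by (simp add: score_def)

lemma measurable_score:
  assumes "admissible c' n P"
  shows "(\<lambda>x. score c C P n x) \<in> borel_measurable (joint Ds)"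
  unfolding joint_eq n(1)[symmetric] score_def using measurable_run[OF assms order_refl] by measurable

lemma expected_cost_eq:
  assumes P: "admissible c' n P"
  shows "ennreal (expected_cost c C Ds P) = (\<integral>\<^sup>+ x. ennreal (score c C P n x) \<partial>joint Ds)"
    and "0 \<le> expected_cost c C Ds P"
proof -
  interpret prob_space "joint Ds" by (rule prob_space_joint)
  note meas = measurable_run[OF P order_refl, folded joint_eq[of Ds, folded n(1)]]
  have le: "card {b \<in> choice P x ` {..<n}. R b} \<le> n" for x R
    by (metis (no_types, lifting) card_image_le card_lessThan card_mono finite_imageI finite_lessThan
        mem_Collect_eq order_trans subsetI)
  have int: "integrable (joint Ds) (\<lambda>x. real (card (choice P x ` {..<n})))"
    "integrable (joint Ds) (\<lambda>x. real (card {b \<in> choice P x ` {..<n}. c < usage P x n b}))"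
    using le[of _ "\<lambda>_. True"] le by (auto intro!: integrable_const_bound[where B = "real n"] meas)
  have eq: "expected_cost c C Ds P = (\<integral>x. score c C P n x \<partial>joint Ds)"
    using int by (simp add: expected_cost_def score_def bins_opened_def bins_overflowed_def n(1)[symmetric])
  have "integrable (joint Ds) (\<lambda>x. score c C P n x)"
    unfolding score_def using int by auto
  then show "ennreal (expected_cost c C Ds P) = (\<integral>\<^sup>+ x. ennreal (score c C P n x) \<partial>joint Ds)"
    unfolding eq by (intro nn_integral_eq_integral[symmetric]) (auto simp: score_nonneg)
  show "0 \<le> expected_cost c C Ds P"
    unfolding eq by (rule Bochner_Integration.integral_nonneg) (simp add: score_nonneg)
qed

lemma nn_integral_joint:
  assumes "f \<in> borel_measurable (joint Ds)"
  shows "(\<integral>\<^sup>+ x. f x \<partial>joint Ds) = rest_integral (item Ds) f n 0 (\<lambda>_. undefined)"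
  using assms unfolding joint_eq n(1)[symmetric] by (intro nn_integral_PiM_rest prob_space_item)

section \<open>The total load and its charge to the bins\<close>

abbreviation "mean_load j \<equiv> (\<integral>y. load (kap y) \<partial>item Ds j)"

lemma load_tail:
  "i \<le> n \<Longrightarrow> ennreal ((\<Sum>j<i. load (kap (x j))) + (\<Sum>j=i..<n. mean_load j)) \<le>
     rest_integral (item Ds) (\<lambda>x. ennreal (\<Sum>j<n. load (kap (x j)))) (n - i) i x"
proof (induction "n - i" arbitrary: i x)
  case 0
  then show ?case by simp
next
  case (Suc k)
  then have i: "i < n" by simp
  interpret prob_space "item Ds i" by (rule prob_space_item)
  let ?f = "\<lambda>x. ennreal (\<Sum>j<n. load (kap (x j)))"
  define A where "A = (\<Sum>j<i. load (kap (x j))) + (\<Sum>j=Suc i..<n. mean_load j)"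
  have int: "integrable (item Ds i) (\<lambda>y. load (kap y))"
    by (rule integrable_quantum[OF item_dist])
  have "ennreal (load (kap y) + A) \<le> rest_integral (item Ds) ?f (n - Suc i) (Suc i) (x(i := y))" for y
    using Suc.hyps(1)[of "Suc i" "x(i := y)"] Suc.hyps(2) i
    unfolding sum_upd[of "\<lambda>z. load (kap z)"] by (simp add: A_def add_ac)
  then have "ennreal (\<integral>y. load (kap y) + A \<partial>item Ds i)
      \<le> (\<integral>\<^sup>+ y. rest_integral (item Ds) ?f (n - Suc i) (Suc i) (x(i := y)) \<partial>item Ds i)"
    using int by (intro ennreal_integral_le) auto
  moreover have "(\<integral>y. load (kap y) + A \<partial>item Ds i) = (\<Sum>j<i. load (kap (x j))) + (\<Sum>j=i..<n. mean_load j)"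
    using int i by (simp add: prob_space A_def sum.atLeast_Suc_lessThan)
  moreover have "n - i = Suc (n - Suc i)" using i by simp
  ultimately show ?case by simp
qed

text \<open>Before each of its items a bin holds at most 1, and the item itself counts at most the
  cap. So a bin accounts for at most \<open>K\<close> units, besides one rounding unit per item.
  Truncating the usage at \<open>K\<close> in \<open>\<phi>\<close> makes this an induction over the
  items.\<close>

lemma load_le_cost:
  assumes P: "admissible 1 n P" and x: "\<And>j. j < n \<Longrightarrow> 0 \<le> x j"
  shows "(\<Sum>j<n. load (kap (x j))) \<le> (2 * real Q + real H + 3) / (real H)\<^sup>2 * score 1 C P n x"
proof -
  define K where "K = real n * real Q + real n * real (L + 1)"
  define \<phi> where "\<phi> u = min (real n * real Q * u) K" for u
  have "i \<le> n \<Longrightarrow> (\<Sum>j<i. real (kap (x j))) \<le> real i + (\<Sum>b\<in>choice P x ` {..<i}. \<phi> (usage P x i b))" for i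
  proof (induction i)
    case (Suc i)
    define b S where "b = choice P x i" and "S = choice P x ` {..<i}"
    have fin: "finite S" by (simp add: S_def)
    have y: "0 \<le> x i" using x Suc.prems by simp
    have u: "usage P x i b \<le> 1" "0 \<le> usage P x i b"
      unfolding b_def using Suc.prems x by (auto intro: admissible_usage[OF P] usage_nonneg)
    have us: "usage P x (Suc i) b' = usage P x i b' + (if b' = b then x i else 0)" for b'
      using usage_Suc[of P x i "x i" b'] by (simp add: b_def)
    have S': "choice P x ` {..<Suc i} = insert b S"
      using choices_Suc[of P x i "x i"] by (simp add: b_def S_def)
    have k: "real (kap (x i)) \<le> real n * real Q * x i + 1" "real (kap (x i)) \<le> real n * real (L + 1)"
      using quantum_upper[OF y] by simp (metis of_nat_le_iff of_nat_mult quantum_le)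
    have "real n * real Q * usage P x i b \<le> real n * real Q" using u by (simp add: mult_left_le)
    then have "real (kap (x i)) \<le> 1 + \<phi> (usage P x i b + x i) - \<phi> (usage P x i b)"
      using k unfolding \<phi>_def K_def by (auto simp: min_def algebra_simps)
    moreover have "(\<Sum>b\<in>insert b S. \<phi> (usage P x (Suc i) b)) =
        \<phi> (usage P x i b + x i) + (\<Sum>b\<in>S - {b}. \<phi> (usage P x i b))"
      using fin by (simp add: sum.insert_remove us)
    moreover have "(\<Sum>b\<in>S. \<phi> (usage P x i b)) = \<phi> (usage P x i b) + (\<Sum>b\<in>S - {b}. \<phi> (usage P x i b))"
    proof (cases "b \<in> S")
      case False
      then have "usage P x i b = 0" unfolding S_def by (rule usage_fresh)
      moreover have "\<phi> 0 = 0" by (simp add: \<phi>_def K_def)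
      ultimately show ?thesis using False by simp
    qed (use fin in \<open>simp add: sum.remove\<close>)
    ultimately show ?case
      using Suc unfolding S' S_def[symmetric] by simp
  qed simp
  from this[of n] have "(\<Sum>j<n. real (kap (x j))) \<le> real n + (\<Sum>b\<in>choice P x ` {..<n}. \<phi> (usage P x n b))"
    by simp
  also have "\<dots> \<le> real n + (\<Sum>b\<in>choice P x ` {..<n}. K)"
    by (intro add_left_mono sum_mono) (simp add: \<phi>_def)
  also have "\<dots> = real n * 1 + real (card (choice P x ` {..<n})) * K" by simp
  \<comment> \<open>At least one bin is opened, so the \<open>n\<close> rounding units can be
    charged to the score too.\<close>
  also have "\<dots> \<le> real n * score 1 C P n x + score 1 C P n x * K"
  proof -
    have "0 < card (choice P x ` {..<n})"
      by (subst card_gt_0_iff) (use n(2) in auto)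
    then have "1 \<le> real (card (choice P x ` {..<n}))" by linarith
    moreover have "real (card (choice P x ` {..<n})) \<le> score 1 C P n x"
      using C by (simp add: score_def)
    ultimately show ?thesis
      by (intro add_mono mult_left_mono mult_right_mono) (auto simp: K_def)
  qed
  also have "\<dots> = real n * (2 * real Q + real H + 3) * score 1 C P n x"
    by (simp add: K_def QH algebra_simps)
  finally have le: "(\<Sum>j<n. real (kap (x j))) \<le> real n * (2 * real Q + real H + 3) * score 1 C P n x" .
  have "(\<Sum>j<n. load (kap (x j))) = (\<Sum>j<n. real (kap (x j))) / (real n * (real H)\<^sup>2)"
    by (simp add: sum_divide_distrib)
  also have "\<dots> \<le> real n * (2 * real Q + real H + 3) * score 1 C P n x / (real n * (real H)\<^sup>2)"
    using le by (rule divide_right_mono) simp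
  also have "\<dots> = (2 * real Q + real H + 3) / (real H)\<^sup>2 * score 1 C P n x"
    using n(2) by simp
  finally show ?thesis .
qed


lemma pack_Suc:
  assumes "place n L H Act i (pack x i) = (b, p')"
  shows "pack (x(i := y)) (Suc i) = settle n L H C V i b (kap y) p'"
proof -
  have "pack (x(i := y)) i = pack x i" by (rule packings_cong) simp
  then show ?thesis using assms by simp
qed

lemma pack_consistent:
  assumes x: "\<And>j. j < n \<Longrightarrow> 0 \<le> x j"
  shows "i \<le> n \<Longrightarrow> consistent i x (pack x i)"
proof (induction i)
  case 0
  then show ?case by (simp add: consistent_def)
next
  case (Suc i)
  obtain b p' where pl: "place n L H Act i (pack x i) = (b, p')" by fastforce
  have b: "b = choice plan_policy x i" using pl by (simp add: choice_plan)
  have i: "i < n" and p: "consistent i x (pack x i)" using Suc by auto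
  \<comment> \<open>The conclusion wanted here is free of \<open>c\<close>; the smallest capacity
    meeting the requirement serves as witness.\<close>
  have "real Q + 2 * real H + 2 \<le> ((real Q + 2 * real H + 2) / real Q) * real Q"
    using QH by simp
  from settle_consistent(1)[OF i p place_placed[OF i p pl] b x[OF i] this refl] pack_Suc[OF pl, of "x i"]
  show ?case by simp
qed

lemma pack_consistent_prefix:
  assumes "\<And>j. j < i \<Longrightarrow> 0 \<le> x j" "i \<le> n"
  shows "consistent i x (pack x i)"
proof -
  define x' where "x' j = (if j < i then x j else 0)" for j
  have "consistent i x' (pack x' i)"
    using assms by (intro pack_consistent) (auto simp: x'_def)
  moreover have "pack x' i = pack x i" by (rule packings_cong) (simp add: x'_def)
  moreover have "choice plan_policy x' j = choice plan_policy x j" if "j \<le> i" for j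
    using that by (intro choice_cong) (simp add: x'_def)
  then have "choice plan_policy x' ` {..<i} = choice plan_policy x ` {..<i}"
    by (intro image_cong) auto
  moreover have "usage plan_policy x' i b = usage plan_policy x i b" for b
    by (rule usage_cong) (simp add: x'_def)
  ultimately show ?thesis by (simp add: consistent_def)
qed

lemma plan_usage:
  assumes x: "\<And>j. j < i \<Longrightarrow> 0 \<le> x j" and i: "i < n"
    and c: "real Q + 2 * real H + 2 \<le> c * real Q"
  shows "usage plan_policy x i (choice plan_policy x i) \<le> c"
proof -
  obtain b p' where pl: "place n L H Act i (pack x i) = (b, p')" by fastforce
  have b: "b = choice plan_policy x i" using pl by (simp add: choice_plan)
  have "placed i x (pack x i) b p'"
    using i x pl by (intro place_placed pack_consistent_prefix) auto
  then have l: "level p' b \<le> L" "\<bar>drift p' b\<bar> < real n * real H"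
    and "real n * real Q * usage plan_policy x i b \<le> real n * real (level p' b) + drift p' b"
    using abs_drift_less by (auto simp: placed_def)
  moreover have "real n * real (level p' b) \<le> real n * real L" using l by (simp add: mult_left_mono)
  ultimately have "real n * real Q * usage plan_policy x i b \<le> real n * real L + real n * real H"
    by linarith
  also have "\<dots> \<le> real n * (real Q + 2 * real H + 2)" by (simp add: QH algebra_simps)
  also have "\<dots> \<le> real n * (c * real Q)" using c by (intro mult_left_mono) auto
  finally have "real n * real Q * usage plan_policy x i b \<le> real n * real Q * c" by (simp add: mult_ac)
  then show ?thesis using n(2) QH by (simp add: b mult_le_cancel_left_pos)
qed

lemma admissible_plan:
  assumes c: "real Q + 2 * real H + 2 \<le> c * real Q"
  shows "admissible c n plan_policy"
  unfolding admissible_def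
proof (intro conjI allI impI)
  fix i assume i: "i < n"
  let ?M = "Pi\<^sub>M {..<n} (\<lambda>_. borel :: real measure)"
  \<comment> \<open>The choice depends on the past through finitely many quanta only, and every
    function on the discrete space of lists of naturals is measurable.\<close>
  let ?G = "\<lambda>ks. fst (place n L H Act i (packings n L H C V Act (\<lambda>j. ks ! j) i))"
  have "(\<lambda>x. kap (x j)) \<in> measurable ?M (count_space UNIV)" if "j < i" for j
  proof (rule measurable_compose[OF _ measurable_quantum])
    show "(\<lambda>x. x j) \<in> measurable ?M borel"
      using that i by (intro measurable_component_singleton) auto
  qed
  then have "(\<lambda>x. map (\<lambda>j. kap (x j)) [0..<i]) \<in> measurable ?M (count_space UNIV)"
    by (rule measurable_map_upt)
  then have "(\<lambda>x. ?G (map (\<lambda>j. kap (x j)) [0..<i])) \<in> measurable ?M (count_space UNIV)"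
    by (rule measurable_compose) simp
  moreover have "choice plan_policy x i = ?G (map (\<lambda>j. kap (x j)) [0..<i])" for x
  proof -
    have "packings n L H C V Act (\<lambda>j. map (\<lambda>j. kap (x j)) [0..<i] ! j) i = pack x i"
      by (rule packings_cong) simp
    then show ?thesis by (simp add: choice_plan)
  qed
  ultimately show "(\<lambda>x. choice plan_policy x i) \<in> measurable ?M (count_space UNIV)" by simp
next
  fix x :: "nat \<Rightarrow> real" and i
  assume "\<forall>j<n. 0 \<le> x j" "i < n"
  then show "usage plan_policy x i (choice plan_policy x i) \<le> c"
    using c by (intro plan_usage) auto
qed

lemma plan_action:
  assumes "\<And>j. j < i \<Longrightarrow> 0 \<le> x j" "i < n" "Act (i * n ^ (L + 1) + code (pack x i)) \<le> L"
  shows "\<exists>b<n. level (pack x i) b = Act (i * n ^ (L + 1) + code (pack x i))"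
proof -
  have p: "opened (pack x i) \<le> i"
    "code (pack x i) = encode n L (levels (pack x i) {..<opened (pack x i)})"
    using pack_consistent_prefix[of i x] assms by (auto simp: consistent_def)
  then show ?thesis
    using assms(2,3) by (cases rule: action_cases[OF assms(2) p]) (auto dest: order.strict_trans1)
qed

text \<open>Here the potential is added: what is left at the end is nonnegative, and its growth is
  paid by the mean loads of the remaining items.\<close>

lemma plan_cost_le_value:
  assumes c: "real Q + 2 * real H + 2 \<le> c * real Q"
  shows "i \<le> n \<Longrightarrow> (\<And>j. j < i \<Longrightarrow> 0 \<le> x j) \<Longrightarrow>
    rest_integral (item Ds) (\<lambda>x. ennreal (score c C plan_policy n x)) (n - i) i x \<le>
    ennreal (score c C plan_policy i x + V (i * n ^ (L + 1) + code (pack x i)) + potential (pack x i)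
      + (\<Sum>j=i..<n. mean_load j))"
proof (induction "n - i" arbitrary: i x)
  case 0
  then have "i = n" by simp
  then show ?case using V_nonneg potential_nonneg by (simp add: ennreal_leI)
next
  case (Suc k i)
  note x = Suc.prems(2)
  have i: "i < n" using Suc.hyps(2) by simp
  let ?f = "\<lambda>x. ennreal (score c C plan_policy n x)"
  define p where "p = pack x i"
  obtain b p' where pl: "place n L H Act i p = (b, p')" by fastforce
  have b: "b = choice plan_policy x i" using pl by (simp add: choice_plan p_def)
  have p: "consistent i x p" unfolding p_def using x i by (intro pack_consistent_prefix) auto
  have pd: "placed i x p b p'" using i p pl by (rule place_placed)
  define u where "u = usage plan_policy x i b"
  define e l where "e = encode n L (levels p' ({..<opened p'} - {b}))" and "l = level p' b"
  have l: "l \<le> L" using pd by (simp add: placed_def l_def)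
  define A where "A = score c C plan_policy i x + of_bool (opened p \<le> b) + potential p'
    + (\<Sum>j=Suc i..<n. mean_load j)"
  have A: "0 \<le> A"
    unfolding A_def using score_nonneg potential_nonneg
    by (intro add_nonneg_nonneg sum_nonneg Bochner_Integration.integral_nonneg) auto
  have step: "rest_integral (item Ds) ?f (n - Suc i) (Suc i) (x(i := y)) \<le>
      ennreal (mean n (W i e) l (kap y) + load (kap y) + A)" if y: "0 \<le> y" for y
  proof -
    have Suc_p: "pack (x(i := y)) (Suc i) = settle n L H C V i b (kap y) p'"
      using pl unfolding p_def by (rule pack_Suc)
    have "rest_integral (item Ds) ?f (n - Suc i) (Suc i) (x(i := y)) \<le>
      ennreal (score c C plan_policy (Suc i) (x(i := y))
        + V (Suc i * n ^ (L + 1) + code (pack (x(i := y)) (Suc i))) + potential (pack (x(i := y)) (Suc i))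
        + (\<Sum>j=Suc i..<n. mean_load j))"
      using Suc.hyps i x y by (intro Suc.hyps(1)) (auto simp: less_Suc_eq)
    also have "\<dots> \<le> ennreal (mean n (W i e) l (kap y) + load (kap y) + A)"
    proof (rule ennreal_leI)
      have "choice plan_policy x i \<notin> choice plan_policy x ` {..<i} \<longleftrightarrow> opened p \<le> b"
        using p by (simp add: consistent_def b not_less)
      then have "score c C plan_policy (Suc i) (x(i := y)) = score c C plan_policy i x
          + of_bool (opened p \<le> b) + C * of_bool (c < u + y)"
        using score_Suc[OF y plan_usage[OF x i c], where C = C] by (simp add: b u_def)
      then show "score c C plan_policy (Suc i) (x(i := y))
        + V (Suc i * n ^ (L + 1) + code (pack (x(i := y)) (Suc i))) + potential (pack (x(i := y)) (Suc i))
        + (\<Sum>j=Suc i..<n. mean_load j) \<le> mean n (W i e) l (kap y) + load (kap y) + A"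
        using settle_consistent(2)[OF i p pd b y c refl]
        unfolding Suc_p A_def e_def l_def u_def by linarith
    qed
    finally show ?thesis .
  qed
  interpret prob_space "item Ds i" by (rule prob_space_item)
  have int: "integrable (item Ds i) (\<lambda>y. mean n (W i e) l (kap y))"
    "integrable (item Ds i) (\<lambda>y. load (kap y))"
    by (rule integrable_quantum[OF item_dist])+
  have "rest_integral (item Ds) ?f (n - i) i x =
      (\<integral>\<^sup>+ y. rest_integral (item Ds) ?f (n - Suc i) (Suc i) (x(i := y)) \<partial>item Ds i)"
    using i by (simp flip: Suc_diff_Suc)
  also have "\<dots> \<le> ennreal (\<integral>y. mean n (W i e) l (kap y) + load (kap y) + A \<partial>item Ds i)"
  proof (rule le_ennreal_integral)
    show "AE y in item Ds i. rest_integral (item Ds) ?f (n - Suc i) (Suc i) (x(i := y)) \<le>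
        ennreal (mean n (W i e) l (kap y) + load (kap y) + A)"
      using item_nonneg[of i] by (rule eventually_mono) (rule step)
    show "0 \<le> mean n (W i e) l (kap y) + load (kap y) + A" for y
      using A n(2) W_nonneg by (intro add_nonneg_nonneg mean_ge) auto
  qed (use int in auto)
  also have "(\<integral>y. mean n (W i e) l (kap y) + load (kap y) + A \<partial>item Ds i) =
      backup (cdf_answers Ds) n L Q C V i e l + mean_load i + A"
    using int by (simp add: backup_eq[OF i l] prob_space)
  also have "\<dots> \<le> score c C plan_policy i x + V (i * n ^ (L + 1) + code p) + potential p
      + (\<Sum>j=i..<n. mean_load j)"
  proof -
    have "of_bool (opened p \<le> b) + backup (cdf_answers Ds) n L Q C V i e l + potential p'
        \<le> V (i * n ^ (L + 1) + code p) + potential p"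
      using pd unfolding placed_def e_def l_def by blast
    then show ?thesis using i by (simp add: A_def sum.atLeast_Suc_lessThan)
  qed
  finally show ?case by (simp add: p_def ennreal_leI)
qed

text \<open>Loads depend on the sizes alone, so even those incurred by the plan's own run are
  charged to the bins of \<open>P\<close>.\<close>

lemma plan_cost_le:
  assumes c: "real Q + 2 * real H + 2 \<le> c * real Q" and P: "admissible 1 n P"
  shows "expected_cost c C Ds plan_policy \<le>
    (1 + 2 * ((2 * real Q + real H + 3) / (real H)\<^sup>2)) * expected_cost 1 C Ds P"
proof -
  define \<theta> where "\<theta> = (2 * real Q + real H + 3) / (real H)\<^sup>2"
  have \<theta>: "0 \<le> \<theta>" by (simp add: \<theta>_def)
  define e where "e = expected_cost 1 C Ds P"
  have e: "0 \<le> e" "(\<integral>\<^sup>+ x. ennreal (score 1 C P n x) \<partial>joint Ds) = ennreal e"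
    using expected_cost_eq[OF P, of 1] by (auto simp: e_def)
  have load: "AE x in joint Ds. (\<Sum>j<n. load (kap (x j))) \<le> \<theta> * score 1 C P n x"
    using AE_joint_nonneg unfolding \<theta>_def by (rule eventually_mono) (rule load_le_cost[OF P], simp)
  have meas[measurable]: "(\<lambda>x. score 1 C P n x) \<in> borel_measurable (joint Ds)"
    by (rule measurable_score[OF P])
  have scaled: "(\<integral>\<^sup>+ x. ennreal (r * score 1 C P n x) \<partial>joint Ds) = ennreal (r * e)" if "0 \<le> r" for r
    using that e by (simp add: ennreal_mult' score_nonneg nn_integral_cmult)
  have "(\<lambda>x. load (kap (x j))) \<in> borel_measurable (Pi\<^sub>M {..<n} (\<lambda>_. borel :: real measure))" if "j < n" for j
  proof -
    have "(\<lambda>y. load (kap y)) \<in> borel_measurable (borel :: real measure)" by measurable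
    then show ?thesis
      using that by (intro measurable_compose[OF measurable_component_singleton[of j]]) auto
  qed
  then have sum: "(\<lambda>x. \<Sum>j<n. load (kap (x j))) \<in> borel_measurable (joint Ds)"
    unfolding joint_eq n(1)[symmetric] measurable_cong_sets[OF sets_items refl]
    by (intro borel_measurable_sum) auto
  have "ennreal (\<Sum>j=0..<n. mean_load j) \<le> (\<integral>\<^sup>+ x. ennreal (\<Sum>j<n. load (kap (x j))) \<partial>joint Ds)"
    using load_tail[of 0 "\<lambda>_. undefined"] sum by (subst nn_integral_joint) auto
  also have "\<dots> \<le> (\<integral>\<^sup>+ x. ennreal (\<theta> * score 1 C P n x) \<partial>joint Ds)"
    using load by (intro nn_integral_mono_AE) (auto elim!: eventually_mono intro: ennreal_leI)
  also note scaled[OF \<theta>]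
  finally have loads: "(\<Sum>j=0..<n. mean_load j) \<le> \<theta> * e"
    using e \<theta> by (simp add: ennreal_le_iff)
  have run: "run_cost P \<in> borel_measurable (joint Ds)"
    unfolding run_cost_def[abs_def] using meas sum by measurable
  have "ennreal (V 0) \<le> (\<integral>\<^sup>+ x. run_cost P x \<partial>joint Ds)"
    using value_le_run_cost[OF P, of 0 "\<lambda>_. undefined" "{}" "\<lambda>_. 0" "{#}" "\<lambda>_. 0"] run
    by (subst nn_integral_joint) (auto simp: score_def)
  also have "\<dots> \<le> (\<integral>\<^sup>+ x. ennreal ((1 + \<theta>) * score 1 C P n x) \<partial>joint Ds)"
    using load unfolding run_cost_def
    by (intro nn_integral_mono_AE) (auto elim!: eventually_mono intro!: ennreal_leI simp: algebra_simps)
  also have "\<dots> = ennreal ((1 + \<theta>) * e)" using \<theta> by (intro scaled) auto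
  finally have V0: "V 0 \<le> (1 + \<theta>) * e" using e \<theta> by (simp add: ennreal_le_iff)
  have adm: "admissible c n plan_policy" using c by (rule admissible_plan)
  have "ennreal (expected_cost c C Ds plan_policy) =
      rest_integral (item Ds) (\<lambda>x. ennreal (score c C plan_policy n x)) n 0 (\<lambda>_. undefined)"
    unfolding expected_cost_eq(1)[OF adm]
    using measurable_score[OF adm] by (intro nn_integral_joint) measurable
  also have "\<dots> \<le> ennreal (V 0 + (\<Sum>j=0..<n. mean_load j))"
    using plan_cost_le_value[OF c, of 0 "\<lambda>_. undefined"] by (simp add: score_def potential_def)
  finally have "ennreal (expected_cost c C Ds plan_policy) \<le> ennreal ((1 + \<theta>) * e + \<theta> * e)"
    using V0 loads by (meson add_mono ennreal_leI order_trans)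
  then show ?thesis
    using e \<theta> unfolding \<theta>_def[symmetric] e_def[symmetric]
    by (subst (asm) ennreal_le_iff) (auto simp: algebra_simps)
qed

lemma plan_cost_le_OPT:
  assumes c: "real Q + 2 * real H + 2 \<le> c * real Q"
    and \<epsilon>: "2 * ((2 * real Q + real H + 3) / (real H)\<^sup>2) \<le> \<epsilon>"
  shows "expected_cost c C Ds plan_policy \<le> (1 + \<epsilon>) * cost_OPT C Ds"
proof -
  have "0 \<le> 2 * ((2 * real Q + real H + 3) / (real H)\<^sup>2)" by simp
  with \<epsilon> have pos: "0 < 1 + \<epsilon>" by linarith
  \<comment> \<open>Opening a new bin for every item shows that the infimum ranges over a nonempty
    set.\<close>
  have "admissible 1 n length"
  proof -
    have "choice length x i = i" for x i by (simp add: choice_def)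
    moreover have "usage length x i i = 0" for x i
      unfolding usage_def calculation by (intro sum.neutral) auto
    ultimately show ?thesis by (simp add: admissible_def)
  qed
  then have "expected_cost c C Ds plan_policy / (1 + \<epsilon>) \<le> cost_OPT C Ds"
    unfolding cost_OPT_def n(1)[symmetric]
  proof (intro cINF_greatest)
    fix P assume "P \<in> {P. admissible 1 n P}"
    then have P: "admissible 1 n P" by simp
    have "expected_cost c C Ds plan_policy \<le>
        (1 + 2 * ((2 * real Q + real H + 3) / (real H)\<^sup>2)) * expected_cost 1 C Ds P"
      using c P by (rule plan_cost_le)
    also have "\<dots> \<le> (1 + \<epsilon>) * expected_cost 1 C Ds P"
      using \<epsilon> expected_cost_eq(2)[OF P] by (intro mult_right_mono) auto
    finally show "expected_cost c C Ds plan_policy / (1 + \<epsilon>) \<le> expected_cost 1 C Ds P"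
      using pos by (simp add: pos_divide_le_eq mult.commute)
  qed auto
  then show ?thesis using pos by (simp add: pos_divide_le_eq mult.commute)
qed

end

section \<open>Choice of parameters\<close>

lemma decides_mono: "decides d B s xs s' \<Longrightarrow> B \<le> B' \<Longrightarrow> decides d B' s xs s'"
  by (induction rule: decides.induct) (auto intro: decides.intros)

lemma table_size_input: "table_size_le (input_memory \<epsilon> C n) 3"
proof -
  have "table_size_le \<lparr>nmem = (\<lambda>_ _. 0), rmem = (\<lambda>_ _. 0)\<rparr> 0"
    by (simp add: table_size_le_def)
  then show ?thesis
    unfolding input_memory_def numeral_3_eq_3 by (intro table_size_le_set)
qed

text \<open>Below 3 the ratio \<open>3 / \<epsilon>\<close> exceeds 1, so rounding it up at most
  doubles it; this is how the range of \<open>\<epsilon>\<close> enters.\<close>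

lemma sqrt_bound_less: "sqrt 6 * (sqrt 15 - 3) < (3::real)"
proof -
  have "sqrt 6 < (3::real)" by (rule real_less_lsqrt) simp_all
  moreover have "sqrt 15 < (4::real)" "3 \<le> sqrt (15::real)"
    by (rule real_less_lsqrt real_le_rsqrt, simp_all)+
  ultimately have "sqrt 6 * (sqrt 15 - 3) < 3 * (4 - 3::real)"
    by (intro mult_strict_mono) auto
  then show ?thesis by simp
qed

text \<open>With \<open>z\<close> the ceiling of \<open>3 / \<epsilon>\<close>,
  \<open>Q = 2 * z ^ 3\<close> and \<open>H = 2 * z ^ 2\<close>, both \<open>(2 * H + 2) / Q\<close>
  and \<open>2 * (2 * Q + H + 3) / H ^ 2\<close> are at most \<open>3 / z\<close>, hence at most
  \<open>\<epsilon>\<close>.\<close>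

lemma parameters:
  fixes \<epsilon> :: real
  assumes \<epsilon>: "0 < \<epsilon>" "\<epsilon> < 3"
  obtains Q H L :: nat where "0 < Q" "0 < H" "L = Q + H + 1"
    "real Q + 2 * real H + 2 \<le> (1 + \<epsilon>) * real Q"
    "2 * ((2 * real Q + real H + 3) / (real H)\<^sup>2) \<le> \<epsilon>"
    "real (L + 3) \<le> 2 * (6 / \<epsilon>) ^ 5" "(real (L + 1))\<^sup>2 \<le> 784 * 3 ^ 10 / \<epsilon> ^ 10"
proof -
  define w where "w = 3 / \<epsilon>"
  have w: "1 < w" using \<epsilon> by (simp add: w_def)
  define z where "z = nat \<lceil>w\<rceil>"
  have zw: "w \<le> real z" "real z < w + 1" using w unfolding z_def by linarith+
  have "1 < real z" using zw w by linarith
  then have z2: "2 \<le> real z" by simp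
  have z2w: "real z \<le> 2 * w" using zw w by linarith
  have e: "3 \<le> \<epsilon> * real z" using zw(1) \<epsilon> by (simp add: w_def field_simps)
  define Q H L where "Q = 2 * z ^ 3" and "H = 2 * z ^ 2" and "L = Q + H + 1"
  define y where "y = real z"
  have y: "2 \<le> y" "3 \<le> \<epsilon> * y" "y \<le> 2 * w"
    using z2 e z2w by (simp_all add: y_def field_simps)
  have QH: "real Q = 2 * y ^ 3" "real H = 2 * y\<^sup>2" by (simp_all add: Q_def H_def y_def)
  have y4: "4 \<le> y\<^sup>2" using power_mono[of 2 y 2] y by simp
  have w3: "1 \<le> w ^ 3" "w\<^sup>2 \<le> w ^ 3" "w ^ 3 \<le> w ^ 5" using w by (auto intro: power_increasing one_le_power)
  have yw: "y ^ 3 \<le> 8 * w ^ 3" "y\<^sup>2 \<le> 4 * w\<^sup>2"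
    using power_mono[of y "2 * w" 3] power_mono[of y "2 * w" 2] y by (auto simp: power_mult_distrib)
  show ?thesis
  proof (rule that[of Q H L])
    show "0 < Q" "0 < H" using z2 by (auto simp: Q_def H_def intro!: Nat.gr0I)
    have "2 * y\<^sup>2 * 3 \<le> 2 * y\<^sup>2 * (\<epsilon> * y)" using y by (intro mult_left_mono) auto
    then have "4 * y\<^sup>2 + 2 \<le> \<epsilon> * (2 * y ^ 3)"
      using y4 by (simp add: power2_eq_square power3_eq_cube algebra_simps)
    then show "real Q + 2 * real H + 2 \<le> (1 + \<epsilon>) * real Q"
      unfolding QH by (simp add: algebra_simps)
    have "2 * (2 * real Q + real H + 3) \<le> 3 * (4 * y ^ 3)"
    proof -
      have "2 * y\<^sup>2 \<le> y * y\<^sup>2" using y by (intro mult_right_mono) auto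
      then have "2 * y\<^sup>2 \<le> y ^ 3" "8 \<le> y ^ 3"
        using y4 by (simp_all add: power3_eq_cube power2_eq_square)
      then show ?thesis unfolding QH by simp
    qed
    also have "\<dots> \<le> \<epsilon> * y * (4 * y ^ 3)" using y by (intro mult_right_mono) auto
    also have "\<dots> = \<epsilon> * (real H)\<^sup>2" unfolding QH by (simp add: power2_eq_square power3_eq_cube)
    finally show "2 * ((2 * real Q + real H + 3) / (real H)\<^sup>2) \<le> \<epsilon>"
      using y by (simp add: QH pos_divide_le_eq)
    \<comment> \<open>28 = 16 + 8 + 4, from \<open>2 * y ^ 3 + 2 * y ^ 2 + 4\<close> with
      \<open>y \<le> 2 * w\<close> and \<open>1 < w\<close>.\<close>
    have L: "real (L + 3) \<le> 28 * w ^ 3"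
    proof -
      have "real (L + 3) = 2 * y ^ 3 + 2 * y\<^sup>2 + 4" using QH by (simp add: L_def)
      then show ?thesis using yw w3 by linarith
    qed
    \<comment> \<open>64 = 2 * 2 ^ 5, because \<open>6 / \<epsilon> = 2 * w\<close>.\<close>
    also have "\<dots> \<le> 64 * w ^ 5" using w3 by linarith
    also have "\<dots> = 2 * (6 / \<epsilon>) ^ 5" by (simp add: w_def power_divide)
    finally show "real (L + 3) \<le> 2 * (6 / \<epsilon>) ^ 5" .
    have "real (L + 1) \<le> 28 * w ^ 3" using L by simp
    then have "(real (L + 1))\<^sup>2 \<le> (28 * w ^ 3)\<^sup>2" by (rule power_mono) simp
    also have "\<dots> = 784 * w ^ 6" by (simp add: power_mult_distrib flip: power_mult)
    also have "\<dots> \<le> 784 * w ^ 10" using w by (intro mult_left_mono power_increasing) auto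
    also have "\<dots> = 784 * 3 ^ 10 / \<epsilon> ^ 10" by (simp add: w_def power_divide)
    finally show "(real (L + 1))\<^sup>2 \<le> 784 * 3 ^ 10 / \<epsilon> ^ 10" .
  qed (simp add: L_def)
qed

text \<open>\<open>A\<close> has to cover both the table, that is the input plus one cell per unit
  of planning time, and the time of one decision.\<close>

lemma planner_decider:
  fixes Ds :: "real measure list"
  assumes Ds: "Ds \<noteq> []" "\<forall>D \<in> set Ds. item_distribution D" and C: "1 \<le> C"
    and par: "0 < Q" "0 < H" "L = Q + H + 1"
      "real Q + 2 * real H + 2 \<le> (1 + \<epsilon>) * real Q"
      "2 * ((2 * real Q + real H + 3) / (real H)\<^sup>2) \<le> \<epsilon>"
    and A: "A = 900 * (L + 1)\<^sup>2 + 60 * (L + 1) + 700"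
  shows "\<exists>t s P. exec (cdf_answers Ds) (planner L Q) (input_memory \<epsilon> C (length Ds)) t s \<and>
    t \<le> 900 * (L + 1)\<^sup>2 * length Ds ^ (L + 3) \<and>
    represents (decider L Q H) s (A * length Ds ^ (L + 3)) (length Ds) P \<and>
    admissible (1 + \<epsilon>) (length Ds) P \<and>
    expected_cost (1 + \<epsilon>) C Ds P \<le> (1 + \<epsilon>) * cost_OPT C Ds"
proof -
  define n where "n = length Ds"
  have pos: "0 < n" using Ds by (simp add: n_def)
  define s0 where "s0 = input_memory \<epsilon> C n"
  have s0: "nmem s0 ''n'' 0 = n" "rmem s0 ''C'' 0 = C" "nmem s0 ''pw'' = (\<lambda>_. 0)" "rmem s0 ''pen'' = (\<lambda>_. 0)"
    "rmem s0 ''V'' = (\<lambda>_. 0)" "nmem s0 ''j'' = (\<lambda>_. 0)" "nmem s0 ''code'' = (\<lambda>_. 0)" "nmem s0 ''opened'' = (\<lambda>_. 0)"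
    "nmem s0 ''level'' = (\<lambda>_. 0)" "rmem s0 ''drift'' = (\<lambda>_. 0)"
    by (simp_all add: s0_def input_memory_def mem_simps)
  obtain t s where ex: "exec (cdf_answers Ds) (planner L Q) s0 t s"
    and t: "t \<le> 900 * (n * (L + 1)) * (L + 1) * n ^ (L + 1) * n" and r: "ready n L C s"
    and table: "plan_table (cdf_answers Ds) n L Q C (rmem s ''V'') (nmem s ''Act'')"
    and ag: "agree (written (planner L Q)) s0 s"
    using wp_agree[OF wp_planner[OF s0(1) pos s0(2-5)], of "cdf_answers Ds" L Q] unfolding wp_def by blast
  define V Act where "V = rmem s ''V''" and "Act = nmem s ''Act''"
  have t': "t \<le> 900 * (L + 1)\<^sup>2 * n ^ (L + 3)"
  proof -
    have "L + 3 = Suc (Suc (L + 1))" by simp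
    then have "900 * (n * (L + 1)) * (L + 1) * n ^ (L + 1) * n = 900 * (L + 1)\<^sup>2 * n ^ (L + 3)"
      by (simp only: power_Suc power2_eq_square mult_ac)
    with t show ?thesis by simp
  qed
  have s: "nmem s ''j'' 0 = 0" "nmem s ''code'' 0 = 0" "nmem s ''opened'' 0 = 0"
    "nmem s ''level'' = (\<lambda>_. 0)" "rmem s ''drift'' = (\<lambda>_. 0)"
    using ag s0 unfolding written_planner by (simp_all add: agree_def)
  interpret planned Ds C n Q H L V Act
    by standard (use pos par Ds C table in \<open>auto simp: n_def V_def Act_def\<close>)
  have one: "1 \<le> n ^ (L + 3)" "n \<le> n ^ (L + 3)"
    using pos by (simp_all add: one_le_power self_le_power Suc_le_eq del: power_Suc One_nat_def)
  have "represents (decider L Q H) s (A * n ^ (L + 3)) n plan_policy"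
    unfolding represents_def
  proof (intro conjI allI impI)
    have "table_size_le s (3 + t)"
      using exec_table_size[OF ex] table_size_input by (simp add: s0_def)
    moreover have "3 + t \<le> A * n ^ (L + 3)"
    proof -
      have "3 + t \<le> 3 * n ^ (L + 3) + 900 * (L + 1)\<^sup>2 * n ^ (L + 3)"
        using t' one by linarith
      also have "\<dots> = (3 + 900 * (L + 1)\<^sup>2) * n ^ (L + 3)" by (rule distrib_right[symmetric])
      also have "\<dots> \<le> A * n ^ (L + 3)" by (rule mult_le_mono1) (simp add: A)
      finally show ?thesis .
    qed
    ultimately show "table_size_le s (A * n ^ (L + 3))" by (rule table_size_le_mono)
  next
    fix x :: "nat \<Rightarrow> real" and i
    assume x: "\<forall>j<n. 0 \<le> x j" and i: "i < n"
    have "\<exists>s'. decides (decider L Q H) (n * (L + 1) * 60 + n * 40 + 600) s (map x [0..<i]) s' \<and>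
      (case place n L H Act i (pack x i) of (b, p) \<Rightarrow>
        stored n L C V Act p s' \<and> nmem s' ''j'' 0 = Suc i \<and> nmem s' ''bin'' 0 = b)"
    proof (rule decides_packings[OF pos par(1) r V_def[symmetric] Act_def[symmetric] s refl _ i])
      fix i p assume "i < n" "p = pack x i" "Act (i * n ^ (L + 1) + code p) \<le> L"
      then show "\<exists>b<n. level p b = Act (i * n ^ (L + 1) + code p)"
        using plan_action[of i x] x by simp
    qed
    then obtain s' where s': "decides (decider L Q H) (n * (L + 1) * 60 + n * 40 + 600) s (map x [0..<i]) s'"
      "nmem s' ''bin'' 0 = choice plan_policy x i"
      unfolding choice_plan case_prod_beta by blast
    have "n * (L + 1) * 60 + n * 40 + 600 \<le> A * n ^ (L + 3)"
    proof -
      have "n * (L + 1) * 60 + n * 40 + 600 \<le> (60 * (L + 1) + 640) * n"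
        using pos by (simp add: algebra_simps)
      also have "\<dots> \<le> A * n ^ (L + 3)" by (rule mult_le_mono[OF _ one(2)]) (simp add: A)
      finally show ?thesis .
    qed
    with s' show "\<exists>s'. decides (decider L Q H) (A * n ^ (L + 3)) s (map x [0..<i]) s' \<and>
        nmem s' ''bin'' 0 = choice plan_policy x i"
      using decides_mono by blast
  qed
  moreover have "admissible (1 + \<epsilon>) n plan_policy" using par(4) by (rule admissible_plan)
  moreover have "expected_cost (1 + \<epsilon>) C Ds plan_policy \<le> (1 + \<epsilon>) * cost_OPT C Ds"
    using par(4,5) by (rule plan_cost_le_OPT)
  ultimately show ?thesis using ex t' unfolding s0_def n_def by blast
qed

theorem theorem1p5:
  shows "\<exists>K::real. \<forall>\<epsilon>::real. 0 < \<epsilon> \<and> \<epsilon> \<le> sqrt 6 * (sqrt 15 - 3) \<longrightarrow>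
    (\<exists>(alg::com) (dec::com) (A::nat) (k::nat).
      \<forall>(Ds::real measure list) (C::real).
        Ds \<noteq> [] \<and> (\<forall>D \<in> set Ds. item_distribution D) \<and> 1 \<le> C \<longrightarrow>
        (\<exists>(t::nat) (s::memory) (P::policy).
           exec (cdf_answers Ds) alg (input_memory \<epsilon> C (length Ds)) t s \<and>
           real t \<le> K * (real (length Ds) powr (2 * (6 / \<epsilon>) ^ 5) / \<epsilon> ^ 10) \<and>
           represents dec s (A * length Ds ^ k) (length Ds) P \<and>
           admissible (1 + \<epsilon>) (length Ds) P \<and>
           expected_cost (1 + \<epsilon>) C Ds P \<le> (1 + \<epsilon>) * cost_OPT C Ds))"
\<comment> \<open>900 is the factor in the planner's time, and
  \<open>784 * 3 ^ 10 / \<epsilon> ^ 10\<close> bounds \<open>(L + 1) ^ 2\<close>.\<close>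
proof (intro exI[of _ "900 * (784 * 3 ^ 10)"] allI impI, elim conjE)
  fix \<epsilon> :: real
  assume \<epsilon>: "0 < \<epsilon>" "\<epsilon> \<le> sqrt 6 * (sqrt 15 - 3)"
  then have "\<epsilon> < 3" using sqrt_bound_less by linarith
  then obtain Q H L :: nat where par: "0 < Q" "0 < H" "L = Q + H + 1"
    "real Q + 2 * real H + 2 \<le> (1 + \<epsilon>) * real Q"
    "2 * ((2 * real Q + real H + 3) / (real H)\<^sup>2) \<le> \<epsilon>"
    and L: "real (L + 3) \<le> 2 * (6 / \<epsilon>) ^ 5" "(real (L + 1))\<^sup>2 \<le> 784 * 3 ^ 10 / \<epsilon> ^ 10"
    using parameters[of \<epsilon>] \<epsilon>(1) by metis
  define A where "A = 900 * (L + 1)\<^sup>2 + 60 * (L + 1) + 700"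
  have time: "real t \<le> 900 * (784 * 3 ^ 10) * (real m powr (2 * (6 / \<epsilon>) ^ 5) / \<epsilon> ^ 10)"
    if t: "t \<le> 900 * (L + 1)\<^sup>2 * m ^ (L + 3)" and m: "0 < m" for t m :: nat
  proof -
    have "real t \<le> 900 * (real (L + 1))\<^sup>2 * real m ^ (L + 3)"
      using of_nat_mono[OF t, where 'a = real] by (simp only: of_nat_mult of_nat_power of_nat_numeral)
    also have "real m ^ (L + 3) = real m powr real (L + 3)"
      by (rule powr_realpow[symmetric]) (use m in simp)
    also have "900 * (real (L + 1))\<^sup>2 * real m powr real (L + 3) \<le>
        900 * (784 * 3 ^ 10 / \<epsilon> ^ 10) * real m powr (2 * (6 / \<epsilon>) ^ 5)"
      using L m \<epsilon>(1) by (intro mult_mono powr_mono) auto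
    finally show ?thesis by simp
  qed
  show "\<exists>alg dec A k. \<forall>Ds C. Ds \<noteq> [] \<and> (\<forall>D \<in> set Ds. item_distribution D) \<and> 1 \<le> C \<longrightarrow>
        (\<exists>t s P. exec (cdf_answers Ds) alg (input_memory \<epsilon> C (length Ds)) t s \<and>
           real t \<le> 900 * (784 * 3 ^ 10) * (real (length Ds) powr (2 * (6 / \<epsilon>) ^ 5) / \<epsilon> ^ 10) \<and>
           represents dec s (A * length Ds ^ k) (length Ds) P \<and>
           admissible (1 + \<epsilon>) (length Ds) P \<and>
           expected_cost (1 + \<epsilon>) C Ds P \<le> (1 + \<epsilon>) * cost_OPT C Ds)"
  \<comment> \<open>Both programs are fixed by \<open>L\<close>, \<open>Q\<close> and
    \<open>H\<close>, which depend on \<open>\<epsilon>\<close> alone; so they can be chosen before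
    the items and the penalty.\<close>
  proof (rule exI[of _ "planner L Q"], rule exI[of _ "decider L Q H"], rule exI[of _ A],
      rule exI[of _ "L + 3"], intro allI impI, elim conjE)
    fix Ds :: "real measure list" and C :: real
    assume Ds: "Ds \<noteq> []" "\<forall>D \<in> set Ds. item_distribution D" and C: "1 \<le> C"
    have "0 < length Ds" using Ds by simp
    with planner_decider[OF Ds C par A_def] time
    show "\<exists>t s P. exec (cdf_answers Ds) (planner L Q) (input_memory \<epsilon> C (length Ds)) t s \<and>
           real t \<le> 900 * (784 * 3 ^ 10) * (real (length Ds) powr (2 * (6 / \<epsilon>) ^ 5) / \<epsilon> ^ 10) \<and>
           represents (decider L Q H) s (A * length Ds ^ (L + 3)) (length Ds) P \<and>
           admissible (1 + \<epsilon>) (length Ds) P \<and>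
           expected_cost (1 + \<epsilon>) C Ds P \<le> (1 + \<epsilon>) * cost_OPT C Ds"
      by blast
  qed
qed

end
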